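(* Let $B_1^2 \subset \mathbb{R}^2$ be the unit ball, let $a>1$ and $q\ge 2$, and write $Y = L^q\left(B_1^2;\ |x|^{-2}\left(\log\frac{a}{|x|}\right)^{-1-\frac q2}dx\right)$. Then: (1) the embedding $H_0^1(B_1^2)\hookrightarrow Y$ is non-compact; (2) the embedding $H^1_{0,\mathrm{rad}}(B_1^2)\hookrightarrow Y$ is non-compact; (3) the embedding $\left(H^1_{0,\mathrm{rad}}(B_1^2)\right)^{\perp}\hookrightarrow Y$ is compact.
   Context: $B_1^2=\{x\in\mathbb{R}^2: |x|<1\}$. $H_0^1(B_1^2)$ is the completion of $C_0^\infty(B_1^2)$ with respect to the norm $\|\nabla u\|_{L^2}$; it is a Hilbert space with inner product $(u,v)=\int_{B_1^2}\nabla u\cdot\nabla v\,dx$. $H^1_{0,\mathrm{rad}}(B_1^2)$ is the closed subspace of radial functions in $H_0^1(B_1^2)$, and $(H^1_{0,\mathrm{rad}}(B_1^2))^\perp$ is its orthogonal complement in $H_0^1(B_1^2)$. $L^q(B_1^2; w\,dx)$ is the weighted Lebesgue space with norm $\left(\int_{B_1^2}|u|^q w\,dx\right)^{1/q}$. A continuous embedding $X\hookrightarrow Y$ is compact if every bounded sequence in $X$ has a subsequence converging in $Y$, and non-compact otherwise. *)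

theory Defs
  imports "HOL-Analysis.Analysis"
begin

subsection \<open>Lebesgue spaces\<close>

text \<open>Elements of function spaces are represented by functions; functions that agree almost
  everywhere are not identified, and the norms below are seminorms on representatives.\<close>

definition Lp_space :: "'a measure \<Rightarrow> real \<Rightarrow> ('a \<Rightarrow> 'b::euclidean_space) set" where
  "Lp_space M p = {u \<in> borel_measurable M. integrable M (\<lambda>x. norm (u x) powr p)}"

definition Lp_norm :: "'a measure \<Rightarrow> real \<Rightarrow> ('a \<Rightarrow> 'b::euclidean_space) \<Rightarrow> real" where
  "Lp_norm M p u = (\<integral>x. norm (u x) powr p \<partial>M) powr (1 / p)"

definition Lp_tendsto ::
  "'a measure \<Rightarrow> real \<Rightarrow> (nat \<Rightarrow> 'a \<Rightarrow> 'b::euclidean_space) \<Rightarrow> ('a \<Rightarrow> 'b) \<Rightarrow> bool" where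
  "Lp_tendsto M p f u \<longleftrightarrow>
     (\<forall>n. f n \<in> Lp_space M p) \<and> u \<in> Lp_space M p \<and>
     (\<lambda>n. Lp_norm M p (\<lambda>x. f n x - u x)) \<longlonglongrightarrow> 0"


subsection \<open>Test functions\<close>

primrec Ck :: "nat \<Rightarrow> ('a::euclidean_space \<Rightarrow> real) \<Rightarrow> bool" where
  "Ck 0 f \<longleftrightarrow> continuous_on UNIV f"
| "Ck (Suc k) f \<longleftrightarrow>
     (\<forall>x. f differentiable (at x)) \<and> (\<forall>v. Ck k (\<lambda>x. frechet_derivative f (at x) v))"

definition test_functions :: "'a::euclidean_space set \<Rightarrow> ('a \<Rightarrow> real) set" where
  "test_functions \<Omega> =
     {\<phi>. (\<forall>k. Ck k \<phi>) \<and> compact (closure {x. \<phi> x \<noteq> 0}) \<and> closure {x. \<phi> x \<noteq> 0} \<subseteq> \<Omega>}"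

definition gradient :: "('a::euclidean_space \<Rightarrow> real) \<Rightarrow> 'a \<Rightarrow> 'a" where
  "gradient f x = (\<Sum>b\<in>Basis. frechet_derivative f (at x) b *\<^sub>R b)"


subsection \<open>The space $H_0^1$ of the unit disc\<close>

abbreviation disc :: "(real^2) set" where
  "disc \<equiv> ball 0 1"

abbreviation disc_measure :: "(real^2) measure" where
  "disc_measure \<equiv> lebesgue_on disc"

text \<open>The completion of the test functions under the norm $\|\nabla u\|_{L^2}$ is realised as a
  space of functions: by Poincare's inequality on the disc, a sequence of test functions whose
  gradients are Cauchy in $L^2$ is itself Cauchy in $L^2$, and the element of the completion that it
  represents is identified with its $L^2$ limit \<open>u\<close>. The limit \<open>g\<close> of the gradients is, up to null
  sets, determined by \<open>u\<close> (integrate by parts against test functions), so the choice made in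
  \<open>weak_gradient\<close> is immaterial.\<close>

definition has_H01_gradient :: "(real^2 \<Rightarrow> real) \<Rightarrow> (real^2 \<Rightarrow> real^2) \<Rightarrow> bool" where
  "has_H01_gradient u g \<longleftrightarrow>
     (\<exists>\<phi>. (\<forall>n. \<phi> n \<in> test_functions disc) \<and>
          Lp_tendsto disc_measure 2 \<phi> u \<and>
          Lp_tendsto disc_measure 2 (\<lambda>n. gradient (\<phi> n)) g)"

definition H01 :: "(real^2 \<Rightarrow> real) set" where
  "H01 = {u. \<exists>g. has_H01_gradient u g}"

definition weak_gradient :: "(real^2 \<Rightarrow> real) \<Rightarrow> real^2 \<Rightarrow> real^2" where
  "weak_gradient u = (SOME g. has_H01_gradient u g)"

definition H01_inner :: "(real^2 \<Rightarrow> real) \<Rightarrow> (real^2 \<Rightarrow> real) \<Rightarrow> real" where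
  "H01_inner u v = (\<integral>x. weak_gradient u x \<bullet> weak_gradient v x \<partial>disc_measure)"

definition H01_norm :: "(real^2 \<Rightarrow> real) \<Rightarrow> real" where
  "H01_norm u = sqrt (H01_inner u u)"

definition H01_rad :: "(real^2 \<Rightarrow> real) set" where
  "H01_rad = {u \<in> H01. \<exists>f. AE x in disc_measure. u x = f (norm x)}"

definition H01_rad_perp :: "(real^2 \<Rightarrow> real) set" where
  "H01_rad_perp = {u \<in> H01. \<forall>v\<in>H01_rad. H01_inner u v = 0}"


subsection \<open>The weighted target space\<close>

definition log_weight :: "real \<Rightarrow> real \<Rightarrow> real^2 \<Rightarrow> real" where
  "log_weight a q x = norm x powr (-2) * ln (a / norm x) powr (- 1 - q / 2)"

definition log_measure :: "real \<Rightarrow> real \<Rightarrow> (real^2) measure" where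
  "log_measure a q = density disc_measure (\<lambda>x. ennreal (log_weight a q x))"


subsection \<open>Embeddings\<close>

text \<open>A space is given by a set of functions together with its (semi)norm.\<close>

definition continuous_embedding ::
  "('a \<Rightarrow> real) set \<Rightarrow> (('a \<Rightarrow> real) \<Rightarrow> real) \<Rightarrow> ('a \<Rightarrow> real) set \<Rightarrow> (('a \<Rightarrow> real) \<Rightarrow> real) \<Rightarrow> bool"
  where
  "continuous_embedding X nX Y nY \<longleftrightarrow> X \<subseteq> Y \<and> (\<exists>C. \<forall>u\<in>X. nY u \<le> C * nX u)"

definition compact_embedding ::
  "('a \<Rightarrow> real) set \<Rightarrow> (('a \<Rightarrow> real) \<Rightarrow> real) \<Rightarrow> ('a \<Rightarrow> real) set \<Rightarrow> (('a \<Rightarrow> real) \<Rightarrow> real) \<Rightarrow> bool"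
  where
  "compact_embedding X nX Y nY \<longleftrightarrow>
     continuous_embedding X nX Y nY \<and>
     (\<forall>u. (\<forall>n. u n \<in> X) \<and> bounded (range (\<lambda>n. nX (u n))) \<longrightarrow>
        (\<exists>r::nat \<Rightarrow> nat. strict_mono r \<and>
           (\<exists>v\<in>Y. (\<lambda>n. nY (\<lambda>x. u (r n) x - v x)) \<longlonglongrightarrow> 0)))"

text \<open>Non-compactness is a property of continuous embeddings, so continuity is part of it.\<close>

definition noncompact_embedding ::
  "('a \<Rightarrow> real) set \<Rightarrow> (('a \<Rightarrow> real) \<Rightarrow> real) \<Rightarrow> ('a \<Rightarrow> real) set \<Rightarrow> (('a \<Rightarrow> real) \<Rightarrow> real) \<Rightarrow> bool"
  where
  "noncompact_embedding X nX Y nY \<longleftrightarrow>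
     continuous_embedding X nX Y nY \<and> \<not> compact_embedding X nX Y nY"

end

theory Submission
  imports Defs "HOL-Complex_Analysis.Great_Picard"
begin

text \<open>
  Write \<open>A = ln a\<close> and, for a test function \<open>f\<close>, let \<open>avg f\<close> be its average over rotations. Averaging is
  the orthogonal projection onto radial functions for the Dirichlet product.

  For radial \<open>f\<close> put \<open>H t = f (e\<^sup>-\<^sup>t e\<^sub>1)\<close>. The measure \<open>|x|\<^sup>-\<^sup>2 dx\<close> becomes \<open>2\<pi> dt\<close>, the Dirichlet
  integral becomes \<open>2\<pi> \<integral> H'\<^sup>2 dt\<close>, and \<open>|H t| \<le> \<surd>t\<close> for unit energy. Hence
  \<open>|H|\<^sup>q (t + A) powr (-1 - q/2) \<le> H\<^sup>2 / (t + A)\<^sup>2\<close>, which Hardy's inequality controls. This estimate is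
  invariant under dilations of \<open>t\<close>, and the profiles \<open>\<surd>k min(1, t/k)\<close> show that it is not compact.

  If \<open>avg f = 0\<close>, integrating along circles gives \<open>\<integral> f\<^sup>2 / |x|\<^sup>2 \<le> 4\<pi>\<^sup>2 \<integral> |\<nabla>f|\<^sup>2\<close>, and the inequality
  \<open>\<parallel>g\<parallel>\<^sub>2 \<le> \<parallel>\<nabla>g\<parallel>\<^sub>1\<close> for \<open>g = f\<^sup>m / |x|\<close> yields inductively bounds for all \<open>\<integral> f\<^sup>2\<^sup>m / |x|\<^sup>2\<close>, without any
  logarithmic factor. The factor \<open>(ln (a / |x|)) powr (-1 - q/2)\<close> of the weight therefore makes the
  contribution of small balls uniformly small, while away from the origin Rellich's theorem applies.
\<close>

text \<open>Elements of \<open>H01\<close> are only limits of test functions and the weight is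
  singular at the origin. Estimates are therefore proved for C1 functions of bounded support with
  constants independent of the function, and carried to the limit by Fatou's lemma. The exponent -1
  - q/2 is critical: a profile growing like the square root of t has a weighted q-th power of size
  1/t, so no decay is left over to stop a sequence from escaping to t = infinity. On the complement
  the obstacle is that orthogonality to radial functions is a condition on weak gradients and says
  nothing directly about circles. It is turned into vanishing circular means by subtracting radial
  averages from the approximating test functions. The moment bounds then give an inequality of
  Ehrling type: at bounded energy the weighted mass is at most K times the L^1 norm plus an
  arbitrarily small error. Applied to differences it upgrades L^1 Cauchy sequences, so Rellich's
  theorem is used in L^1 only.\<close>

abbreviation energy :: "'a measure \<Rightarrow> ('a \<Rightarrow> 'b::real_normed_vector) \<Rightarrow> real" where
  "energy M g \<equiv> (\<integral>x. (norm (g x))\<^sup>2 \<partial>M)"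

text \<open>Valued in \<open>ennreal\<close>, so that bounds can be stated and passed through
  Fatou's lemma before integrability against the weight is known.\<close>

abbreviation powr_mass :: "'a measure \<Rightarrow> real \<Rightarrow> ('a \<Rightarrow> real) \<Rightarrow> ennreal" where
  "powr_mass M q u \<equiv> (\<integral>\<^sup>+x. ennreal (\<bar>u x\<bar> powr q) \<partial>M)"

abbreviation moment :: "nat \<Rightarrow> (real^2 \<Rightarrow> real) \<Rightarrow> ennreal" where
  "moment m f \<equiv> (\<integral>\<^sup>+x. ennreal (f x ^ (2 * m) / (norm x)\<^sup>2) \<partial>lborel)"

subsection \<open>Continuously differentiable functions of bounded support\<close>

lemma integrable_lborel_cont_bounded_support:
  fixes f :: "'a::euclidean_space \<Rightarrow> 'b::{banach, second_countable_topology}"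
  assumes "continuous_on UNIV f" and "\<And>x. norm x > B \<Longrightarrow> f x = 0"
  shows "integrable lborel f"
proof -
  have "integrable lborel (\<lambda>x. indicator (cball 0 B) x *\<^sub>R f x)"
    by (intro borel_integrable_compact continuous_on_subset[OF assms(1)]) auto
  moreover have "(\<lambda>x. indicator (cball 0 B) x *\<^sub>R f x) = f"
    using assms(2) by (force simp: indicator_def)
  ultimately show ?thesis by simp
qed

text \<open>Fubini over the unit interval times a ball, followed by the invariance of Lebesgue
  measure under each \<open>T t\<close>; the last hypothesis confines the integrand to a compact
  set. Two flows use this: the translations x + t v and the rotations.\<close>

lemma integral_average:
  fixes G :: "'a::euclidean_space \<Rightarrow> real" and T :: "real \<Rightarrow> 'a \<Rightarrow> 'a"
  assumes G: "continuous_on UNIV G" and T: "continuous_on UNIV (\<lambda>(t,x). T t x)"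
    and inv: "\<And>t. distr lborel borel (T t) = lborel"
    and B: "\<And>t x. t \<in> {0..1} \<Longrightarrow> norm x > B \<Longrightarrow> G (T t x) = 0"
  shows continuous_on_average: "continuous_on UNIV (\<lambda>x. integral {0..1} (\<lambda>t. G (T t x)))"
    and integrable_average: "integrable lborel (\<lambda>x. integral {0..1} (\<lambda>t. G (T t x)))"
    and integral_average_eq:
      "(\<integral>x. integral {0..1} (\<lambda>t. G (T t x)) \<partial>lborel) = (\<integral>x. G x \<partial>lborel)"
proof -
  have GT: "continuous_on S (\<lambda>(t,x). G (T t x))" for S
    using continuous_on_compose2[OF G T]
    by (auto simp: case_prod_unfold intro: continuous_on_subset)
  have GTt: "continuous_on S (\<lambda>t. G (T t x))" for S x
  proof -
    have "continuous_on S (\<lambda>t. (\<lambda>(t,x). G (T t x)) (t, x))"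
      by (rule continuous_on_compose2[OF GT[of UNIV]]) (auto intro!: continuous_intros)
    then show ?thesis by simp
  qed
  have Tt: "continuous_on S (\<lambda>x. T t x)" for S t
  proof -
    have "continuous_on S (\<lambda>x. (\<lambda>(t,x). T t x) (t, x))"
      by (rule continuous_on_compose2[OF T]) (auto intro!: continuous_intros)
    then show ?thesis by simp
  qed
  have "continuous_on (UNIV \<times> cbox 0 1) (\<lambda>(x,t). G (T t x))"
  proof -
    have "continuous_on (UNIV \<times> cbox 0 1) (\<lambda>p. (\<lambda>(t,x). G (T t x)) (snd p, fst p))"
      by (rule continuous_on_compose2[OF GT[of UNIV]]) (auto intro!: continuous_intros)
    then show ?thesis by (simp add: case_prod_unfold)
  qed
  from integral_continuous_on_param[OF this]
  show 1: "continuous_on UNIV (\<lambda>x. integral {0..1} (\<lambda>t. G (T t x)))" by simp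
  show "integrable lborel (\<lambda>x. integral {0..1} (\<lambda>t. G (T t x)))"
  proof (rule integrable_lborel_cont_bounded_support[OF 1])
    fix x :: 'a assume x: "norm x > B"
    have "integral {0..1} (\<lambda>t. G (T t x)) = integral {0..1::real} (\<lambda>t. 0)"
      by (intro integral_cong) (use B x in auto)
    then show "integral {0..1} (\<lambda>t. G (T t x)) = 0" by simp
  qed
  define F where "F = (\<lambda>p. indicator ({0..1} \<times> cball 0 B) p *\<^sub>R (case p of (t,x) \<Rightarrow> G (T t x)))"
  have F: "F (t,x) = indicator {0..1} t * G (T t x)" for t x
    using B[of t x] by (auto simp: F_def indicator_def)
  have "integrable lborel F" unfolding F_def
    by (intro borel_integrable_compact GT compact_Times) auto
  then have iF: "integrable (lborel \<Otimes>\<^sub>M lborel) (\<lambda>(t,x). F (t,x))"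
    by (simp add: lborel_prod)
  have s: "(\<integral>t. F (t,x) \<partial>lborel) = integral {0..1} (\<lambda>t. G (T t x))" for x
  proof -
    have "set_integrable lborel {0..1} (\<lambda>t. G (T t x))"
      unfolding set_integrable_def by (intro borel_integrable_compact GTt) auto
    from set_borel_integral_eq_integral(2)[OF this] show ?thesis
      by (simp add: F set_lebesgue_integral_def)
  qed
  have m: "(\<integral>x. F (t,x) \<partial>lborel) = indicator {0..1} t * (\<integral>x. G x \<partial>lborel)" for t
  proof -
    have [measurable]: "T t \<in> borel_measurable borel" "G \<in> borel_measurable borel"
      by (auto intro!: borel_measurable_continuous_onI Tt G)
    have "(\<integral>x. G x \<partial>lborel) = (\<integral>x. G x \<partial>distr lborel borel (T t))" by (simp add: inv)
    also have "\<dots> = (\<integral>x. G (T t x) \<partial>lborel)" by (subst integral_distr) auto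
    finally show ?thesis by (simp add: F)
  qed
  have "(\<integral>x. (\<integral>t. F (t,x) \<partial>lborel) \<partial>lborel) = (\<integral>t. (\<integral>x. F (t,x) \<partial>lborel) \<partial>lborel)"
    by (rule lborel_pair.Fubini_integral[OF iF])
  then show "(\<integral>x. integral {0..1} (\<lambda>t. G (T t x)) \<partial>lborel) = (\<integral>x. G x \<partial>lborel)"
    by (simp add: s m)
qed

text \<open>Jensen's inequality on the unit interval, from the nonnegative integral of (f - c)^2
  with c the mean of f.\<close>

lemma integral_01_square_le:
  fixes f :: "real \<Rightarrow> real"
  assumes "continuous_on {0..1} f"
  shows "(integral {0..1} f)\<^sup>2 \<le> integral {0..1} (\<lambda>t. (f t)\<^sup>2)"
proof -
  define c where "c = integral {0..1} f"
  have i: "(f has_integral c) {0..1}"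
    "((\<lambda>t. (f t)\<^sup>2) has_integral integral {0..1} (\<lambda>t. (f t)\<^sup>2)) {0..1}"
    unfolding c_def
    by (auto intro!: integrable_integral integrable_continuous_real continuous_intros assms)
  have "((\<lambda>t. (f t)\<^sup>2 - (2 * c) * f t + c\<^sup>2) has_integral
      integral {0..1} (\<lambda>t. (f t)\<^sup>2) - (2 * c) * c + c\<^sup>2) {0..1}"
    using has_integral_const_real[of "c\<^sup>2" 0 1]
    by (intro has_integral_add has_integral_diff has_integral_mult_right i) auto
  moreover have "(\<lambda>t. (f t)\<^sup>2 - (2 * c) * f t + c\<^sup>2) = (\<lambda>t. (f t - c)\<^sup>2)"
    by (auto simp: power2_eq_square algebra_simps)
  ultimately have "0 \<le> integral {0..1} (\<lambda>t. (f t)\<^sup>2) - (2 * c) * c + c\<^sup>2"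
    by (metis (no_types, lifting) has_integral_nonneg zero_le_power2)
  then show ?thesis by (simp add: c_def power2_eq_square)
qed

text \<open>The gradient is an explicit second argument, so that averages, powers and weighted
  products come with a formula for it. Test functions are the case g =
  \<open>gradient f\<close>.\<close>

definition C1c :: "('a::euclidean_space \<Rightarrow> real) \<Rightarrow> ('a \<Rightarrow> 'a) \<Rightarrow> bool" where
  "C1c f g \<longleftrightarrow> (\<forall>x. (f has_derivative (\<lambda>v. g x \<bullet> v)) (at x)) \<and> continuous_on UNIV g \<and>
     bounded {x. f x \<noteq> 0}"

lemma C1cD:
  assumes "C1c f g"
  shows C1c_deriv: "\<And>x S. (f has_derivative (\<lambda>v. g x \<bullet> v)) (at x within S)"
    and C1c_cont_grad: "\<And>S. continuous_on S g"
    and C1c_cont: "\<And>S. continuous_on S f"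
proof -
  show d: "(f has_derivative (\<lambda>v. g x \<bullet> v)) (at x within S)" for x S
    using assms by (auto simp: C1c_def intro: has_derivative_at_withinI)
  show "continuous_on S g" for S
    using assms by (auto simp: C1c_def intro: continuous_on_subset)
  show "continuous_on S f" for S
    by (rule has_derivative_continuous_on[OF d])
qed

lemma C1c_support:
  assumes "C1c f g"
  obtains B where "B > 0" "\<And>x. norm x > B \<Longrightarrow> f x = 0" "\<And>x. norm x > B \<Longrightarrow> g x = 0"
proof -
  from assms obtain B where B: "B > 0" "\<And>x. f x \<noteq> 0 \<Longrightarrow> norm x \<le> B"
    unfolding C1c_def bounded_pos by auto
  have "g x = 0" if "norm x > B" for x
  proof -
    have "(f has_derivative (\<lambda>v. 0)) (at x)"
    proof (rule has_derivative_transform_within_open[where s = "- cball 0 B"])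
      show "((\<lambda>x. 0) has_derivative (\<lambda>v. 0)) (at x)" by auto
    qed (use B(2) that in force)+
    from has_derivative_unique[OF this C1c_deriv[OF assms]] have "g x \<bullet> g x = 0"
      by metis
    then show ?thesis by simp
  qed
  then show ?thesis using B that by force
qed

lemma C1c_measurable:
  assumes "C1c f g"
  shows "f \<in> borel_measurable borel" "g \<in> borel_measurable borel"
  by (intro borel_measurable_continuous_onI C1cD[OF assms])+

lemma C1c_integrable:
  assumes "C1c f g"
  shows "integrable lborel f" "integrable lborel g" "integrable lborel (\<lambda>x. norm (g x))"
    "integrable lborel (\<lambda>x. (norm (g x))\<^sup>2)"
    "integrable lborel (\<lambda>x. \<bar>f x\<bar>)" "integrable lborel (\<lambda>x. (f x)\<^sup>2)"
    "integrable lborel (\<lambda>x. g x \<bullet> v)"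
proof -
  obtain B where "\<And>x. norm x > B \<Longrightarrow> f x = 0" "\<And>x. norm x > B \<Longrightarrow> g x = 0"
    using C1c_support[OF assms] by metis
  then show "integrable lborel f" "integrable lborel g" "integrable lborel (\<lambda>x. norm (g x))"
    "integrable lborel (\<lambda>x. (norm (g x))\<^sup>2)"
    "integrable lborel (\<lambda>x. \<bar>f x\<bar>)" "integrable lborel (\<lambda>x. (f x)\<^sup>2)"
    "integrable lborel (\<lambda>x. g x \<bullet> v)"
    by (auto intro!: integrable_lborel_cont_bounded_support[of _ B] continuous_intros
        C1cD[OF assms])
qed

lemma C1c_FTC:
  fixes p :: "real \<Rightarrow> 'a::euclidean_space"
  assumes "C1c f g" and "\<And>t. (p has_vector_derivative p' t) (at t)" and "a \<le> b"
  shows "((\<lambda>t. g (p t) \<bullet> p' t) has_integral f (p b) - f (p a)) {a..b}"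
proof (rule fundamental_theorem_of_calculus[OF \<open>a \<le> b\<close>])
  fix t
  have "((\<lambda>t. f (p t)) has_derivative (\<lambda>h. g (p t) \<bullet> (h *\<^sub>R p' t))) (at t)"
    using assms(2)[of t] unfolding has_vector_derivative_def
    by (rule has_derivative_compose) (rule C1c_deriv[OF assms(1)])
  then show "((\<lambda>t. f (p t)) has_vector_derivative g (p t) \<bullet> p' t) (at t within {a..b})"
    by (auto simp: has_vector_derivative_def intro: has_derivative_at_withinI)
qed

text \<open>The fundamental theorem writes f (x + v) - f x as the mean of g (x + t v) \<bullet> v
  over t. Integrating in x, translation invariance kills the left side, which is the second claim;
  taking absolute values first yields the other. The first claim is the modulus of continuity behind
  Rellich's theorem, the second the root of integration by parts.\<close>

lemma C1c_translate:
  fixes f :: "'a::euclidean_space \<Rightarrow> real"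
  assumes "C1c f g"
  shows integral_translate_diff_le:
      "(\<integral>x. \<bar>f (x + v) - f x\<bar> \<partial>lborel) \<le> norm v * (\<integral>x. norm (g x) \<partial>lborel)"
    and integral_gradient_eq_0: "(\<integral>x. g x \<bullet> v \<partial>lborel) = 0"
proof -
  obtain B where B: "B > 0" "\<And>x. norm x > B \<Longrightarrow> f x = 0" "\<And>x. norm x > B \<Longrightarrow> g x = 0"
    using C1c_support[OF assms] by metis
  have T: "continuous_on UNIV (\<lambda>(t::real,x). x + t *\<^sub>R v)"
    by (auto simp: case_prod_unfold intro!: continuous_intros)
  have inv: "distr lborel borel (\<lambda>x. x + t *\<^sub>R v) = lborel" for t
    using lborel_distr_plus[of "t *\<^sub>R v"] by (simp add: add.commute[of _ "t *\<^sub>R v"] cong: distr_cong)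
  have far: "norm (x + t *\<^sub>R v) > B" if "t \<in> {0..1}" "norm x > B + norm v" for t x
  proof -
    have "norm (t *\<^sub>R v) \<le> norm v" using that(1) by (simp add: mult_left_le_one_le)
    then show ?thesis using norm_diff_ineq[of x "t *\<^sub>R v"] that(2) by linarith
  qed
  have fd: "((\<lambda>t. g (x + t *\<^sub>R v) \<bullet> v) has_integral f (x + v) - f x) {0..1}" for x
  proof -
    have "((\<lambda>t. x + t *\<^sub>R v) has_vector_derivative v) (at t)" for t
      by (auto intro!: derivative_eq_intros simp: has_vector_derivative_def)
    from C1c_FTC[OF assms this, of 0 1] show ?thesis by simp
  qed
  note cg = C1c_cont_grad[OF assms]
  have shift: "integrable lborel (\<lambda>x. f (x + v))" "(\<integral>x. f (x + v) \<partial>lborel) = (\<integral>x. f x \<partial>lborel)"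
  proof -
    have [measurable]: "f \<in> borel_measurable borel"
      by (intro borel_measurable_continuous_onI C1c_cont[OF assms])
    show "integrable lborel (\<lambda>x. f (x + v))"
      using C1c_integrable(1)[OF assms] inv[of 1] integrable_distr[of "\<lambda>x. x + v" lborel borel f]
      by simp
    show "(\<integral>x. f (x + v) \<partial>lborel) = (\<integral>x. f x \<partial>lborel)"
      using integral_distr[of "\<lambda>x. x + v" lborel borel f] inv[of 1] by simp
  qed
  have "0 = (\<integral>x. f (x + v) - f x \<partial>lborel)"
    using shift C1c_integrable(1)[OF assms] by simp
  also have "\<dots> = (\<integral>x. integral {0..1} (\<lambda>t. g (x + t *\<^sub>R v) \<bullet> v) \<partial>lborel)"
    by (simp add: integral_unique[OF fd])
  also have "\<dots> = (\<integral>x. g x \<bullet> v \<partial>lborel)"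
    by (rule integral_average_eq[where B = "B + norm v"])
       (use T inv far B in \<open>auto intro!: continuous_intros cg\<close>)
  finally show "(\<integral>x. g x \<bullet> v \<partial>lborel) = 0" by simp
  have cng: "continuous_on UNIV (\<lambda>x. norm (g x))" by (intro continuous_intros cg)
  have av: "integrable lborel (\<lambda>x. integral {0..1} (\<lambda>t. norm (g (x + t *\<^sub>R v))))"
    "(\<integral>x. integral {0..1} (\<lambda>t. norm (g (x + t *\<^sub>R v))) \<partial>lborel) = (\<integral>x. norm (g x) \<partial>lborel)"
    by (rule integrable_average[where G = "\<lambda>x. norm (g x)" and B = "B + norm v"]
             integral_average_eq[where G = "\<lambda>x. norm (g x)" and B = "B + norm v"];
        use T inv far B cng in \<open>auto\<close>)+
  have pt: "\<bar>f (x + v) - f x\<bar> \<le> norm v * integral {0..1} (\<lambda>t. norm (g (x + t *\<^sub>R v)))" for x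
  proof -
    have "\<bar>f (x + v) - f x\<bar> = norm (integral {0..1} (\<lambda>t. g (x + t *\<^sub>R v) \<bullet> v))"
      using fd[of x] by (simp add: integral_unique)
    also have "\<dots> \<le> integral {0..1} (\<lambda>t. norm v * norm (g (x + t *\<^sub>R v)))"
    proof (rule integral_norm_bound_integral)
      show "(\<lambda>t. g (x + t *\<^sub>R v) \<bullet> v) integrable_on {0..1}" using fd by auto
      show "(\<lambda>t. norm v * norm (g (x + t *\<^sub>R v))) integrable_on {0..1}"
        by (intro integrable_continuous_real continuous_intros continuous_on_compose2[OF cg[of UNIV]]) auto
      show "norm (g (x + t *\<^sub>R v) \<bullet> v) \<le> norm v * norm (g (x + t *\<^sub>R v))" for t
        using Cauchy_Schwarz_ineq2[of "g (x + t *\<^sub>R v)" v] by (simp add: mult.commute)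
    qed
    finally show ?thesis by simp
  qed
  have "(\<integral>x. \<bar>f (x + v) - f x\<bar> \<partial>lborel)
      \<le> (\<integral>x. norm v * integral {0..1} (\<lambda>t. norm (g (x + t *\<^sub>R v))) \<partial>lborel)"
    using shift C1c_integrable(1)[OF assms] av(1) pt by (intro integral_mono) auto
  then show "(\<integral>x. \<bar>f (x + v) - f x\<bar> \<partial>lborel) \<le> norm v * (\<integral>x. norm (g x) \<partial>lborel)"
    by (simp add: av)
qed

text \<open>The support condition sits on the first factor alone because the second may be a weight
  such as 1 / sqrt (|x|^2 + e), which vanishes nowhere.\<close>

lemma C1c_mult:
  assumes "C1c f g" and "\<And>x. (f' has_derivative (\<lambda>v. g' x \<bullet> v)) (at x)" and "continuous_on UNIV g'"
  shows "C1c (\<lambda>x. f x * f' x) (\<lambda>x. f x *\<^sub>R g' x + f' x *\<^sub>R g x)"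
  unfolding C1c_def
proof (intro conjI allI)
  have cf': "continuous_on UNIV f'"
    by (rule has_derivative_continuous_on) (use assms(2) in auto)
  show "((\<lambda>x. f x * f' x) has_derivative (\<lambda>v. (f x *\<^sub>R g' x + f' x *\<^sub>R g x) \<bullet> v)) (at x)" for x
    using has_derivative_mult[OF C1c_deriv[OF assms(1)] assms(2)[of x]]
    by (simp add: inner_add_left algebra_simps)
  show "continuous_on UNIV (\<lambda>x. f x *\<^sub>R g' x + f' x *\<^sub>R g x)"
    by (intro continuous_intros C1cD[OF assms(1)] assms cf')
  show "bounded {x. f x * f' x \<noteq> 0}"
    by (rule bounded_subset[of "{x. f x \<noteq> 0}"]) (use assms(1) in \<open>auto simp: C1c_def\<close>)
qed

lemma C1c_power:
  assumes "C1c f g" "m > 0"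
  shows "C1c (\<lambda>x. f x ^ m) (\<lambda>x. (real m * f x ^ (m - 1)) *\<^sub>R g x)"
  unfolding C1c_def
proof (intro conjI allI)
  show "((\<lambda>x. f x ^ m) has_derivative (\<lambda>v. ((real m * f x ^ (m - 1)) *\<^sub>R g x) \<bullet> v)) (at x)" for x
    by (rule derivative_eq_intros C1c_deriv[OF assms(1)] refl)+ auto
  show "continuous_on UNIV (\<lambda>x. (real m * f x ^ (m - 1)) *\<^sub>R g x)"
    by (intro continuous_intros C1cD[OF assms(1)])
  show "bounded {x. f x ^ m \<noteq> 0}"
    by (rule bounded_subset[of "{x. f x \<noteq> 0}"]) (use assms in \<open>auto simp: C1c_def\<close>)
qed

subsection \<open>The Gagliardo--Nirenberg inequality in the plane\<close>

definition vec2 :: "real \<Rightarrow> real \<Rightarrow> real^2" where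
  "vec2 a b = vector [a, b]"

lemma vec2_nth [simp]: "vec2 a b $ 1 = a" "vec2 a b $ 2 = b"
  by (simp_all add: vec2_def)

lemma vec2_eta [simp]: "vec2 (x $ 1) (x $ 2) = x"
  by (simp add: vec_eq_iff forall_2)

lemma norm_real2: "(norm (x::real^2))\<^sup>2 = (x $ 1)\<^sup>2 + (x $ 2)\<^sup>2"
  unfolding power2_norm_eq_inner by (simp add: inner_vec_def sum_2 power2_eq_square)

lemma inner_real2: "(x::real^2) \<bullet> y = x $ 1 * y $ 1 + x $ 2 * y $ 2"
  by (simp add: inner_vec_def sum_2)

lemma Basis_real2: "(Basis :: (real^2) set) = {axis 1 1, axis 2 1}"
  by (auto simp: Basis_vec_def exhaust_2 intro: exhaust_2) (metis exhaust_2)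

lemma continuous_on_vec2: "continuous_on S (\<lambda>p. vec2 (fst p) (snd p))"
proof -
  have "vec2 a b = a *\<^sub>R axis 1 1 + b *\<^sub>R axis 2 1" for a b
    by (simp add: vec_eq_iff forall_2 axis_def)
  then show ?thesis by (auto intro!: continuous_intros)
qed

text \<open>Lebesgue measure is determined by its values on boxes, and a box of the plane pulls back
  to a product of intervals. This opens the plane to iterated integrals.\<close>

lemma distr_vec2: "distr lborel borel (\<lambda>p. vec2 (fst p) (snd p)) = lborel"
proof (rule lborel_eqI[symmetric])
  have m[measurable]: "(\<lambda>p. vec2 (fst p) (snd p)) \<in> borel_measurable borel"
    by (intro borel_measurable_continuous_onI continuous_on_vec2)
  fix l u :: "real^2" assume lu: "\<And>b. b \<in> Basis \<Longrightarrow> l \<bullet> b \<le> u \<bullet> b"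
  have le: "l $ 1 \<le> u $ 1" "l $ 2 \<le> u $ 2"
    using lu[of "axis 1 1"] lu[of "axis 2 1"] by (auto simp: Basis_real2 inner_axis)
  have "(\<lambda>p. vec2 (fst p) (snd p)) -` box l u = box (l $ 1) (u $ 1) \<times> box (l $ 2) (u $ 2)"
    by (auto simp: box_def Basis_real2 inner_axis)
  then have "emeasure (distr lborel borel (\<lambda>p. vec2 (fst p) (snd p))) (box l u)
      = emeasure (lborel \<Otimes>\<^sub>M lborel) (box (l $ 1) (u $ 1) \<times> box (l $ 2) (u $ 2))"
    by (subst emeasure_distr) (auto simp: lborel_prod)
  also have "\<dots> = ennreal ((u $ 1 - l $ 1) * (u $ 2 - l $ 2))"
    using le by (subst lborel.emeasure_pair_measure_Times) (auto simp: ennreal_mult)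
  also have "(u $ 1 - l $ 1) * (u $ 2 - l $ 2) = (\<Prod>b\<in>Basis. (u - l) \<bullet> b)"
    by (simp add: Basis_real2 inner_axis axis_eq_axis)
  finally show "emeasure (distr lborel borel (\<lambda>p. vec2 (fst p) (snd p))) (box l u)
      = (\<Prod>b\<in>Basis. (u - l) \<bullet> b)" .
qed simp

lemma nn_integral_vec2:
  assumes [measurable]: "f \<in> borel_measurable borel"
  shows "(\<integral>\<^sup>+x. f x \<partial>lborel) = (\<integral>\<^sup>+b. (\<integral>\<^sup>+a. f (vec2 a b) \<partial>lborel) \<partial>lborel)"
    and "(\<integral>\<^sup>+x. f x \<partial>lborel) = (\<integral>\<^sup>+a. (\<integral>\<^sup>+b. f (vec2 a b) \<partial>lborel) \<partial>lborel)"
proof -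
  have m[measurable]: "(\<lambda>p. vec2 (fst p) (snd p)) \<in> borel_measurable borel"
    by (intro borel_measurable_continuous_onI continuous_on_vec2)
  then have m2[measurable]: "(\<lambda>p. vec2 (fst p) (snd p)) \<in> borel_measurable (lborel \<Otimes>\<^sub>M lborel)"
    by (simp add: lborel_prod)
  have m3: "(\<lambda>p. f (vec2 (fst p) (snd p))) \<in> borel_measurable (lborel \<Otimes>\<^sub>M lborel)"
    by measurable
  have *: "(\<integral>\<^sup>+x. f x \<partial>lborel) = (\<integral>\<^sup>+p. f (vec2 (fst p) (snd p)) \<partial>(lborel \<Otimes>\<^sub>M lborel))"
    using nn_integral_distr[of "\<lambda>p. vec2 (fst p) (snd p)" lborel borel f] m
    by (simp add: distr_vec2 lborel_prod)
  show "(\<integral>\<^sup>+x. f x \<partial>lborel) = (\<integral>\<^sup>+b. (\<integral>\<^sup>+a. f (vec2 a b) \<partial>lborel) \<partial>lborel)"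
    using lborel_pair.nn_integral_snd[OF m3] * by simp
  show "(\<integral>\<^sup>+x. f x \<partial>lborel) = (\<integral>\<^sup>+a. (\<integral>\<^sup>+b. f (vec2 a b) \<partial>lborel) \<partial>lborel)"
    using lborel.nn_integral_fst[OF m3] * by simp
qed

text \<open>Far out in direction -v the function vanishes, so f x is the integral of its derivative
  along that ray. Extending the integral to the whole line makes the bound the same for all points
  of the line, which is what separates the variables in the planar inequality.\<close>

lemma C1c_le_line_integral:
  assumes "C1c f g" and "norm v = 1"
  shows "ennreal \<bar>f x\<bar> \<le> (\<integral>\<^sup>+s. ennreal (norm (g (x + s *\<^sub>R v))) \<partial>lborel)"
proof -
  obtain B where B: "B > 0" "\<And>x. norm x > B \<Longrightarrow> f x = 0"
    using C1c_support[OF assms(1)] by metis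
  \<comment> \<open>Large enough for x - N v to lie beyond the support: its norm is at least N - |x|
    = B + 1.\<close>
  define N where "N = B + norm x + 1"
  have N: "N > 0" using B by (simp add: N_def add_pos_nonneg)
  have "x + (- N) *\<^sub>R v = - (N *\<^sub>R v - x)" by simp
  then have "norm (x + (- N) *\<^sub>R v) = norm (N *\<^sub>R v - x)" by (metis norm_minus_cancel)
  moreover have "norm (N *\<^sub>R v) = B + norm x + 1"
    using N assms(2) by (simp add: N_def)
  ultimately have "norm (x + (- N) *\<^sub>R v) > B"
    using norm_triangle_ineq2[of "N *\<^sub>R v" x] by linarith
  then have f0: "f (x + (- N) *\<^sub>R v) = 0" using B by blast
  note cg = C1c_cont_grad[OF assms(1)]
  have c: "continuous_on S (\<lambda>s. norm (g (x + s *\<^sub>R v)))" for S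
    by (intro continuous_intros continuous_on_compose2[OF cg[of UNIV]]) auto
  have fd: "((\<lambda>t. g (x + t *\<^sub>R v) \<bullet> v) has_integral f (x + 0 *\<^sub>R v) - f (x + (- N) *\<^sub>R v)) {-N..0}"
  proof -
    have "((\<lambda>t. x + t *\<^sub>R v) has_vector_derivative v) (at t)" for t
      by (auto intro!: derivative_eq_intros simp: has_vector_derivative_def)
    from C1c_FTC[OF assms(1) this, of "-N" 0] N show ?thesis by simp
  qed
  have "\<bar>f x\<bar> = norm (integral {-N..0} (\<lambda>t. g (x + t *\<^sub>R v) \<bullet> v))"
    using fd f0 by (simp add: integral_unique)
  also have "\<dots> \<le> integral {-N..0} (\<lambda>t. norm (g (x + t *\<^sub>R v)))"
  proof (rule integral_norm_bound_integral)
    show "(\<lambda>t. norm (g (x + t *\<^sub>R v))) integrable_on {-N..0}"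
      by (intro integrable_continuous_real c)
    show "norm (g (x + t *\<^sub>R v) \<bullet> v) \<le> norm (g (x + t *\<^sub>R v))" for t
      using Cauchy_Schwarz_ineq2[of "g (x + t *\<^sub>R v)" v] assms(2) by simp
  qed (use fd in auto)
  finally have *: "\<bar>f x\<bar> \<le> integral {-N..0} (\<lambda>t. norm (g (x + t *\<^sub>R v)))" .
  have "ennreal (integral {-N..0} (\<lambda>t. norm (g (x + t *\<^sub>R v))))
      = (\<integral>\<^sup>+t. ennreal (indicator {-N..0} t * norm (g (x + t *\<^sub>R v))) \<partial>lborel)"
  proof -
    have si: "set_integrable lborel {-N..0} (\<lambda>t. norm (g (x + t *\<^sub>R v)))"
      unfolding set_integrable_def by (intro borel_integrable_compact c) auto
    show ?thesis
      using set_borel_integral_eq_integral(2)[OF si] si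
      by (subst nn_integral_eq_integral) (auto simp: set_lebesgue_integral_def set_integrable_def)
  qed
  also have "\<dots> \<le> (\<integral>\<^sup>+s. ennreal (norm (g (x + s *\<^sub>R v))) \<partial>lborel)"
    by (intro nn_integral_mono ennreal_leI) (auto simp: indicator_def)
  finally show ?thesis using * by (meson ennreal_leI order_trans)
qed

text \<open>|f| is bounded by the horizontal line integral \<open>A\<close>, a function of b only,
  and by the vertical one \<open>A'\<close>, a function of a only. Their product bounds f^2, and its
  double integral factors into two copies of the L^1 norm of the gradient.\<close>

lemma gagliardo_nirenberg_2:
  fixes f :: "real^2 \<Rightarrow> real"
  assumes "C1c f g"
  shows "(\<integral>x. (f x)\<^sup>2 \<partial>lborel) \<le> (\<integral>x. norm (g x) \<partial>lborel)\<^sup>2"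
proof -
  note cg = C1c_cont_grad[OF assms] and cf = C1c_cont[OF assms]
  have [measurable]: "g \<in> borel_measurable borel" "f \<in> borel_measurable borel"
    by (auto intro!: borel_measurable_continuous_onI cg cf)
  have v2c: "continuous_on S (\<lambda>a. vec2 a b)" "continuous_on S (\<lambda>b. vec2 a b)" for S a b
  proof -
    have "continuous_on S (\<lambda>a. vec2 (fst (a,b)) (snd (a,b)))"
      "continuous_on S (\<lambda>b. vec2 (fst (a,b)) (snd (a,b)))"
      by (rule continuous_on_compose2[OF continuous_on_vec2[of UNIV]];
          auto intro!: continuous_intros)+
    then show "continuous_on S (\<lambda>a. vec2 a b)" "continuous_on S (\<lambda>b. vec2 a b)" by simp_all
  qed
  have [measurable]: "(\<lambda>p. vec2 (fst p) (snd p)) \<in> borel_measurable (lborel \<Otimes>\<^sub>M lborel)"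
    by (simp add: lborel_prod borel_measurable_continuous_onI continuous_on_vec2)
  have gm[measurable]: "(\<lambda>(a,b). ennreal (norm (g (vec2 a b)))) \<in> borel_measurable (lborel \<Otimes>\<^sub>M lborel)"
    unfolding case_prod_unfold by measurable
  have gm'[measurable]: "(\<lambda>(b,a). ennreal (norm (g (vec2 a b)))) \<in> borel_measurable (lborel \<Otimes>\<^sub>M lborel)"
    using measurable_pair_swap[OF gm] by (simp add: case_prod_unfold)
  define A where "A = (\<lambda>b. \<integral>\<^sup>+a. ennreal (norm (g (vec2 a b))) \<partial>lborel)"
  define A' where "A' = (\<lambda>a. \<integral>\<^sup>+b. ennreal (norm (g (vec2 a b))) \<partial>lborel)"
  have [measurable]: "A \<in> borel_measurable lborel" "A' \<in> borel_measurable lborel"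
    unfolding A_def A'_def
    using lborel.borel_measurable_nn_integral_fst[OF gm'] lborel.borel_measurable_nn_integral_fst[OF gm]
    by (auto simp: case_prod_unfold)
  have shift: "(\<integral>\<^sup>+s. h (c + s) \<partial>lborel) = (\<integral>\<^sup>+s. h s \<partial>lborel)"
    if [measurable]: "h \<in> borel_measurable borel" for h :: "real \<Rightarrow> ennreal" and c
    using nn_integral_distr[of "(+) c" lborel borel h] by (simp add: lborel_distr_plus)
  have b1: "ennreal \<bar>f (vec2 a b)\<bar> \<le> A b" for a b
  proof -
    have [measurable]: "(\<lambda>a. vec2 a b) \<in> borel_measurable borel"
      by (intro borel_measurable_continuous_onI v2c)
    have "vec2 a b + s *\<^sub>R axis 1 1 = vec2 (a + s) b" for s
      by (simp add: vec_eq_iff forall_2 axis_def)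
    then show ?thesis
      using C1c_le_line_integral[OF assms, of "axis 1 1" "vec2 a b"]
        shift[of "\<lambda>a. ennreal (norm (g (vec2 a b)))" a] by (simp add: A_def)
  qed
  have b2: "ennreal \<bar>f (vec2 a b)\<bar> \<le> A' a" for a b
  proof -
    have [measurable]: "(\<lambda>b. vec2 a b) \<in> borel_measurable borel"
      by (intro borel_measurable_continuous_onI v2c)
    have "vec2 a b + s *\<^sub>R axis 2 1 = vec2 a (b + s)" for s
      by (simp add: vec_eq_iff forall_2 axis_def)
    then show ?thesis
      using C1c_le_line_integral[OF assms, of "axis 2 1" "vec2 a b"]
        shift[of "\<lambda>b. ennreal (norm (g (vec2 a b)))" b] by (simp add: A'_def)
  qed
  have "(\<integral>\<^sup>+x. ennreal ((f x)\<^sup>2) \<partial>lborel) = (\<integral>\<^sup>+b. (\<integral>\<^sup>+a. ennreal ((f (vec2 a b))\<^sup>2) \<partial>lborel) \<partial>lborel)"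
    by (rule nn_integral_vec2) measurable
  also have "\<dots> \<le> (\<integral>\<^sup>+b. (\<integral>\<^sup>+a. A b * A' a \<partial>lborel) \<partial>lborel)"
  proof (intro nn_integral_mono)
    fix a b
    have "ennreal ((f (vec2 a b))\<^sup>2) = ennreal \<bar>f (vec2 a b)\<bar> * ennreal \<bar>f (vec2 a b)\<bar>"
      by (simp add: power2_eq_square flip: ennreal_mult)
    also have "\<dots> \<le> A b * A' a" by (intro mult_mono b1 b2) auto
    finally show "ennreal ((f (vec2 a b))\<^sup>2) \<le> A b * A' a" .
  qed
  also have "\<dots> = (\<integral>\<^sup>+b. A b \<partial>lborel) * (\<integral>\<^sup>+a. A' a \<partial>lborel)"
    by (simp add: nn_integral_cmult nn_integral_multc)
  also have "(\<integral>\<^sup>+b. A b \<partial>lborel) = (\<integral>\<^sup>+x. ennreal (norm (g x)) \<partial>lborel)"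
    unfolding A_def by (rule nn_integral_vec2(1)[symmetric]) measurable
  also have "(\<integral>\<^sup>+b. A' b \<partial>lborel) = (\<integral>\<^sup>+x. ennreal (norm (g x)) \<partial>lborel)"
    unfolding A'_def by (rule nn_integral_vec2(2)[symmetric]) measurable
  finally have "ennreal (\<integral>x. (f x)\<^sup>2 \<partial>lborel)
      \<le> ennreal (\<integral>x. norm (g x) \<partial>lborel) * ennreal (\<integral>x. norm (g x) \<partial>lborel)"
    using C1c_integrable[OF assms] by (simp add: nn_integral_eq_integral)
  then show ?thesis by (simp add: power2_eq_square flip: ennreal_mult)
qed

subsection \<open>Rotations and radial averages\<close>

definition perp :: "real^2 \<Rightarrow> real^2" where
  "perp x = vec2 (- x $ 2) (x $ 1)"

text \<open>One full turn corresponds to t in [0, 1], so that circular means are plain integrals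
  over a unit interval; the factor 2 pi reappears in the derivative.\<close>

definition rot :: "real \<Rightarrow> real^2 \<Rightarrow> real^2" where
  "rot t x = cos (2 * pi * t) *\<^sub>R x + sin (2 * pi * t) *\<^sub>R perp x"

lemma perp_nth [simp]: "perp x $ 1 = - x $ 2" "perp x $ 2 = x $ 1"
  by (simp_all add: perp_def)

lemma linear_perp: "linear perp"
  by (intro linearI) (simp_all add: vec_eq_iff forall_2)

lemma perp_perp [simp]: "perp (perp x) = - x"
  by (simp add: vec_eq_iff forall_2)

lemma continuous_on_perp [continuous_intros]:
  "continuous_on S f \<Longrightarrow> continuous_on S (\<lambda>x. perp (f x))"
  by (rule bounded_linear.continuous_on[OF linear_conv_bounded_linear[THEN iffD1, OF linear_perp]])

lemma inner_perp: "x \<bullet> perp y = - (perp x \<bullet> y)" "perp x \<bullet> perp y = x \<bullet> y"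
  by (simp_all add: inner_real2)

lemma norm_perp [simp]: "norm (perp x) = norm x"
  by (simp add: norm_eq_sqrt_inner inner_perp)

lemma linear_rot: "linear (rot t)"
  unfolding rot_def[abs_def]
  by (intro linear_compose_add linear_compose_scale_right linear_perp linear_ident)

lemma rot_0 [simp]: "rot 0 x = x"
  by (simp add: rot_def)

lemma rot_rot: "rot s (rot t x) = rot (s + t) x"
  using linear_perp unfolding rot_def
  by (simp add: linear_add linear_scale cos_add sin_add distrib_left vec_eq_iff forall_2 algebra_simps)

lemma rot_add_1: "rot (t + 1) x = rot t x"
  by (simp add: rot_def distrib_left)

lemma rot_minus_rot [simp]: "rot (- t) (rot t x) = x" "rot t (rot (- t) x) = x"
  by (simp_all add: rot_rot)

lemma rot_inner: "rot t x \<bullet> y = x \<bullet> rot (- t) y"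
  by (simp add: rot_def inner_add_left inner_diff_right inner_perp)

lemma norm_rot [simp]: "norm (rot t x) = norm x"
  by (simp add: norm_eq_sqrt_inner rot_inner)

lemma continuous_on_rot [continuous_intros]:
  fixes f :: "'a::t2_space \<Rightarrow> real"
  shows "continuous_on S f \<Longrightarrow> continuous_on S g \<Longrightarrow> continuous_on S (\<lambda>x. rot (f x) (g x))"
  unfolding rot_def by (intro continuous_intros) auto

lemma rot_has_vector_derivative:
  "((\<lambda>t. rot t x) has_vector_derivative ((2 * pi) *\<^sub>R perp (rot t x))) (at t)"
  unfolding rot_def
  using linear_perp
  by (auto intro!: derivative_eq_intros simp: has_vector_derivative_def linear_add linear_scale
      algebra_simps)

lemma rot_has_derivative: "(rot t has_derivative rot t) F"
  by (intro bounded_linear_imp_has_derivative linear_conv_bounded_linear[THEN iffD1] linear_rot)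

text \<open>The preimage of a box is a rotated box, whose measure is unchanged because rotations are
  orthogonal transformations.\<close>

lemma distr_rot: "distr lborel borel (rot t) = lborel"
proof (rule lborel_eqI[symmetric])
  have [measurable]: "rot t \<in> borel_measurable borel"
    by (intro borel_measurable_continuous_onI continuous_intros)
  fix l u :: "real^2" assume lu: "\<And>b. b \<in> Basis \<Longrightarrow> l \<bullet> b \<le> u \<bullet> b"
  have o: "orthogonal_transformation (rot (- t))"
    by (simp add: orthogonal_transformation linear_rot)
  have eq: "rot t -` box l u = rot (- t) ` box l u"
    by (auto intro!: image_eqI[where x = "rot t _"])
  have "emeasure (distr lborel borel (rot t)) (box l u) = emeasure lborel (rot t -` box l u)"
    by (subst emeasure_distr) auto
  also have "\<dots> = emeasure lebesgue (rot (- t) ` box l u)"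
    unfolding eq[symmetric] using measurable_sets[of "rot t" borel borel "box l u"] by simp
  also have "\<dots> = ennreal (measure lebesgue (rot (- t) ` box l u))"
    using measurable_orthogonal_image[OF o lmeasurable_box] by (simp add: emeasure_eq_measure2)
  also have "\<dots> = ennreal (measure lebesgue (box l u))"
    using measure_orthogonal_image[OF o lmeasurable_box] by simp
  also have "\<dots> = (\<Prod>b\<in>Basis. (u - l) \<bullet> b)"
    using lu by (simp add: measure_lborel_box)
  finally show "emeasure (distr lborel borel (rot t)) (box l u) = (\<Prod>b\<in>Basis. (u - l) \<bullet> b)" .
qed simp

text \<open>Reduces rotation-invariant and equivariant statements to points of the positive first
  axis.\<close>

lemma rot_polar:
  obtains s where "s \<in> {0..1}" "x = rot s (norm x *\<^sub>R axis 1 1)"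
proof (cases "x = 0")
  case True
  then show ?thesis using that[of 0] by simp
next
  case False
  then have "(x $ 1 / norm x)\<^sup>2 + (x $ 2 / norm x)\<^sup>2 = 1"
    unfolding power_divide add_divide_distrib[symmetric] norm_real2[of x, symmetric] by simp
  then obtain t where t: "0 \<le> t" "t < 2 * pi" "x $ 1 / norm x = cos t" "x $ 2 / norm x = sin t"
    by (rule sincos_total_2pi)
  show ?thesis
  proof (rule that)
    show "t / (2 * pi) \<in> {0..1}" using t(1,2) by simp
    have "norm x * (x $ 1 / norm x) = x $ 1" "norm x * (x $ 2 / norm x) = x $ 2"
      using False by simp_all
    then have "x $ 1 = norm x * cos t" "x $ 2 = norm x * sin t"
      unfolding t(3,4) by (auto intro: sym)
    then show "x = rot (t / (2 * pi)) (norm x *\<^sub>R axis 1 1)"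
      unfolding vec_eq_iff forall_2 by (simp add: rot_def axis_def)
  qed
qed

section \<open>Circular means and the orthogonal projection onto radial functions\<close>

definition avg :: "(real^2 \<Rightarrow> real) \<Rightarrow> real^2 \<Rightarrow> real" where
  "avg f x = integral {0..1} (\<lambda>t. f (rot t x))"

lemma avg_rot:
  assumes "continuous_on UNIV f" and "s \<in> {0..1}"
  shows "avg f (rot s x) = avg f x"
proof -
  define p where "p = (\<lambda>t. f (rot t x))"
  have c: "continuous_on S p" for S
    unfolding p_def by (intro continuous_on_compose2[OF assms(1)] continuous_intros) auto
  have i: "p integrable_on {u..v}" for u v by (intro integrable_continuous_real c)
  have sh: "integral {u..v} (\<lambda>t. p (t + w)) = integral {u + w..v + w} p" for u v w
    using integral_shift[of u w v p] c by (simp add: comp_def)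
  have "avg f (rot s x) = integral {0..1} (\<lambda>t. p (t + s))"
    by (simp add: avg_def p_def rot_rot)
  also have "\<dots> = integral {s..1 + s} p"
    using sh by simp
  also have "\<dots> = integral {s..1} p + integral {1..1 + s} p"
    using assms(2) by (intro Henstock_Kurzweil_Integration.integral_combine[symmetric] i) auto
  also have "integral {1..1 + s} p = integral {0..s} (\<lambda>t. p (t + 1))"
    using sh[of 0 s 1] by (simp add: add.commute)
  also have "\<dots> = integral {0..s} p" by (simp add: p_def rot_add_1)
  also have "integral {s..1} p + integral {0..s} p = integral {0..1} p"
    using Henstock_Kurzweil_Integration.integral_combine[of 0 s 1 p] assms(2) i by auto
  finally show ?thesis by (simp add: avg_def p_def)
qed

lemma avg_radial:
  assumes "continuous_on UNIV f"
  shows "avg f x = avg f (norm x *\<^sub>R axis 1 1)"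
proof -
  obtain s where "s \<in> {0..1}" "x = rot s (norm x *\<^sub>R axis 1 1)" by (rule rot_polar)
  then show ?thesis using avg_rot[OF assms] by metis
qed

lemma avg_avg:
  assumes "continuous_on UNIV f"
  shows "avg (avg f) x = avg f x"
proof -
  have "avg (avg f) x = integral {0..1} (\<lambda>t::real. avg f x)"
    unfolding avg_def[of "avg f"] by (intro integral_cong avg_rot[OF assms]) auto
  then show ?thesis by simp
qed

lemma avg_diff:
  assumes "continuous_on UNIV f" "continuous_on UNIV h"
  shows "avg (\<lambda>x. f x - h x) x = avg f x - avg h x"
  unfolding avg_def
  by (intro integral_diff integrable_continuous_real continuous_on_compose2[OF assms(1)]
      continuous_on_compose2[OF assms(2)] continuous_intros) auto

text \<open>Differentiation under the integral sign, with \<open>rot (- t)\<close> appearing as the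
  adjoint of \<open>rot t\<close>. The weight c prepares an induction on smoothness; c = 1 gives the
  circular mean.\<close>

lemma weighted_average_derivative:
  assumes d: "\<And>x. (f has_derivative (\<lambda>v. g x \<bullet> v)) (at x)" and cg: "continuous_on UNIV g"
    and cc: "continuous_on UNIV c"
  shows "((\<lambda>x. integral {0..1} (\<lambda>t. c t * f (rot t x))) has_derivative
      (\<lambda>v. integral {0..1} (\<lambda>t. c t *\<^sub>R rot (- t) (g (rot t x))) \<bullet> v)) (at x)"
proof -
  define q where "q = (\<lambda>x t. c t *\<^sub>R rot (- t) (g (rot t x)))"
  have cf: "continuous_on UNIV f" by (rule has_derivative_continuous_on) (use d in auto)
  have cq: "continuous_on S (\<lambda>p. q (fst p) (snd p))" for S
    unfolding q_def
    by (intro continuous_intros continuous_on_compose2[OF cg] continuous_on_compose2[OF cc]) auto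
  have cq1: "continuous_on S (\<lambda>t. q x t)" for S x
    unfolding q_def
    by (intro continuous_intros continuous_on_compose2[OF cg] continuous_on_compose2[OF cc]) auto
  have "((\<lambda>x. integral (cbox 0 1) (\<lambda>t. c t * f (rot t x))) has_derivative
      blinfun_apply (integral (cbox 0 1) (\<lambda>t. blinfun_inner_right (q x t)))) (at x within UNIV)"
  proof (rule leibniz_rule[where fx = "\<lambda>x t. blinfun_inner_right (q x t)"])
    fix x t
    have "((\<lambda>x. c t * f (rot t x)) has_derivative (\<lambda>v. c t * (g (rot t x) \<bullet> rot t v))) (at x)"
      by (intro has_derivative_mult_right has_derivative_compose[OF rot_has_derivative d])
    moreover have "(\<lambda>v. c t * (g (rot t x) \<bullet> rot t v)) = blinfun_apply (blinfun_inner_right (q x t))"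
      by (auto simp: fun_eq_iff q_def rot_inner)
    ultimately show "((\<lambda>x. c t * f (rot t x))
        has_derivative blinfun_apply (blinfun_inner_right (q x t))) (at x within UNIV)"
      by simp
  next
    show "(\<lambda>t. c t * f (rot t x)) integrable_on cbox 0 1" for x
      by (intro integrable_continuous continuous_intros continuous_on_compose2[OF cf]
          continuous_on_compose2[OF cc]) auto
    show "continuous_on (UNIV \<times> cbox 0 1) (\<lambda>(x, t). blinfun_inner_right (q x t))"
      unfolding case_prod_unfold
      by (intro bounded_linear.continuous_on[OF bounded_linear_blinfun_inner_right] cq)
  qed auto
  moreover have "integral (cbox 0 1) (\<lambda>t. blinfun_inner_right (q x t))
      = blinfun_inner_right (integral (cbox 0 1) (q x))"
    using integral_linear[OF integrable_continuous[OF cq1[of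
        "cbox 0 1" x]] bounded_linear_blinfun_inner_right]
    by (simp add: comp_def)
  ultimately show ?thesis by (simp add: q_def)
qed

lemma continuous_on_rot_average:
  fixes g :: "real^2 \<Rightarrow> 'b::euclidean_space"
  assumes "continuous_on UNIV g" "continuous_on UNIV (\<lambda>(t,y). L t y)"
  shows "continuous_on UNIV (\<lambda>x. integral {0..1} (\<lambda>t. L t (g (rot t x)) :: 'c::euclidean_space))"
proof -
  have "continuous_on (UNIV \<times> cbox 0 1) (\<lambda>p. (\<lambda>(t,y). L t y) (snd p, g (rot (snd p) (fst p))))"
    by (rule continuous_on_compose2[OF assms(2)])
       (auto intro!: continuous_intros continuous_on_compose2[OF assms(1)])
  from integral_continuous_on_param[of UNIV 0 1 "\<lambda>x t. L t (g (rot t x))"] this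
  show ?thesis by (simp add: case_prod_unfold)
qed

text \<open>The gradient of \<open>avg f\<close> when g is the gradient of f: the values of g on the
  circle are turned back to the point x before they are averaged.\<close>

definition avg_grad :: "(real^2 \<Rightarrow> real^2) \<Rightarrow> real^2 \<Rightarrow> real^2" where
  "avg_grad g x = integral {0..1} (\<lambda>t. rot (- t) (g (rot t x)))"

lemma C1c_avg:
  assumes "C1c f g"
  shows "C1c (avg f) (avg_grad g)"
  unfolding C1c_def
proof (intro conjI allI)
  show "(avg f has_derivative (\<lambda>v. avg_grad g x \<bullet> v)) (at x)" for x
    using weighted_average_derivative[OF C1c_deriv[OF assms] C1c_cont_grad[OF assms], of "\<lambda>_. 1" x]
    by (simp add: avg_def[abs_def] avg_grad_def)
  show "continuous_on UNIV (avg_grad g)"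
    unfolding avg_grad_def[abs_def]
    by (rule continuous_on_rot_average[OF C1c_cont_grad[OF assms]])
       (auto simp: case_prod_unfold intro!: continuous_intros)
  obtain B where B: "B > 0" "\<And>x. norm x > B \<Longrightarrow> f x = 0"
    using C1c_support[OF assms] by metis
  have "avg f x = 0" if "norm x > B" for x
  proof -
    have "avg f x = integral {0..1} (\<lambda>t::real. 0)"
      unfolding avg_def by (intro integral_cong) (use B that in auto)
    then show ?thesis by simp
  qed
  then have "{x. avg f x \<noteq> 0} \<subseteq> cball 0 B" by force
  then show "bounded {x. avg f x \<noteq> 0}" by (rule bounded_subset[rotated]) simp
qed

text \<open>Equivariance follows by differentiating the invariance
  \<open>avg f \<circ> rot s = avg f\<close> and moving \<open>rot s\<close> to the other side of
  the inner product.\<close>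

lemma avg_grad_rot:
  assumes "C1c f g" and s: "s \<in> {0..1}"
  shows "avg_grad g (rot s x) = rot s (avg_grad g x)"
proof -
  have "avg f \<circ> rot s = avg f"
    using avg_rot[OF C1c_cont[OF assms(1)] s] by auto
  moreover have "((avg f \<circ> rot s) has_derivative ((\<lambda>v. avg_grad g (rot s x) \<bullet> v) \<circ> rot s)) (at x)"
    by (intro diff_chain_at rot_has_derivative C1c_deriv[OF C1c_avg[OF assms(1)]])
  ultimately have "(avg f has_derivative (\<lambda>v. avg_grad g (rot s x) \<bullet> rot s v)) (at x)"
    by (simp add: comp_def)
  from has_derivative_unique[OF this C1c_deriv[OF C1c_avg[OF assms(1)]]]
  have "avg_grad g (rot s x) \<bullet> rot s v = avg_grad g x \<bullet> v" for v by metis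
  then have "rot (- s) (avg_grad g (rot s x)) \<bullet> v = avg_grad g x \<bullet> v" for v
    by (simp add: rot_inner)
  then have "rot (- s) (avg_grad g (rot s x)) = avg_grad g x" by (meson vector_eq_rdot)
  then show ?thesis by (metis rot_minus_rot(2))
qed

text \<open>By equivariance, the squared norm of \<open>avg_grad g\<close> is the circular mean of
  the product of g with \<open>avg_grad g\<close>, and integrating over the plane removes that mean.
  In other words, g - \<open>avg_grad g\<close> is orthogonal to \<open>avg_grad g\<close>.\<close>

lemma avg_orthogonal:
  assumes "C1c f g"
  shows "(\<integral>x. g x \<bullet> avg_grad g x \<partial>lborel) = energy lborel (avg_grad g)"
proof -
  note ca = C1c_cont_grad[OF C1c_avg[OF assms]] and cg = C1c_cont_grad[OF assms]
  obtain B where B: "B > 0" "\<And>x. norm x > B \<Longrightarrow> g x = 0"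
    using C1c_support[OF assms] by metis
  have *: "(norm (avg_grad g x))\<^sup>2 = integral {0..1} (\<lambda>t. g (rot t x) \<bullet> avg_grad g (rot t x))" for x
  proof -
    have "((\<lambda>t. rot (- t) (g (rot t x))) has_integral avg_grad g x) {0..1}"
      unfolding avg_grad_def
      by (intro integrable_integral integrable_continuous_real continuous_intros
          continuous_on_compose2[OF cg[of UNIV]]) auto
    from has_integral_linear[OF this bounded_linear_inner_left[of "avg_grad g x"]]
    have "(norm (avg_grad g x))\<^sup>2 = integral {0..1} (\<lambda>t. rot (- t) (g (rot t x)) \<bullet> avg_grad g x)"
      by (simp add: comp_def integral_unique power2_norm_eq_inner)
    also have "\<dots> = integral {0..1} (\<lambda>t. g (rot t x) \<bullet> avg_grad g (rot t x))"
      by (intro integral_cong) (simp add: rot_inner avg_grad_rot[OF assms])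
    finally show ?thesis .
  qed
  show ?thesis unfolding *
    by (rule integral_average_eq[symmetric, where B = B])
       (use B in \<open>auto simp: distr_rot case_prod_unfold intro!: continuous_intros ca cg\<close>)
qed

lemma C1c_diff:
  assumes "C1c f g" "C1c f' g'"
  shows "C1c (\<lambda>x. f x - f' x) (\<lambda>x. g x - g' x)"
  unfolding C1c_def
proof (intro conjI allI)
  show "((\<lambda>x. f x - f' x) has_derivative (\<lambda>v. (g x - g' x) \<bullet> v)) (at x)" for x
    using has_derivative_diff[OF C1c_deriv[OF assms(1)] C1c_deriv[OF assms(2)]]
    by (simp add: inner_diff_left)
  show "continuous_on UNIV (\<lambda>x. g x - g' x)"
    by (intro continuous_intros C1c_cont_grad[OF assms(1)] C1c_cont_grad[OF assms(2)])
  show "bounded {x. f x - f' x \<noteq> 0}"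
    by (rule bounded_subset[of "{x. f x \<noteq> 0} \<union> {x. f' x \<noteq> 0}"])
       (use assms in \<open>auto simp: C1c_def\<close>)
qed

lemma C1c_cmult:
  assumes "C1c f g"
  shows "C1c (\<lambda>x. c * f x) (\<lambda>x. c *\<^sub>R g x)"
  unfolding C1c_def
proof (intro conjI allI)
  show "((\<lambda>x. c * f x) has_derivative (\<lambda>v. (c *\<^sub>R g x) \<bullet> v)) (at x)" for x
    using has_derivative_mult_right[OF C1c_deriv[OF assms], of c] by simp
  show "continuous_on UNIV (\<lambda>x. c *\<^sub>R g x)"
    by (intro continuous_intros C1c_cont_grad[OF assms])
  show "bounded {x. c * f x \<noteq> 0}"
    by (rule bounded_subset[of "{x. f x \<noteq> 0}"]) (use assms in \<open>auto simp: C1c_def\<close>)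
qed

lemma integrable_C1c_inner:
  assumes "C1c f g" "C1c f' g'"
  shows "integrable lborel (\<lambda>x. g x \<bullet> g' x)"
proof -
  obtain B where "B > 0" "\<And>x. norm x > B \<Longrightarrow> g x = 0"
    using C1c_support[OF assms(1)] by metis
  then show ?thesis
    by (auto intro!: integrable_lborel_cont_bounded_support[of _ B] continuous_intros
        C1cD[OF assms(1)] C1cD[OF assms(2)])
qed

text \<open>Pythagoras for the splitting of g into \<open>avg_grad g\<close> and the remainder
  orthogonal to it.\<close>

lemma avg_energy:
  assumes "C1c f g"
  shows "energy lborel (avg_grad g) \<le> energy lborel g"
    and "energy lborel (\<lambda>x. g x - avg_grad g x) \<le> energy lborel g"
proof -
  note i = C1c_integrable(4)[OF assms] C1c_integrable(4)[OF C1c_avg[OF assms]]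
    integrable_C1c_inner[OF assms C1c_avg[OF assms]]
  have "(norm (g x - avg_grad g x))\<^sup>2
      = (norm (g x))\<^sup>2 + (norm (avg_grad g x))\<^sup>2 - 2 * (g x \<bullet> avg_grad g x)" for x
    by (simp add: power2_norm_eq_inner inner_diff_left inner_diff_right inner_commute)
  then have eq: "energy lborel (\<lambda>x. g x - avg_grad g x)
      = energy lborel g - energy lborel (avg_grad g)"
    using i by (simp add: avg_orthogonal[OF assms])
  have "0 \<le> energy lborel (avg_grad g)"
    "0 \<le> energy lborel (\<lambda>x. g x - avg_grad g x)" by simp_all
  with eq show "energy lborel (avg_grad g) \<le> energy lborel g"
    "energy lborel (\<lambda>x. g x - avg_grad g x) \<le> energy lborel g"
    by linarith+
qed

subsection \<open>Functions with vanishing circular means\<close>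

text \<open>A zero mean on the circle makes - f x the mean of the differences f (rot t x) - f x, and
  each difference is an integral of the tangential derivative over an arc of a circle of length 2 pi
  |x|. Only finiteness of the constant matters later, so no Fourier expansion enters.\<close>

lemma wirtinger_pointwise:
  assumes "C1c f g" and "avg f x = 0"
  shows "(f x)\<^sup>2 \<le> (2 * pi * norm x)\<^sup>2 * integral {0..1} (\<lambda>t. (norm (g (rot t x)))\<^sup>2)"
proof -
  note cf = C1c_cont[OF assms(1)] and cg = C1c_cont_grad[OF assms(1)]
  have cf1: "continuous_on S (\<lambda>t. f (rot t x))" for S
    by (intro continuous_on_compose2[OF cf[of UNIV]] continuous_intros) auto
  have cg1: "continuous_on S (\<lambda>t. norm (g (rot t x)))" for S
    by (intro continuous_on_compose2[OF cg[of UNIV]] continuous_intros) auto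
  define K where "K = 2 * pi * norm x * integral {0..1} (\<lambda>t. norm (g (rot t x)))"
  have K: "\<bar>f (rot t x) - f x\<bar> \<le> K" if "t \<in> {0..1}" for t
  proof -
    have h: "((\<lambda>\<tau>. g (rot \<tau> x) \<bullet> ((2 * pi) *\<^sub>R perp (rot \<tau> x)))
        has_integral f (rot t x) - f (rot 0 x)) {0..t}"
      by (rule C1c_FTC[OF assms(1) rot_has_vector_derivative]) (use that in auto)
    then have "\<bar>f (rot t x) - f x\<bar>
        = norm (integral {0..t} (\<lambda>\<tau>. g (rot \<tau> x) \<bullet> ((2 * pi) *\<^sub>R perp (rot \<tau> x))))"
      by (simp only: rot_0 real_norm_def integral_unique)
    also have "\<dots> \<le> integral {0..t} (\<lambda>\<tau>. 2 * pi * norm x * norm (g (rot \<tau> x)))"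
    proof (rule integral_norm_bound_integral)
      show "(\<lambda>\<tau>. 2 * pi * norm x * norm (g (rot \<tau> x))) integrable_on {0..t}"
        by (intro integrable_continuous_real continuous_intros cg1)
      show "norm (g (rot \<tau> x) \<bullet> ((2 * pi) *\<^sub>R perp (rot \<tau> x))) \<le> 2 * pi * norm x * norm (g (rot \<tau> x))" for \<tau>
      proof -
        have "norm ((2 * pi) *\<^sub>R perp (rot \<tau> x)) = 2 * pi * norm x" by simp
        then show ?thesis
          using Cauchy_Schwarz_ineq2[of "g (rot \<tau> x)" "(2 * pi) *\<^sub>R perp (rot \<tau> x)"]
          by (simp only: real_norm_def mult.commute)
      qed
    qed (use h in auto)
    also have "\<dots> \<le> integral {0..1} (\<lambda>\<tau>. 2 * pi * norm x * norm (g (rot \<tau> x)))"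
      using that by (intro integral_subset_le integrable_continuous_real continuous_intros cg1) auto
    finally show ?thesis by (simp add: K_def)
  qed
  have "((\<lambda>t. f (rot t x) - f x) has_integral avg f x - f x) {0..1}"
  proof -
    have "((\<lambda>t. f (rot t x)) has_integral avg f x) {0..1}"
      unfolding avg_def by (intro integrable_integral integrable_continuous_real cf1)
    from has_integral_diff[OF this has_integral_const_real[of "f x" 0 1]] show ?thesis by simp
  qed
  then have "\<bar>avg f x - f x\<bar> = norm (integral {0..1} (\<lambda>t. f (rot t x) - f x))"
    by (simp add: integral_unique)
  also have "\<dots> \<le> integral {0..1::real} (\<lambda>t. K)"
    by (intro integral_norm_bound_integral integrable_continuous_real continuous_intros cf1)
       (use K in auto)
  finally have "\<bar>f x\<bar> \<le> K" using assms(2) by simp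
  then have "(f x)\<^sup>2 \<le> K\<^sup>2" by (metis abs_ge_zero power2_abs power_mono)
  also have "\<dots> \<le> (2 * pi * norm x)\<^sup>2 * integral {0..1} (\<lambda>t. (norm (g (rot t x)))\<^sup>2)"
    unfolding K_def power_mult_distrib[of "2 * pi * norm x"]
    by (intro mult_left_mono integral_01_square_le cg1) auto
  finally show ?thesis .
qed

text \<open>The shift e > 0 keeps the quotient continuous, so integrability is immediate. The
  singular quotient over |x|^2 is reached only after bounds uniform in e have been proved.\<close>

lemma quotient_integrable:
  fixes f :: "'a::euclidean_space \<Rightarrow> real"
  assumes "C1c f g" "e > 0" "m > 0"
  shows "integrable lborel (\<lambda>x. f x ^ m / ((norm x)\<^sup>2 + e))"
proof -
  obtain B where "B > 0" "\<And>x. norm x > B \<Longrightarrow> f x = 0"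
    using C1c_support[OF assms(1)] by metis
  moreover have "(norm x)\<^sup>2 + e \<noteq> 0" for x :: 'a
    using assms(2) by (metis add_nonneg_pos less_irrefl zero_le_power2)
  ultimately show ?thesis using assms(3)
    by (auto intro!: integrable_lborel_cont_bounded_support[of _ B] continuous_intros
        C1cD[OF assms(1)])
qed

lemma wirtinger:
  assumes "C1c f g" and "\<And>x. avg f x = 0" and "e > 0"
  shows "(\<integral>x. (f x)\<^sup>2 / ((norm x)\<^sup>2 + e) \<partial>lborel) \<le> 4 * pi\<^sup>2 * energy lborel g"
proof -
  obtain B where B: "B > 0" "\<And>x. norm x > B \<Longrightarrow> g x = 0"
    using C1c_support[OF assms(1)] by metis
  note cg = C1c_cont_grad[OF assms(1)]
  have av: "integrable lborel (\<lambda>x. integral {0..1} (\<lambda>t. (norm (g (rot t x)))\<^sup>2))"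
    "(\<integral>x. integral {0..1} (\<lambda>t. (norm (g (rot t x)))\<^sup>2) \<partial>lborel) = energy lborel g"
    by (rule integrable_average[where G = "\<lambda>x. (norm (g x))\<^sup>2" and B = B]
             integral_average_eq[where G = "\<lambda>x. (norm (g x))\<^sup>2" and B = B];
        use B in \<open>auto simp: distr_rot case_prod_unfold intro!: continuous_intros cg\<close>)+
  have "(f x)\<^sup>2 / ((norm x)\<^sup>2 + e) \<le> 4 * pi\<^sup>2 * integral {0..1} (\<lambda>t. (norm (g (rot t x)))\<^sup>2)" for x
  proof -
    define I where "I = integral {0..1} (\<lambda>t. (norm (g (rot t x)))\<^sup>2)"
    have I0: "0 \<le> I" unfolding I_def
      by (intro integral_nonneg integrable_continuous_real continuous_intros
          continuous_on_compose2[OF cg[of UNIV]]) auto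
    have pos: "(norm x)\<^sup>2 + e > 0" using assms(3) by (simp add: add_nonneg_pos)
    have "(f x)\<^sup>2 \<le> 4 * pi\<^sup>2 * I * (norm x)\<^sup>2"
      using wirtinger_pointwise[OF assms(1,2), of x] by (simp add: I_def power_mult_distrib algebra_simps)
    also have "\<dots> \<le> 4 * pi\<^sup>2 * I * ((norm x)\<^sup>2 + e)"
      using assms(3) I0 by (intro mult_left_mono) auto
    finally show ?thesis using pos by (simp add: I_def pos_divide_le_eq)
  qed
  then have "(\<integral>x. (f x)\<^sup>2 / ((norm x)\<^sup>2 + e) \<partial>lborel)
      \<le> (\<integral>x. 4 * pi\<^sup>2 * integral {0..1} (\<lambda>t. (norm (g (rot t x)))\<^sup>2) \<partial>lborel)"
    using quotient_integrable[OF assms(1,3), of 2] av(1) by (intro integral_mono) auto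
  then show ?thesis by (simp add: av)
qed

text \<open>Interpolation of the exponent k between 2 and 2k - 2, the two moments known at the
  corresponding stage of the induction.\<close>

lemma abs_power_le_square_plus:
  fixes y :: real
  assumes "k \<ge> 2"
  shows "\<bar>y\<bar> ^ k \<le> y\<^sup>2 + y ^ (2 * k - 2)"
proof (cases "\<bar>y\<bar> \<le> 1")
  case True
  then have "\<bar>y\<bar> ^ k \<le> \<bar>y\<bar> ^ 2" using assms by (intro power_decreasing) auto
  moreover have "y ^ (2 * k - 2) \<ge> 0" by (simp add: zero_le_even_power)
  ultimately show ?thesis by simp
next
  case False
  then have "\<bar>y\<bar> ^ k \<le> \<bar>y\<bar> ^ (2 * k - 2)" using assms by (intro power_increasing) auto
  also have "\<dots> = y ^ (2 * k - 2)" by (simp add: power_even_abs)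
  finally show ?thesis by (simp add: add_increasing)
qed

lemma abs_power_square: "(\<bar>y\<bar> ^ n)\<^sup>2 = (y::real) ^ (2 * n)"
proof -
  have "(\<bar>y\<bar> ^ n)\<^sup>2 = (\<bar>y\<bar>\<^sup>2) ^ n" by (simp only: power_mult[symmetric] mult.commute)
  then show ?thesis by (simp only: power2_abs power_mult)
qed

lemma DERIV_one_over_sqrt:
  assumes y: "(y::real) > 0"
  shows "((\<lambda>y. 1 / sqrt y) has_real_derivative - (1 / (2 * sqrt y ^ 3))) (at y)"
proof -
  have s: "sqrt y \<noteq> 0" using y by simp
  have "- (inverse (sqrt y) * (inverse (sqrt y) / 2) * inverse (sqrt y)) = - (1 / (2 * sqrt y ^ 3))"
    unfolding power3_eq_cube divide_inverse inverse_mult_distrib mult_1_left by (simp only: mult_ac)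
  then show ?thesis
    using DERIV_inverse'[OF DERIV_real_sqrt[OF y] s] unfolding inverse_eq_divide by (simp only:)
qed

text \<open>The Gagliardo--Nirenberg inequality for \<open>f\<^sup>k / \<surd>(|x|\<^sup>2 + e)\<close>; the bound is uniform in \<open>e\<close>.\<close>

lemma mean_zero_moment_step:
  fixes f :: "real^2 \<Rightarrow> real"
  assumes fg: "C1c f g" and e: "e > 0" and k: "k \<ge> 2"
    and D: "energy lborel g \<le> c"
    and M1: "(\<integral>x. (f x)\<^sup>2 / ((norm x)\<^sup>2 + e) \<partial>lborel) \<le> C1"
    and M2: "(\<integral>x. f x ^ (2 * k - 2) / ((norm x)\<^sup>2 + e) \<partial>lborel) \<le> C2"
  shows "(\<integral>x. f x ^ (2 * k) / ((norm x)\<^sup>2 + e) \<partial>lborel) \<le> (C1 + C2 + k / 2 * (C2 + c))\<^sup>2"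
proof -
  define s where "s = (\<lambda>x::real^2. sqrt ((norm x)\<^sup>2 + e))"
  have s0: "(norm x)\<^sup>2 + e > 0" for x :: "real^2" using e by (simp add: add_nonneg_pos)
  then have s: "s x > 0" "(s x)\<^sup>2 = (norm x)\<^sup>2 + e" "norm x \<le> s x" for x
    using e by (auto simp: s_def less_imp_le intro!: real_le_rsqrt)
  have cs: "continuous_on UNIV s" unfolding s_def by (intro continuous_intros)
  define gs where "gs = (\<lambda>x. - (1 / (s x) ^ 3) *\<^sub>R x)"
  have ds: "((\<lambda>x. 1 / s x) has_derivative (\<lambda>v. gs x \<bullet> v)) (at x)" for x
  proof -
    have 1: "((\<lambda>x. x \<bullet> x + e) has_derivative (\<lambda>v. 2 * (x \<bullet> v))) (at x)"
      by (auto intro!: derivative_eq_intros simp: inner_commute)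
    have yp: "x \<bullet> x + e > 0" and sy: "sqrt (x \<bullet> x + e) = s x"
      using s0[of x] by (simp_all add: s_def power2_norm_eq_inner)
    have 2: "((\<lambda>y. 1 / sqrt y) has_derivative (*) (- (1 / (2 * s x ^ 3)))) (at (x \<bullet> x + e))"
      using DERIV_one_over_sqrt[OF yp] unfolding has_field_derivative_def sy .
    show ?thesis
      using has_derivative_compose[OF 1 2] by (simp add: s_def power2_norm_eq_inner gs_def)
  qed
  have cgs: "continuous_on UNIV gs"
    unfolding gs_def using s(1) by (intro continuous_intros cs) (auto simp: less_imp_neq[symmetric])
  define h where "h = (\<lambda>x. f x ^ k * (1 / s x))"
  define gh where "gh = (\<lambda>x. f x ^ k *\<^sub>R gs x + (1 / s x) *\<^sub>R ((real k * f x ^ (k - 1)) *\<^sub>R g x))"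
  have h: "C1c h gh"
    unfolding h_def gh_def by (intro C1c_mult C1c_power fg ds cgs) (use k in auto)
  \<comment> \<open>Product rule. Differentiating the weight costs |f|^k / s^2, interpolated between
    the two known moments. Differentiating f^k costs k |f|^(k-1) / s times |g|, split by the
    arithmetic-geometric mean into the moment of order 2k - 2 and the energy.\<close>
  have gn: "norm (gh x) \<le> (f x)\<^sup>2 / ((norm x)\<^sup>2 + e) + f x ^ (2 * k - 2) / ((norm x)\<^sup>2 + e)
      + k / 2 * (f x ^ (2 * k - 2) / ((norm x)\<^sup>2 + e) + (norm (g x))\<^sup>2)" for x
  proof -
    have "norm (f x ^ k *\<^sub>R gs x) = \<bar>f x\<bar> ^ k * (norm x / s x ^ 3)"
      using s(1)[of x] by (simp add: gs_def power_abs)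
    also have "\<dots> \<le> ((f x)\<^sup>2 + f x ^ (2 * k - 2)) * (1 / (s x)\<^sup>2)"
    proof (intro mult_mono abs_power_le_square_plus k)
      show "norm x / s x ^ 3 \<le> 1 / (s x)\<^sup>2"
      proof -
        have "norm x / s x ^ 3 \<le> s x / s x ^ 3" using s[of x] by (intro divide_right_mono) auto
        also have "\<dots> = 1 / (s x)\<^sup>2" using s(1)[of x] by (simp add: power2_eq_square power3_eq_cube)
        finally show ?thesis .
      qed
      show "0 \<le> (f x)\<^sup>2 + f x ^ (2 * k - 2)" by (simp add: zero_le_even_power)
    qed (use s(1)[of x] in auto)
    finally have a: "norm (f x ^ k *\<^sub>R gs x)
        \<le> (f x)\<^sup>2 / ((norm x)\<^sup>2 + e) + f x ^ (2 * k - 2) / ((norm x)\<^sup>2 + e)"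
      by (simp add: s add_divide_distrib)
    have "norm ((1 / s x) *\<^sub>R ((real k * f x ^ (k - 1)) *\<^sub>R g x))
        = k * ((\<bar>f x\<bar> ^ (k - 1) / s x) * norm (g x))"
      using s(1)[of x] by (simp add: power_abs abs_mult)
    also have "\<dots> \<le> k * (((\<bar>f x\<bar> ^ (k - 1) / s x)\<^sup>2 + (norm (g x))\<^sup>2) / 2)"
      using sum_squares_bound[of "\<bar>f x\<bar> ^ (k - 1) / s x" "norm (g x)"]
      by (intro mult_left_mono) (auto simp: algebra_simps)
    also have "(\<bar>f x\<bar> ^ (k - 1) / s x)\<^sup>2 = f x ^ (2 * k - 2) / ((norm x)\<^sup>2 + e)"
    proof -
      have "(\<bar>f x\<bar> ^ (k - 1))\<^sup>2 = f x ^ (2 * (k - 1))"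
        by (rule abs_power_square)
      also have "2 * (k - 1) = 2 * k - 2" by simp
      finally have "(\<bar>f x\<bar> ^ (k - 1) / s x)\<^sup>2 = f x ^ (2 * k - 2) / (s x)\<^sup>2"
        by (simp only: power_divide)
      then show ?thesis by (simp only: s)
    qed
    finally have b: "norm ((1 / s x) *\<^sub>R ((real k * f x ^ (k - 1)) *\<^sub>R g x))
      \<le> k / 2 * (f x ^ (2 * k - 2) / ((norm x)\<^sup>2 + e) + (norm (g x))\<^sup>2)" by simp
    show ?thesis unfolding gh_def using norm_triangle_mono[OF a b] .
  qed
  note i = quotient_integrable[OF fg e, of 2] quotient_integrable[OF fg e, of "2 * k - 2"]
    C1c_integrable(4)[OF fg]
  have "(\<integral>x. norm (gh x) \<partial>lborel) \<le> (\<integral>x. (f x)\<^sup>2 / ((norm x)\<^sup>2 + e) + f x ^ (2 * k - 2) / ((norm x)\<^sup>2 + e)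
      + k / 2 * (f x ^ (2 * k - 2) / ((norm x)\<^sup>2 + e) + (norm (g x))\<^sup>2) \<partial>lborel)"
    using i k gn C1c_integrable(3)[OF h] by (intro integral_mono) auto
  also have "\<dots> = (\<integral>x. (f x)\<^sup>2 / ((norm x)\<^sup>2 + e) \<partial>lborel) + (\<integral>x. f x ^ (2 * k - 2) / ((norm x)\<^sup>2
      + e) \<partial>lborel)
      + k / 2 * ((\<integral>x. f x ^ (2 * k - 2) / ((norm x)\<^sup>2 + e) \<partial>lborel) + energy lborel g)"
    using i k by simp
  also have "\<dots> \<le> C1 + C2 + k / 2 * (C2 + c)"
    by (intro add_mono mult_left_mono M1 M2 D) auto
  finally have le: "(\<integral>x. norm (gh x) \<partial>lborel) \<le> C1 + C2 + k / 2 * (C2 + c)" .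
  have "f x ^ (2 * k) / ((norm x)\<^sup>2 + e) = (h x)\<^sup>2" for x
  proof -
    have "(h x)\<^sup>2 = (f x ^ k)\<^sup>2 / (s x)\<^sup>2" by (simp add: h_def power_divide)
    also have "(f x ^ k)\<^sup>2 = f x ^ (2 * k)" by (metis mult.commute power_mult)
    finally show ?thesis by (simp only: s)
  qed
  then have "(\<integral>x. f x ^ (2 * k) / ((norm x)\<^sup>2 + e) \<partial>lborel) = (\<integral>x. (h x)\<^sup>2 \<partial>lborel)" by simp
  also have "\<dots> \<le> (\<integral>x. norm (gh x) \<partial>lborel)\<^sup>2" by (rule gagliardo_nirenberg_2[OF h])
  also have "\<dots> \<le> (C1 + C2 + k / 2 * (C2 + c))\<^sup>2" by (intro power_mono le) simp
  finally show ?thesis .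
qed

text \<open>Induction on m with Wirtinger's inequality as base. The step takes k = m + 1, for which
  2k - 2 = 2m is the exponent of the induction hypothesis. The constant is chosen before f, g and
  e.\<close>

lemma mean_zero_moments_reg:
  assumes "m \<ge> 1"
  shows "\<exists>C. \<forall>f g e. C1c f g \<longrightarrow> (\<forall>x. avg f x = 0) \<longrightarrow> energy lborel g \<le> c \<longrightarrow> e > 0 \<longrightarrow>
     (\<integral>x. f x ^ (2 * m) / ((norm x)\<^sup>2 + e) \<partial>lborel) \<le> C"
  using assms
proof (induction m rule: nat_induct_at_least)
  case base
  have "(\<integral>x. f x ^ (2 * 1) / ((norm x)\<^sup>2 + e) \<partial>lborel) \<le> 4 * pi\<^sup>2 * c"
    if "C1c f g" "\<forall>x. avg f x = 0" "energy lborel g \<le> c" "e > 0" for f g e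
  proof -
    have "avg f x = 0" for x using that(2) by blast
    note wirtinger[OF that(1) this that(4)]
    also have "4 * pi\<^sup>2 * energy lborel g \<le> 4 * pi\<^sup>2 * c"
      using that(3) by (intro mult_left_mono) auto
    finally show ?thesis by simp
  qed
  then show ?case by blast
next
  case (Suc m)
  then obtain C where C: "\<And>f g e. C1c f g \<Longrightarrow> (\<forall>x. avg f x = 0) \<Longrightarrow> energy lborel g \<le> c \<Longrightarrow> e > 0 \<Longrightarrow>
     (\<integral>x. f x ^ (2 * m) / ((norm x)\<^sup>2 + e) \<partial>lborel) \<le> C" by blast
  have "(\<integral>x. f x ^ (2 * Suc m) / ((norm x)\<^sup>2 + e) \<partial>lborel) \<le> (4 * pi\<^sup>2 * c + C + Suc m / 2 * (C + c))\<^sup>2"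
    if f: "C1c f g" "\<forall>x. avg f x = 0" "energy lborel g \<le> c" "e > 0" for f g e
  proof (rule mean_zero_moment_step[OF f(1,4) _ f(3)])
    show "(\<integral>x. (f x)\<^sup>2 / ((norm x)\<^sup>2 + e) \<partial>lborel) \<le> 4 * pi\<^sup>2 * c"
    proof -
      have "avg f x = 0" for x using f(2) by blast
      note wirtinger[OF f(1) this f(4)]
      also have "4 * pi\<^sup>2 * energy lborel g \<le> 4 * pi\<^sup>2 * c"
        using f(3) by (intro mult_left_mono) auto
      finally show ?thesis by simp
    qed
    show "(\<integral>x. f x ^ (2 * Suc m - 2) / ((norm x)\<^sup>2 + e) \<partial>lborel) \<le> C"
      using C[OF f] by simp
  qed (use Suc in auto)
  then show ?case by blast
qed

lemma AE_lborel_neq: "AE x in lborel. x \<noteq> (c :: 'a::euclidean_space)"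
proof -
  have "AE x in lborel. x \<notin> {c}" by (intro AE_not_in finite_imp_null_set_lborel) simp
  then show ?thesis by simp
qed

lemma mean_zero_moments:
  assumes "m \<ge> 1"
  obtains C where "C \<ge> 0" "\<And>f g. C1c f g \<Longrightarrow> (\<And>x. avg f x = 0) \<Longrightarrow> energy lborel g \<le> c \<Longrightarrow>
     moment m f \<le> ennreal C"
proof -
  obtain C where C: "\<And>f g e. C1c f g \<Longrightarrow> (\<forall>x. avg f x = 0) \<Longrightarrow> energy lborel g \<le> c \<Longrightarrow> e > 0 \<Longrightarrow>
     (\<integral>x. f x ^ (2 * m) / ((norm x)\<^sup>2 + e) \<partial>lborel) \<le> C" using mean_zero_moments_reg[OF assms] by blast
  \<comment> \<open>The maximum with 0 is taken because the preceding statement gives no sign for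
    C.\<close>
  have "moment m f \<le> ennreal (max C 0)"
    if f: "C1c f g" "\<And>x. avg f x = 0" "energy lborel g \<le> c" for f g
  proof -
    define F where "F = (\<lambda>n x. f x ^ (2 * m) / ((norm x)\<^sup>2 + 1 / real (Suc n)))"
    have [measurable]: "f \<in> borel_measurable borel"
      by (intro borel_measurable_continuous_onI C1c_cont[OF f(1)])
    have m[measurable]: "F n \<in> borel_measurable lborel" for n unfolding F_def by measurable
    have lim: "(\<lambda>n. F n x) \<longlonglongrightarrow> f x ^ (2 * m) / (norm x)\<^sup>2" if "x \<noteq> 0" for x
    proof -
      have "(\<lambda>n. F n x) \<longlonglongrightarrow> f x ^ (2 * m) / ((norm x)\<^sup>2 + 0)"
        unfolding F_def using that
        by (intro tendsto_intros lim_inverse_n'[THEN LIMSEQ_Suc]) auto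
      then show ?thesis by simp
    qed
    have "moment m f = (\<integral>\<^sup>+x. liminf (\<lambda>n. ennreal (F n x)) \<partial>lborel)"
    proof (rule nn_integral_cong_AE)
      show "AE x in lborel. ennreal (f x ^ (2 * m) / (norm x)\<^sup>2) = liminf (\<lambda>n. ennreal (F n x))"
        using AE_lborel_neq[of 0]
      proof eventually_elim
        case (elim x)
        from tendsto_ennrealI[OF lim[OF this]] show ?case
          by (intro lim_imp_Liminf[symmetric]) auto
      qed
    qed
    also have "\<dots> \<le> liminf (\<lambda>n. \<integral>\<^sup>+x. ennreal (F n x) \<partial>lborel)"
      by (rule nn_integral_liminf) measurable
    also have "\<dots> \<le> liminf (\<lambda>n::nat. ennreal (max C 0))"
    proof (rule Liminf_mono, rule always_eventually, rule allI)
      fix n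
      have "(\<integral>\<^sup>+x. ennreal (F n x) \<partial>lborel) = ennreal (\<integral>x. F n x \<partial>lborel)"
        unfolding F_def using assms quotient_integrable[OF f(1), of "1 / real (Suc n)" "2 * m"]
        by (intro nn_integral_eq_integral) (auto simp: zero_le_even_power)
      also have "\<dots> \<le> ennreal (max C 0)"
        unfolding F_def using C[OF f(1) _ f(3), of "1 / real (Suc n)"] f(2) by (intro ennreal_leI) auto
      finally show "(\<integral>\<^sup>+x. ennreal (F n x) \<partial>lborel) \<le> ennreal (max C 0)" .
    qed
    finally show ?thesis by (simp add: Liminf_const)
  qed
  then show ?thesis using that[of "max C 0"] by auto
qed

subsection \<open>Radial functions and the Hardy inequality\<close>

text \<open>Two finite measures on the line agree once they agree on half-lines. Up to a null set,
  the condition - ln |x| > t with t \<ge> 0 describes the disc of radius exp (-t), whose area pi exp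
  (-2t) is also the integral of 2 pi exp (-2s) over s > t.\<close>

lemma nn_integral_polar_log:
  fixes F :: "real \<Rightarrow> ennreal"
  assumes [measurable]: "F \<in> borel_measurable borel"
  shows "(\<integral>\<^sup>+x. F (- ln (norm (x::real^2))) * indicator disc x \<partial>lborel)
    = (\<integral>\<^sup>+t. ennreal (2 * pi * exp (- 2 * t)) * indicator {0..} t * F t \<partial>lborel)"
proof -
  define M where "M = distr (restrict_space lborel disc) borel (\<lambda>x::real^2. - ln (norm x))"
  define N where "N = density lborel (\<lambda>t::real. ennreal (2 * pi * exp (- 2 * t)) * indicator {0..} t)"
  have m[measurable]: "(\<lambda>x::real^2. - ln (norm x)) \<in> borel_measurable (restrict_space lborel disc)"
    using measurable_restrict_space1[of "\<lambda>x::real^2. - ln (norm x)" lborel borel disc]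
    by (simp add: borel_measurable_uminus)
  \<comment> \<open>For negative t the condition is void on the unit disc, hence
    \<open>max t 0\<close>.\<close>
  have eM: "emeasure M {t<..} = ennreal (pi * exp (- 2 * max t 0))" for t
  proof -
    have "emeasure M {t<..} = emeasure (restrict_space lborel disc) ((\<lambda>x::real^2.
        - ln (norm x)) -` {t<..} \<inter> disc)"
      unfolding M_def by (subst emeasure_distr[OF m]) (auto simp: space_restrict_space)
    also have "\<dots> = emeasure lborel ((\<lambda>x::real^2. - ln (norm x)) -` {t<..} \<inter> disc)"
      by (subst emeasure_restrict_space) auto
    also have "\<dots> = emeasure lborel (ball (0::real^2) (exp (- max t 0)))"
    proof (rule emeasure_eq_AE)
      show "AE x in lborel. (x \<in> (\<lambda>x::real^2. - ln (norm x)) -` {t<..} \<inter> disc)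
          = (x \<in> ball 0 (exp (- max t 0)))"
        using AE_lborel_neq[of 0]
      proof eventually_elim
        case (elim x)
        have "norm x < 1 \<longleftrightarrow> ln (norm x) < 0" using elim by simp
        moreover have "norm x < exp (- max t 0) \<longleftrightarrow> ln (norm x) < - max t 0"
          using elim by (metis exp_less_cancel_iff exp_ln zero_less_norm_iff)
        ultimately show ?case by auto
      qed
    next
      have "(\<lambda>x::real^2. - ln (norm x)) \<in> borel_measurable borel" by measurable
      from measurable_sets_borel[OF this, of "{t<..}"]
      show "(\<lambda>x::real^2. - ln (norm x)) -` {t<..} \<inter> disc \<in> sets lborel" by simp
    qed auto
    also have "\<dots> = ennreal (pi * exp (- 2 * max t 0))"
    proof -
      have "(exp (- max t 0))\<^sup>2 = exp (- 2 * max t 0)" by (simp add: exp_double[symmetric])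
      then show ?thesis by (simp add: emeasure_ball unit_ball_vol_2)
    qed
    finally show ?thesis .
  qed
  have eN: "emeasure N {t<..} = ennreal (pi * exp (- 2 * max t 0))" for t
  proof -
    have "emeasure N {t<..} = (\<integral>\<^sup>+s. ennreal (2 * pi * exp (- 2 * s)) * indicator {0..} s
        * indicator {t<..} s \<partial>lborel)"
      unfolding N_def by (subst emeasure_density) auto
    also have "\<dots> = (\<integral>\<^sup>+s. ennreal (2 * pi * exp (- 2 * s)) * indicator {max t 0..} s \<partial>lborel)"
    proof (rule nn_integral_cong_AE)
      show "AE s in lborel. ennreal (2 * pi * exp (- 2 * s)) * indicator {0..} s * indicator {t<..} s
          = ennreal (2 * pi * exp (- 2 * s)) * indicator {max t 0..} s"
        using AE_lborel_neq[of t] by eventually_elim (auto simp: indicator_def)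
    qed
    also have "\<dots> = ennreal (0 - (- pi * exp (- 2 * max t 0)))"
    proof (rule nn_integral_FTC_atLeast)
      show "((\<lambda>s. - pi * exp (- 2 * s)) \<longlongrightarrow> 0) at_top"
      proof -
        have "filterlim (\<lambda>s::real. - 2 * s) at_bot at_top"
          by (rule filterlim_tendsto_neg_mult_at_bot[OF tendsto_const _ filterlim_ident]) simp
        from filterlim_compose[OF exp_at_bot this]
        show ?thesis by (intro tendsto_mult_right_zero)
      qed
    qed (auto intro!: derivative_eq_intros)
    finally show ?thesis by simp
  qed
  have "M = N"
    by (rule measure_eqI_lessThan) (auto simp: eM eN, auto simp: M_def N_def)
  have "(\<integral>\<^sup>+x. F (- ln (norm (x::real^2))) * indicator disc x \<partial>lborel)
      = (\<integral>\<^sup>+x. F (- ln (norm x)) \<partial>restrict_space lborel disc)"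
    by (subst nn_integral_restrict_space) auto
  also have "\<dots> = (\<integral>\<^sup>+t. F t \<partial>M)"
    unfolding M_def by (subst nn_integral_distr[OF m]) auto
  also have "\<dots> = (\<integral>\<^sup>+t. ennreal (2 * pi * exp (- 2 * t)) * indicator {0..} t * F t \<partial>lborel)"
    unfolding \<open>M = N\<close> N_def by (subst nn_integral_density) auto
  finally show ?thesis .
qed

lemma nn_integral_polar_log_weighted:
  fixes F :: "real \<Rightarrow> ennreal"
  assumes [measurable]: "F \<in> borel_measurable borel"
  shows "(\<integral>\<^sup>+x. F (- ln (norm (x::real^2))) * ennreal (1 / (norm x)\<^sup>2) * indicator disc x \<partial>lborel)
    = ennreal (2 * pi) * (\<integral>\<^sup>+t. F t * indicator {0..} t \<partial>lborel)"
proof -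
  have "(\<integral>\<^sup>+x. F (- ln (norm (x::real^2))) * ennreal (1 / (norm x)\<^sup>2) * indicator disc x \<partial>lborel)
      = (\<integral>\<^sup>+x. (\<lambda>t. F t * ennreal (exp (2 * t))) (- ln (norm (x::real^2))) * indicator disc x \<partial>lborel)"
  proof (rule nn_integral_cong_AE)
    show "AE x in lborel. F (- ln (norm (x::real^2))) * ennreal (1 / (norm x)\<^sup>2) * indicator disc x
        = (\<lambda>t. F t * ennreal (exp (2 * t))) (- ln (norm (x::real^2))) * indicator disc x"
      using AE_lborel_neq[of 0]
    proof eventually_elim
      case (elim x)
      then have "exp (2 * - ln (norm x)) = 1 / (norm x)\<^sup>2"
        by (simp add: exp_minus exp_double field_simps)
      then show ?case by simp
    qed
  qed
  also have "\<dots> = (\<integral>\<^sup>+t. ennreal (2 * pi * exp (- 2 * t)) * indicator {0..} t * (F t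
      * ennreal (exp (2 * t))) \<partial>lborel)"
    by (rule nn_integral_polar_log) measurable
  also have "\<dots> = (\<integral>\<^sup>+t. ennreal (2 * pi) * (F t * indicator {0..} t) \<partial>lborel)"
  proof (rule nn_integral_cong)
    fix t :: real
    have "ennreal (2 * pi * exp (- 2 * t)) * ennreal (exp (2 * t)) = ennreal (2 * pi)"
      by (simp add: exp_minus flip: ennreal_mult)
    then show "ennreal (2 * pi * exp (- 2 * t)) * indicator {0..} t * (F t * ennreal (exp (2 * t)))
        = ennreal (2 * pi) * (F t * indicator {0..} t)"
      by (metis (no_types, lifting) mult.assoc mult.commute)
  qed
  also have "\<dots> = ennreal (2 * pi) * (\<integral>\<^sup>+t. F t * indicator {0..} t \<partial>lborel)"
    by (rule nn_integral_cmult) measurable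
  finally show ?thesis .
qed

lemma nn_integral_Icc_continuous:
  fixes f :: "real \<Rightarrow> real"
  assumes "continuous_on {a..b} f" and "\<And>t. t \<in> {a..b} \<Longrightarrow> 0 \<le> f t"
  shows "(\<integral>\<^sup>+t. ennreal (f t) * indicator {a..b} t \<partial>lborel) = ennreal (integral {a..b} f)"
proof -
  have si: "set_integrable lborel {a..b} f"
    unfolding set_integrable_def using assms(1) by (intro borel_integrable_compact) auto
  have "(\<integral>\<^sup>+t. ennreal (f t) * indicator {a..b} t \<partial>lborel)
      = (\<integral>\<^sup>+t. ennreal (indicator {a..b} t * f t) \<partial>lborel)"
    by (intro nn_integral_cong) (auto simp: indicator_def)
  also have "\<dots> = ennreal (integral {a..b} f)"
    using set_borel_integral_eq_integral(2)[OF si] si assms(2)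
    by (subst nn_integral_eq_integral) (auto simp: set_lebesgue_integral_def set_integrable_def indicator_def)
  finally show ?thesis .
qed

lemma nn_integral_atLeast_le:
  fixes f :: "real \<Rightarrow> ennreal"
  assumes [measurable]: "f \<in> borel_measurable borel"
    and "\<And>n::nat. (\<integral>\<^sup>+t. f t * indicator {0..real n} t \<partial>lborel) \<le> C"
  shows "(\<integral>\<^sup>+t. f t * indicator {0..} t \<partial>lborel) \<le> C"
proof -
  have "f t * indicator {0..} t = liminf (\<lambda>n. f t * indicator {0..real n} t)" for t
  proof (rule lim_imp_Liminf[symmetric])
    obtain N :: nat where "t \<le> real N" using real_arch_simple by blast
    then have "eventually (\<lambda>n. f t * indicator {0..} t = f t * indicator {0..real n} t) sequentially"
      by (intro eventually_sequentiallyI[of N]) (auto simp: indicator_def)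
    then show "(\<lambda>n. f t * indicator {0..real n} t) \<longlonglongrightarrow> f t * indicator {0..} t"
      by (rule Lim_transform_eventually[rotated]) auto
  qed simp
  then have "(\<integral>\<^sup>+t. f t * indicator {0..} t \<partial>lborel)
      = (\<integral>\<^sup>+t. liminf (\<lambda>n. f t * indicator {0..real n} t) \<partial>lborel)"
    by simp
  also have "\<dots> \<le> liminf (\<lambda>n. \<integral>\<^sup>+t. f t * indicator {0..real n} t \<partial>lborel)"
    by (rule nn_integral_liminf) measurable
  also have "\<dots> \<le> liminf (\<lambda>n::nat. C)"
    by (intro Liminf_mono always_eventually allI assms(2))
  finally show ?thesis by (simp add: Liminf_const)
qed

lemma finite_energy_abs_le_sqrt:
  fixes H :: "real \<Rightarrow> real"
  assumes d: "\<And>t. (H has_real_derivative H' t) (at t)" and c: "continuous_on UNIV H'" and "H 0 = 0"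
    and e: "\<And>T. T \<ge> 0 \<Longrightarrow> integral {0..T} (\<lambda>t. (H' t)\<^sup>2) \<le> 1" and t: "t \<ge> 0"
  shows "\<bar>H t\<bar> \<le> sqrt t"
proof (cases "t = 0")
  case False
  with t have t0: "t > 0" by simp
  have c': "continuous_on S H'" for S using c continuous_on_subset by blast
  \<comment> \<open>Young's inequality with parameter s replaces Cauchy-Schwarz; this value makes
    both resulting terms at most s / 2.\<close>
  define s where "s = sqrt t"
  have s: "s > 0" "s * s = t" using t0 by (simp_all add: s_def)
  have h: "(H' has_integral H t - H 0) {0..t}"
    by (rule fundamental_theorem_of_calculus)
       (use t d in \<open>auto simp: has_real_derivative_iff_has_vector_derivative[symmetric] intro: has_field_derivative_at_within\<close>)
  have "\<bar>H t\<bar> = norm (integral {0..t} H')"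
    using h \<open>H 0 = 0\<close> by (simp add: integral_unique)
  also have "\<dots> \<le> integral {0..t} (\<lambda>\<tau>. s / 2 * (H' \<tau>)\<^sup>2 + 1 / (2 * s))"
  proof (rule integral_norm_bound_integral)
    show "H' integrable_on {0..t}" using h by auto
    show "(\<lambda>\<tau>. s / 2 * (H' \<tau>)\<^sup>2 + 1 / (2 * s)) integrable_on {0..t}"
      by (intro integrable_continuous_real continuous_intros c')
    show "norm (H' \<tau>) \<le> s / 2 * (H' \<tau>)\<^sup>2 + 1 / (2 * s)" for \<tau>
    proof -
      have "2 * (s * \<bar>H' \<tau>\<bar>) * 1 \<le> (s * \<bar>H' \<tau>\<bar>)\<^sup>2 + 1\<^sup>2"
        using sum_squares_bound[of "s * \<bar>H' \<tau>\<bar>" 1] by simp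
      then show ?thesis using s(1) by (simp add: field_simps power2_eq_square)
    qed
  qed
  also have "\<dots> = s / 2 * integral {0..t} (\<lambda>t. (H' t)\<^sup>2) + t * (1 / (2 * s))"
  proof -
    have "((\<lambda>t. (H' t)\<^sup>2) has_integral integral {0..t} (\<lambda>t. (H' t)\<^sup>2)) {0..t}"
      by (intro integrable_integral integrable_continuous_real continuous_intros c')
    from has_integral_add[OF has_integral_mult_right[OF this, of "s / 2"]
        has_integral_const_real[of "1 / (2 * s)" 0 t]]
    show ?thesis using t by (simp add: integral_unique)
  qed
  also have "\<dots> \<le> s / 2 * 1 + s / 2"
  proof (intro add_mono mult_left_mono e t)
    have "t * (1 / (2 * s)) = (s * s) * (1 / (2 * s))" by (simp only: s)
    then show "t * (1 / (2 * s)) \<le> s / 2" using s(1) by simp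
  qed (use s in auto)
  finally show ?thesis by (simp add: s_def)
qed (use assms in simp)

text \<open>Integrate the derivative of - H^2 / (t + A): the boundary value at 0 vanishes and the
  one at T is nonpositive. With p = H / (t + A) this bounds the integral of p^2 - 2 p H' by 0, and
  (p - 2 H')^2 \<ge> 0 absorbs the mixed term.\<close>

lemma hardy_shifted:
  fixes H :: "real \<Rightarrow> real"
  assumes d: "\<And>t. (H has_real_derivative H' t) (at t)" and c: "continuous_on UNIV H'" and "H 0 = 0"
    and A: "A > 0" and T: "T \<ge> 0"
  shows "integral {0..T} (\<lambda>t. (H t)\<^sup>2 / (t + A)\<^sup>2) \<le> 4 * integral {0..T} (\<lambda>t. (H' t)\<^sup>2)"
proof -
  have c': "continuous_on S H'" for S using c continuous_on_subset by blast
  have cH: "continuous_on S H" for S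
    by (meson DERIV_isCont continuous_at_imp_continuous_on d)
  define I where "I = integral {0..T} (\<lambda>t. (H t)\<^sup>2 / (t + A)\<^sup>2)"
  define J where "J = integral {0..T} (\<lambda>t. (H' t)\<^sup>2)"
  have I: "((\<lambda>t. (H t)\<^sup>2 / (t + A)\<^sup>2) has_integral I) {0..T}"
    unfolding I_def using A by (intro integrable_integral integrable_continuous_real continuous_intros cH) auto
  have J: "((\<lambda>t. (H' t)\<^sup>2) has_integral J) {0..T}"
    unfolding J_def by (intro integrable_integral integrable_continuous_real continuous_intros c')
  have B: "((\<lambda>t. (H t)\<^sup>2 / (t + A)\<^sup>2 - 2 * H t * H' t / (t + A)) has_integral
      - ((H T)\<^sup>2 / (T + A)) - - ((H 0)\<^sup>2 / (0 + A))) {0..T}"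
  proof (rule fundamental_theorem_of_calculus[OF T])
    fix t assume t: "t \<in> {0..T}"
    have "((\<lambda>t. - ((H t)\<^sup>2 / (t + A))) has_real_derivative (H t)\<^sup>2 / (t + A)\<^sup>2 - 2 * H t * H' t / (t
        + A)) (at t)"
    proof -
      have s: "t + A \<noteq> 0" using t A by auto
      have "2 * H t * H' t * (t + A) / (t + A)\<^sup>2 = 2 * H t * H' t / (t + A)"
        using s by (simp add: power2_eq_square)
      then show ?thesis
        using s by (auto intro!: derivative_eq_intros d simp: diff_divide_distrib mult_ac simp flip: power2_eq_square)
    qed
    then show "((\<lambda>t. - ((H t)\<^sup>2 / (t + A))) has_vector_derivative (H t)\<^sup>2 / (t + A)\<^sup>2 - 2 * H t
        * H' t / (t + A)) (at t within {0..T})"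
      by (simp add: has_real_derivative_iff_has_vector_derivative[symmetric] has_field_derivative_at_within)
  qed
  have "1 / 2 * I - 2 * J \<le> - ((H T)\<^sup>2 / (T + A)) - - ((H 0)\<^sup>2 / (0 + A))"
  proof (rule has_integral_le[OF _ B])
    show "((\<lambda>t. 1 / 2 * ((H t)\<^sup>2 / (t + A)\<^sup>2) - 2 * (H' t)\<^sup>2) has_integral 1 / 2 * I - 2 * J) {0..T}"
      by (intro has_integral_diff has_integral_mult_right I J)
    fix t assume t: "t \<in> {0..T}"
    define p where "p = H t / (t + A)"
    have "(H t)\<^sup>2 / (t + A)\<^sup>2 = p\<^sup>2" "2 * H t * H' t / (t + A) = 2 * (p * H' t)"
      by (simp_all add: p_def power_divide)
    moreover have "(p - 2 * H' t)\<^sup>2 = p\<^sup>2 - 4 * (p * H' t) + 4 * (H' t)\<^sup>2"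
      by (simp add: power2_eq_square algebra_simps)
    moreover have "0 \<le> (p - 2 * H' t)\<^sup>2" by simp
    ultimately show "1 / 2 * ((H t)\<^sup>2 / (t + A)\<^sup>2) - 2 * (H' t)\<^sup>2
        \<le> (H t)\<^sup>2 / (t + A)\<^sup>2 - 2 * H t * H' t / (t + A)"
      by linarith
  qed
  moreover have "(H T)\<^sup>2 / (T + A) \<ge> 0" using A T by simp
  ultimately have "I \<le> 4 * J" using \<open>H 0 = 0\<close> by simp
  then show ?thesis by (simp add: I_def J_def)
qed

text \<open>The q - 2 surplus powers of |h|, a nonnegative number of them since q \<ge> 2, are
  traded for powers of sqrt s. The exponents of s then add up to (q - 2)/2 - 1 - q/2 = -2, so q
  disappears from the bound.\<close>

lemma powr_weight_le:
  fixes h :: real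
  assumes "q \<ge> 2" "s > 0" "\<bar>h\<bar> \<le> sqrt s"
  shows "\<bar>h\<bar> powr q * s powr (- 1 - q / 2) \<le> h\<^sup>2 / s\<^sup>2"
proof -
  have "\<bar>h\<bar> powr q = \<bar>h\<bar> powr (2 + (q - 2))" by simp
  also have "\<dots> = \<bar>h\<bar> powr 2 * \<bar>h\<bar> powr (q - 2)" by (rule powr_add)
  also have "\<dots> \<le> \<bar>h\<bar> powr 2 * (sqrt s) powr (q - 2)"
    using assms by (intro mult_left_mono powr_mono2) auto
  also have "sqrt s = s powr (1 / 2)" using assms(2) by (simp add: powr_half_sqrt)
  also have "\<bar>h\<bar> powr 2 = h\<^sup>2" by simp
  finally have "\<bar>h\<bar> powr q * s powr (- 1 - q / 2)
      \<le> h\<^sup>2 * (s powr (1 / 2)) powr (q - 2) * s powr (- 1 - q / 2)"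
    by (rule mult_right_mono) simp
  also have "\<dots> = h\<^sup>2 * s powr (- 2)"
    using assms(2) by (simp add: powr_powr mult.assoc flip: powr_add) (simp add: field_simps)
  also have "\<dots> = h\<^sup>2 / s\<^sup>2"
    using assms(2) by (simp add: powr_minus divide_inverse)
  finally show ?thesis .
qed

text \<open>Pointwise comparison reduces the left side to Hardy's integral on each [0, n]; the
  resulting bound 4 depends on neither A nor q.\<close>

lemma weighted_line_bound:
  fixes H :: "real \<Rightarrow> real"
  assumes d: "\<And>t. (H has_real_derivative H' t) (at t)" and c: "continuous_on UNIV H'" and "H 0 = 0"
    and e: "\<And>T. T \<ge> 0 \<Longrightarrow> integral {0..T} (\<lambda>t. (H' t)\<^sup>2) \<le> 1" and A: "A > 0" and q: "q \<ge> 2"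
  shows "(\<integral>\<^sup>+t. ennreal (\<bar>H t\<bar> powr q * (t + A) powr (- 1 - q / 2)) * indicator {0..} t \<partial>lborel) \<le> 4"
proof (rule nn_integral_atLeast_le)
  have cH: "continuous_on S H" for S
    by (meson DERIV_isCont continuous_at_imp_continuous_on d)
  have [measurable]: "H \<in> borel_measurable borel"
    by (intro borel_measurable_continuous_onI cH)
  show "(\<lambda>t. ennreal (\<bar>H t\<bar> powr q * (t + A) powr (- 1 - q / 2))) \<in> borel_measurable borel"
    by measurable
  fix n :: nat
  have "(\<integral>\<^sup>+t. ennreal (\<bar>H t\<bar> powr q * (t + A) powr (- 1 - q / 2)) * indicator {0..real n} t \<partial>lborel)
      \<le> (\<integral>\<^sup>+t. ennreal ((H t)\<^sup>2 / (t + A)\<^sup>2) * indicator {0..real n} t \<partial>lborel)"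
  proof (rule nn_integral_mono)
    fix t :: real
    show "ennreal (\<bar>H t\<bar> powr q * (t + A) powr (- 1 - q / 2)) * indicator {0..real n} t
      \<le> ennreal ((H t)\<^sup>2 / (t + A)\<^sup>2) * indicator {0..real n} t"
    proof (cases "t \<in> {0..real n}")
      case True
      have "\<bar>H t\<bar> \<le> sqrt t"
        using finite_energy_abs_le_sqrt[OF d c \<open>H 0 = 0\<close> e] True by simp
      also have "\<dots> \<le> sqrt (t + A)" using A by simp
      finally show ?thesis using True A
        by (auto simp: indicator_def intro!: ennreal_leI powr_weight_le q)
    qed simp
  qed
  also have "\<dots> = ennreal (integral {0..real n} (\<lambda>t. (H t)\<^sup>2 / (t + A)\<^sup>2))"
    using A by (intro nn_integral_Icc_continuous continuous_intros cH) auto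
  also have "\<dots> \<le> ennreal 4"
    using hardy_shifted[OF d c \<open>H 0 = 0\<close> A, of "real n"] e[of "real n"] by (intro ennreal_leI) simp
  finally show "(\<integral>\<^sup>+t. ennreal (\<bar>H t\<bar> powr q * (t + A) powr (- 1 - q / 2))
      * indicator {0..real n} t \<partial>lborel) \<le> 4"
    by simp
qed

text \<open>In the variable t = - ln |x| all that counts is the behaviour along one ray: vanishing
  for |x| \<ge> 1 becomes H 0 = 0, and only the radial component of g enters H'. The constant is 2
  pi from the change of variables times 4 from Hardy's inequality.\<close>

lemma radial_weighted_bound:
  fixes f :: "real^2 \<Rightarrow> real"
  assumes fg: "C1c f g" and rf: "\<And>x. f x = f (norm x *\<^sub>R axis 1 1)"
    and rg: "\<And>x. norm (g x) = norm (g (norm x *\<^sub>R axis 1 1))"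
    and f0: "\<And>x. norm x \<ge> 1 \<Longrightarrow> f x = 0"
    and E: "energy lborel g \<le> 1" and a: "a > 1" and q: "q \<ge> 2"
  shows "(\<integral>\<^sup>+x. ennreal (log_weight a q x * \<bar>f x\<bar> powr q) * indicator disc x \<partial>lborel) \<le> ennreal (8 * pi)"
proof -
  define e1 :: "real^2" where "e1 = axis 1 1"
  have ne1[simp]: "norm e1 = 1" by (simp add: e1_def)
  define H where "H = (\<lambda>t. f (exp (- t) *\<^sub>R e1))"
  define H' where "H' = (\<lambda>t. - (exp (- t) * (g (exp (- t) *\<^sub>R e1) \<bullet> e1)))"
  define G where "G = (\<lambda>t. (norm (g (exp (- t) *\<^sub>R e1)))\<^sup>2 * exp (- 2 * t))"
  note cg = C1c_cont_grad[OF fg] and cf = C1c_cont[OF fg]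
  have d: "(H has_real_derivative H' t) (at t)" for t
  proof -
    have "((\<lambda>t. exp (- t) *\<^sub>R e1) has_derivative (\<lambda>h. (- exp (- t) * h) *\<^sub>R e1)) (at t)"
      by (auto intro!: derivative_eq_intros)
    from has_derivative_compose[OF this C1c_deriv[OF fg]]
    have "(H has_derivative (\<lambda>h. g (exp (- t) *\<^sub>R e1) \<bullet> ((- exp (- t) * h) *\<^sub>R e1))) (at t)"
      unfolding H_def .
    moreover have "(\<lambda>h. g (exp (- t) *\<^sub>R e1) \<bullet> ((- exp (- t) * h) *\<^sub>R e1)) = (*) (H' t)"
      by (auto simp: H'_def)
    ultimately show ?thesis by (simp only: has_field_derivative_def)
  qed
  have c: "continuous_on UNIV H'"
    unfolding H'_def by (intro continuous_intros continuous_on_compose2[OF cg[of UNIV]]) auto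
  have cG: "continuous_on S G" for S
    unfolding G_def by (intro continuous_intros continuous_on_compose2[OF cg[of UNIV]]) auto
  have [measurable]: "G \<in> borel_measurable borel" "H \<in> borel_measurable borel" "g \<in> borel_measurable borel"
    "f \<in> borel_measurable borel"
    by (auto intro!: borel_measurable_continuous_onI cG cg cf DERIV_isCont[OF d] continuous_at_imp_continuous_on)
  have G: "(H' t)\<^sup>2 \<le> G t" "0 \<le> G t" for t
  proof -
    have "\<bar>H' t\<bar> \<le> exp (- t) * norm (g (exp (- t) *\<^sub>R e1))"
      using Cauchy_Schwarz_ineq2[of "g (exp (- t) *\<^sub>R e1)" e1] by (simp add: H'_def abs_mult)
    then have "\<bar>H' t\<bar>\<^sup>2 \<le> (exp (- t) * norm (g (exp (- t) *\<^sub>R e1)))\<^sup>2" by (intro power_mono) auto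
    also have "\<dots> = G t"
    proof -
      have "(exp (- t))\<^sup>2 = exp (- 2 * t)" by (simp add: exp_double[symmetric])
      then show ?thesis unfolding G_def power_mult_distrib by (simp only: mult.commute)
    qed
    finally show "(H' t)\<^sup>2 \<le> G t" by simp
  qed (simp add: G_def)
  have "ennreal (2 * pi) * (\<integral>\<^sup>+t. ennreal (G t) * indicator {0..} t \<partial>lborel)
      = (\<integral>\<^sup>+x. ennreal (G (- ln (norm (x::real^2)))) * ennreal (1 / (norm x)\<^sup>2) * indicator disc x \<partial>lborel)"
    by (rule nn_integral_polar_log_weighted[symmetric]) measurable
  also have "\<dots> \<le> (\<integral>\<^sup>+x. ennreal ((norm (g x))\<^sup>2) \<partial>lborel)"
  proof (rule nn_integral_mono_AE)
    show "AE x in lborel. ennreal (G (- ln (norm (x::real^2)))) * ennreal (1 / (norm x)\<^sup>2)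
        * indicator disc x \<le> ennreal ((norm (g x))\<^sup>2)"
      using AE_lborel_neq[of 0]
    proof eventually_elim
      case (elim x)
      have "exp (2 * ln (norm x)) = (norm x)\<^sup>2" using elim by (simp add: exp_double)
      then have "G (- ln (norm x)) * (1 / (norm x)\<^sup>2) = (norm (g x))\<^sup>2"
        using elim rg[of x, folded e1_def] by (simp add: G_def)
      then have "ennreal (G (- ln (norm x))) * ennreal (1 / (norm x)\<^sup>2) = ennreal ((norm (g x))\<^sup>2)"
        using G(2) by (metis ennreal_mult')
      then show ?case by (auto simp: indicator_def)
    qed
  qed
  also have "\<dots> = ennreal (energy lborel g)"
    by (intro nn_integral_eq_integral C1c_integrable[OF fg]) auto
  also have "\<dots> \<le> ennreal 1" by (intro ennreal_leI E)
  finally have *: "ennreal (2 * pi) * (\<integral>\<^sup>+t. ennreal (G t) * indicator {0..} t \<partial>lborel) \<le> 1" by simp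
  have e: "integral {0..T} (\<lambda>t. (H' t)\<^sup>2) \<le> 1" if "T \<ge> 0" for T
  proof -
    have "ennreal (integral {0..T} (\<lambda>t. (H' t)\<^sup>2))
        = (\<integral>\<^sup>+t. ennreal ((H' t)\<^sup>2) * indicator {0..T} t \<partial>lborel)"
      by (intro nn_integral_Icc_continuous[symmetric] continuous_intros continuous_on_subset[OF c]) auto
    also have "\<dots> \<le> (\<integral>\<^sup>+t. ennreal (G t) * indicator {0..} t \<partial>lborel)"
      using G by (intro nn_integral_mono mult_mono ennreal_leI) (auto simp: indicator_def)
    \<comment> \<open>The factor 2 pi \<ge> 1 is given away to reach the normalisation used by
      \<open>weighted_line_bound\<close>.\<close>
    also have "\<dots> \<le> ennreal (2 * pi) * (\<integral>\<^sup>+t. ennreal (G t) * indicator {0..} t \<partial>lborel)"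
    proof -
      have "ennreal 1 \<le> ennreal (2 * pi)" using pi_gt3 by (intro ennreal_leI) simp
      from mult_right_mono[OF this] show ?thesis by simp
    qed
    also note *
    finally show ?thesis by simp
  qed
  have H0: "H 0 = 0" using f0[of e1] by (simp add: H_def)
  have A: "ln a > 0" using a by simp
  have "(\<integral>\<^sup>+x. ennreal (log_weight a q x * \<bar>f x\<bar> powr q) * indicator disc x \<partial>lborel)
      = (\<integral>\<^sup>+x. ennreal (\<bar>H (- ln (norm (x::real^2)))\<bar> powr q * (- ln (norm x) + ln a) powr (- 1 - q / 2))
          * ennreal (1 / (norm x)\<^sup>2) * indicator disc x \<partial>lborel)"
  proof (rule nn_integral_cong_AE)
    show "AE x in lborel. ennreal (log_weight a q x * \<bar>f x\<bar> powr q) * indicator disc x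
      = ennreal (\<bar>H (- ln (norm (x::real^2)))\<bar> powr q * (- ln (norm x) + ln a) powr (- 1 - q / 2))
          * ennreal (1 / (norm x)\<^sup>2) * indicator disc x"
      using AE_lborel_neq[of 0]
    proof eventually_elim
      case (elim x)
      have "H (- ln (norm x)) = f x" using rf[of x, folded e1_def] elim by (simp add: H_def)
      moreover have "norm x powr (- 2) = 1 / (norm x)\<^sup>2" using elim by (simp add: powr_minus divide_inverse)
      moreover have "ln (a / norm x) = - ln (norm x) + ln a" using elim a by (simp add: ln_div)
      ultimately show ?case
        by (simp add: log_weight_def mult_ac flip: ennreal_mult')
    qed
  qed
  also have "\<dots> = ennreal (2 * pi) * (\<integral>\<^sup>+t. ennreal (\<bar>H t\<bar> powr q * (t + ln a) powr (- 1 - q / 2))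
      * indicator {0..} t \<partial>lborel)"
    by (rule nn_integral_polar_log_weighted) measurable
  also have "\<dots> \<le> ennreal (2 * pi) * 4"
    by (intro mult_left_mono weighted_line_bound[OF d c H0 e A q]) auto
  also have "\<dots> = ennreal (8 * pi)"
    by (simp flip: ennreal_numeral ennreal_mult')
  finally show ?thesis .
qed

subsection \<open>The weighted inequality\<close>

lemma borel_measurable_disc_measure:
  "f \<in> borel_measurable borel \<Longrightarrow> f \<in> borel_measurable disc_measure"
  by (intro measurable_restrict_space1 measurable_completion) simp

lemma integrable_indicator_disc: "integrable lborel (indicator disc :: real^2 \<Rightarrow> real)"
  using emeasure_lborel_ball_finite[of "0::real^2" 1] by (intro integrable_real_indicator) auto

lemma log_weight_measurable [measurable]: "log_weight a q \<in> borel_measurable borel"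
  unfolding log_weight_def by measurable

lemma log_weight_nonneg: "0 \<le> log_weight a q x"
  by (simp add: log_weight_def)

lemma nn_integral_log_measure:
  assumes [measurable]: "F \<in> borel_measurable disc_measure"
  shows "(\<integral>\<^sup>+x. F x \<partial>log_measure a q) = (\<integral>\<^sup>+x. ennreal (log_weight a q x) * F x * indicator disc x \<partial>lborel)"
proof -
  have [measurable]: "log_weight a q \<in> borel_measurable disc_measure"
    by (intro measurable_restrict_space1 measurable_completion) (auto simp: measurable_lborel1)
  have "(\<integral>\<^sup>+x. F x \<partial>log_measure a q) = (\<integral>\<^sup>+x. ennreal (log_weight a q x) * F x \<partial>disc_measure)"
    unfolding log_measure_def by (subst nn_integral_density) auto
  also have "\<dots> = (\<integral>\<^sup>+x. ennreal (log_weight a q x) * F x * indicator disc x \<partial>lebesgue)"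
    by (subst nn_integral_restrict_space) auto
  finally show ?thesis by (simp add: nn_integral_completion)
qed

lemma log_weight_le:
  assumes "a > 1" "q \<ge> 2" "norm x < 1" "x \<noteq> 0"
  shows "log_weight a q x \<le> ln a powr (- 1 - q / 2) * (1 / (norm x)\<^sup>2)"
proof -
  have "norm x powr (- 2) = 1 / (norm x)\<^sup>2" using assms by (simp add: powr_minus divide_inverse)
  moreover have "ln a \<le> ln (a / norm x)"
    using assms by (subst ln_le_cancel_iff) (auto simp: field_simps)
  then have "ln (a / norm x) powr (- 1 - q / 2) \<le> ln a powr (- 1 - q / 2)"
    using assms by (intro powr_mono2') auto
  ultimately show ?thesis
    unfolding log_weight_def by (simp add: mult.commute divide_right_mono)
qed

lemma abs_powr_le_powers:
  fixes y :: real
  assumes "2 \<le> q" "q \<le> real (2 * m)"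
  shows "\<bar>y\<bar> powr q \<le> y\<^sup>2 + y ^ (2 * m)"
proof (cases "\<bar>y\<bar> \<le> 1")
  case True
  then have "\<bar>y\<bar> powr q \<le> \<bar>y\<bar> powr 2"
    using assms(1) by (intro powr_mono') auto
  also have "\<dots> = y\<^sup>2" by simp
  also have "\<dots> \<le> y\<^sup>2 + y ^ (2 * m)" by (simp add: zero_le_even_power)
  finally show ?thesis .
next
  case False
  then have "\<bar>y\<bar> powr q \<le> \<bar>y\<bar> powr real (2 * m)" using assms by (intro powr_mono) auto
  also have "\<dots> = \<bar>y\<bar> ^ (2 * m)" using False by (subst powr_realpow) auto
  also have "\<dots> = y ^ (2 * m)" by (simp add: power_even_abs)
  finally show ?thesis by (simp add: add_increasing)
qed

text \<open>A substitute for Minkowski's inequality at the level of q-th powers; the factor 2^q is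
  harmless where only smallness or finiteness is claimed.\<close>

lemma abs_add_powr_le:
  fixes x y :: real
  assumes "q \<ge> 0"
  shows "\<bar>x + y\<bar> powr q \<le> 2 powr q * (\<bar>x\<bar> powr q + \<bar>y\<bar> powr q)"
proof -
  have "\<bar>x + y\<bar> powr q \<le> (2 * max \<bar>x\<bar> \<bar>y\<bar>) powr q"
    using assms by (intro powr_mono2) auto
  also have "\<dots> = 2 powr q * (max \<bar>x\<bar> \<bar>y\<bar>) powr q" by (subst powr_mult) auto
  also have "\<dots> \<le> 2 powr q * (\<bar>x\<bar> powr q + \<bar>y\<bar> powr q)"
    by (intro mult_left_mono) (auto simp: max_def)
  finally show ?thesis .
qed

text \<open>Split at R = 1 + 1/e. Below R all but one power of |y| is bounded by a constant; above R
  one has e |y| \<ge> 1, so an extra power can be inserted, for which q + 1 \<le> 2m leaves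
  room.\<close>

lemma abs_powr_le_young:
  assumes q: "q \<ge> 1" and m: "q + 1 \<le> real (2 * m)" and e: "e > 0"
  obtains K where "K \<ge> 0" "\<And>y. \<bar>y\<bar> powr q \<le> K * \<bar>y\<bar> + e * (y::real) ^ (2 * m)"
proof -
  define R where "R = 1 + 1 / e"
  have R: "R \<ge> 1" using e by (simp add: R_def)
  have "\<bar>y\<bar> powr q \<le> R powr (q - 1) * \<bar>y\<bar> + e * y ^ (2 * m)" for y
  proof (cases "\<bar>y\<bar> \<le> R")
    case True
    have "\<bar>y\<bar> powr q = \<bar>y\<bar> powr ((q - 1) + 1)" by simp
    also have "\<dots> = \<bar>y\<bar> powr (q - 1) * \<bar>y\<bar> powr 1" by (rule powr_add)
    also have "\<dots> \<le> R powr (q - 1) * \<bar>y\<bar> powr 1"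
      using True q by (intro mult_right_mono powr_mono2) auto
    also have "\<dots> = R powr (q - 1) * \<bar>y\<bar>" by simp
    also have "\<dots> \<le> R powr (q - 1) * \<bar>y\<bar> + e * y ^ (2 * m)"
      using e by (simp add: zero_le_even_power)
    finally show ?thesis .
  next
    case False
    then have y: "\<bar>y\<bar> > R" "\<bar>y\<bar> \<ge> 1" using R by auto
    have "1 \<le> e * \<bar>y\<bar>"
    proof -
      have "1 \<le> e * R" using e by (simp add: R_def field_simps)
      also have "\<dots> \<le> e * \<bar>y\<bar>" using e y by (intro mult_left_mono) auto
      finally show ?thesis .
    qed
    then have "\<bar>y\<bar> powr q * 1 \<le> \<bar>y\<bar> powr q * (e * \<bar>y\<bar>)" by (intro mult_left_mono) auto
    also have "\<dots> = e * (\<bar>y\<bar> powr q * \<bar>y\<bar> powr 1)" by simp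
    also have "\<bar>y\<bar> powr q * \<bar>y\<bar> powr 1 = \<bar>y\<bar> powr (q + 1)" by (rule powr_add[symmetric])
    also have "e * \<dots> \<le> e * \<bar>y\<bar> powr real (2 * m)"
      using e y m by (intro mult_left_mono powr_mono) auto
    also have "\<bar>y\<bar> powr real (2 * m) = \<bar>y\<bar> ^ (2 * m)" using y by (subst powr_realpow) auto
    also have "\<dots> = y ^ (2 * m)" by (simp add: power_even_abs)
    finally have "\<bar>y\<bar> powr q \<le> e * y ^ (2 * m)" by simp
    moreover have "0 \<le> R powr (q - 1) * \<bar>y\<bar>" by simp
    ultimately show ?thesis by linarith
  qed
  then show ?thesis using that[of "R powr (q - 1)"] by simp
qed

lemma log_weight_small:
  assumes a: "a > 1" and q: "q \<ge> 2" and e: "e > 0"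
  obtains d where "d > 0" "\<And>x. x \<noteq> 0 \<Longrightarrow> norm x < 1 \<Longrightarrow> norm x \<le> d \<Longrightarrow> log_weight a q x \<le> e * (1 / (norm x)\<^sup>2)"
proof -
  \<comment> \<open>T solves T^(-1 - q/2) = e, and |x| \<le> a exp (-T) says that ln (a / |x|) \<ge>
    T.\<close>
  define T where "T = e powr (- 1 / (1 + q / 2))"
  have T: "T > 0" "T powr (- 1 - q / 2) = e"
  proof -
    have "- 1 / (1 + q / 2) * (- 1 - q / 2) = 1" using q by (simp add: field_simps)
    then show "T > 0" "T powr (- 1 - q / 2) = e" using e unfolding T_def powr_powr by simp_all
  qed
  show ?thesis
  proof (rule that[of "a * exp (- T)"])
    show "a * exp (- T) > 0" using a by simp
    fix x :: "real^2" assume x: "x \<noteq> 0" "norm x < 1" "norm x \<le> a * exp (- T)"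
    have "exp T \<le> a / norm x"
      using x by (simp add: exp_minus field_simps)
    then have "T \<le> ln (a / norm x)" using x a by (subst ln_ge_iff) auto
    then have "ln (a / norm x) powr (- 1 - q / 2) \<le> e"
      using powr_mono2'[of "- 1 - q / 2" T "ln (a / norm x)"] T q by simp
    moreover have "norm x powr (- 2) = 1 / (norm x)\<^sup>2" using x by (simp add: powr_minus divide_inverse)
    ultimately show "log_weight a q x \<le> e * (1 / (norm x)\<^sup>2)"
      unfolding log_weight_def by (simp add: divide_right_mono)
  qed
qed

text \<open>Close to the origin the weight is at most e / |x|^2 and the two moments alone suffice.
  Elsewhere it is at most a constant W, and Young's inequality with e / W sends the large values of
  y into the highest moment and the others into a multiple of |y|.\<close>

lemma log_weight_powr_le:
  assumes a: "a > 1" and q: "q \<ge> 2" and m: "q + 1 \<le> real (2 * m)" and e: "e > 0"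
  obtains K where "K \<ge> 0" "\<And>x y. x \<noteq> 0 \<Longrightarrow> norm x < 1 \<Longrightarrow>
    log_weight a q x * \<bar>y\<bar> powr q \<le> K * \<bar>y\<bar> + e * (y ^ (2 * 1) / (norm x)\<^sup>2 + y ^ (2 * m) / (norm x)\<^sup>2)"
proof -
  obtain d where d: "d > 0" "\<And>x. x \<noteq> 0 \<Longrightarrow> norm x < 1 \<Longrightarrow> norm x \<le> d \<Longrightarrow> log_weight a q x \<le> e * (1 / (norm x)\<^sup>2)"
    using log_weight_small[OF a q e] by blast
  define W where "W = ln a powr (- 1 - q / 2) * (1 / d\<^sup>2)"
  have W: "W > 0" using a d(1) by (simp add: W_def)
  have "e / W > 0" using e W by simp
  then obtain K where K: "K \<ge> 0" "\<And>y. \<bar>y\<bar> powr q \<le> K * \<bar>y\<bar> + e / W * (y::real) ^ (2 * m)"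
    using abs_powr_le_young[of q m "e / W"] q m by auto
  show ?thesis
  proof (rule that[of "W * K"])
    show "W * K \<ge> 0" using W K(1) by simp
    fix x :: "real^2" and y :: real assume x: "x \<noteq> 0" "norm x < 1"
    have n: "0 < (norm x)\<^sup>2" "(norm x)\<^sup>2 \<le> 1" using x by (auto simp: power_le_one)
    have y2: "0 \<le> y ^ (2 * m)" "0 \<le> y ^ (2 * 1)" by (simp_all add: zero_le_even_power)
    have WK: "0 \<le> W * K * \<bar>y\<bar>" using W K(1) by simp
    show "log_weight a q x * \<bar>y\<bar> powr q
        \<le> W * K * \<bar>y\<bar> + e * (y ^ (2 * 1) / (norm x)\<^sup>2 + y ^ (2 * m) / (norm x)\<^sup>2)"
    proof (cases "norm x \<le> d")
      case True
      have "log_weight a q x * \<bar>y\<bar> powr q \<le> (e * (1 / (norm x)\<^sup>2)) * (y\<^sup>2 + y ^ (2 * m))"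
        using d(2)[OF x True] e q m by (intro mult_mono abs_powr_le_powers) auto
      also have "\<dots> = e * (y ^ (2 * 1) / (norm x)\<^sup>2 + y ^ (2 * m) / (norm x)\<^sup>2)"
        by (simp add: add_divide_distrib distrib_left)
      finally show ?thesis using WK by linarith
    next
      case False
      have "log_weight a q x \<le> ln a powr (- 1 - q / 2) * (1 / (norm x)\<^sup>2)"
        by (rule log_weight_le[OF a q x(2,1)])
      also have "\<dots> \<le> W"
        unfolding W_def using False d(1) n(1) by (intro mult_left_mono divide_left_mono power_mono) auto
      finally have "log_weight a q x * \<bar>y\<bar> powr q \<le> W * (K * \<bar>y\<bar> + e / W * y ^ (2 * m))"
        using W by (intro mult_mono K) auto
      also have "\<dots> = W * K * \<bar>y\<bar> + e * y ^ (2 * m)" using W by (simp add: distrib_left)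
      also have "y ^ (2 * m) \<le> y ^ (2 * m) / (norm x)\<^sup>2"
        using n y2(1) mult_left_le[of "(norm x)\<^sup>2" "y ^ (2 * m)"] by (simp add: pos_le_divide_eq)
      also have "\<dots> \<le> y ^ (2 * 1) / (norm x)\<^sup>2 + y ^ (2 * m) / (norm x)\<^sup>2"
        using n y2(2) by simp
      finally show ?thesis using e by simp
    qed
  qed
qed

text \<open>The Ehrling-type inequality that produces compactness: at bounded energy the weighted
  mass is controlled by the L^1 norm up to an arbitrarily small error, obtained by dividing e by the
  sum of the two moment bounds.\<close>

lemma mean_zero_weighted_le:
  assumes a: "a > 1" and q: "q \<ge> 2" and e: "e > 0"
  obtains K where "K \<ge> 0" "\<And>f g. C1c f g \<Longrightarrow> (\<And>x. avg f x = 0) \<Longrightarrow>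
     energy lborel g \<le> c \<Longrightarrow>
     powr_mass (log_measure a q) q f \<le> ennreal (K * (\<integral>x. \<bar>f x\<bar> \<partial>lborel) + e)"
proof -
  \<comment> \<open>With m \<ge> q \<ge> 2 the exponent 2m exceeds q by at least 2, which covers the
    extra power spent in Young's inequality.\<close>
  define m where "m = nat \<lceil>q\<rceil>"
  have m: "m \<ge> 1" "q + 1 \<le> real (2 * m)" using q by (auto simp: m_def) linarith+
  obtain C1 where C1: "C1 \<ge> 0" "\<And>f g. C1c f g \<Longrightarrow> (\<And>x. avg f x = 0) \<Longrightarrow>
     energy lborel g \<le> c \<Longrightarrow>
     moment 1 f \<le> ennreal (C1)"
    using mean_zero_moments[of 1] by blast
  obtain Cm where Cm: "Cm \<ge> 0" "\<And>f g. C1c f g \<Longrightarrow> (\<And>x. avg f x = 0) \<Longrightarrow>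
     energy lborel g \<le> c \<Longrightarrow>
     moment m f \<le> ennreal (Cm)"
    using mean_zero_moments[OF m(1)] by blast
  define S where "S = C1 + Cm + 1"
  have S: "S > 0" using C1(1) Cm(1) by (simp add: S_def add_nonneg_pos)
  define e' where "e' = e / S"
  have e': "e' > 0" using e S by (simp add: e'_def)
  obtain K where K: "K \<ge> 0" "\<And>x y. x \<noteq> 0 \<Longrightarrow> norm x < 1 \<Longrightarrow>
    log_weight a q x * \<bar>y\<bar> powr q \<le> K * \<bar>y\<bar> + e' * (y ^ (2 * 1) / (norm x)\<^sup>2 + y ^ (2 * m) / (norm x)\<^sup>2)"
    using log_weight_powr_le[OF a q m(2) e'] by blast
  have "powr_mass (log_measure a q) q f \<le> ennreal (K * (\<integral>x. \<bar>f x\<bar> \<partial>lborel) + e)"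
    if f: "C1c f g" "\<And>x. avg f x = 0" "energy lborel g \<le> c" for f g
  proof -
    have fm[measurable]: "f \<in> borel_measurable borel" by (rule C1c_measurable(1)[OF f(1)])
    have [measurable]: "f \<in> borel_measurable disc_measure" by (rule borel_measurable_disc_measure[OF fm])
    have "powr_mass (log_measure a q) q f
        = (\<integral>\<^sup>+x. ennreal (log_weight a q x) * ennreal (\<bar>f x\<bar> powr q) * indicator disc x \<partial>lborel)"
      by (rule nn_integral_log_measure) measurable
    also have "\<dots> \<le> (\<integral>\<^sup>+x. ennreal K * ennreal \<bar>f x\<bar> + ennreal e' * (ennreal (f x ^ (2 * 1) / (norm x)\<^sup>2)
        + ennreal (f x ^ (2 * m) / (norm x)\<^sup>2)) \<partial>lborel)"
    proof (rule nn_integral_mono_AE)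
      show "AE x in lborel. ennreal (log_weight a q x) * ennreal (\<bar>f x\<bar> powr q) * indicator disc x
        \<le> ennreal K * ennreal \<bar>f x\<bar> + ennreal e' * (ennreal (f x ^ (2 * 1) / (norm x)\<^sup>2)
        + ennreal (f x ^ (2 * m) / (norm x)\<^sup>2))"
        using AE_lborel_neq[of 0]
      proof eventually_elim
        case (elim x)
        show ?case
        proof (cases "x \<in> disc")
          case True
          have n: "0 \<le> f x ^ (2 * 1) / (norm x)\<^sup>2" "0 \<le> f x ^ (2 * m) / (norm x)\<^sup>2"
            by (simp_all add: zero_le_even_power)
          have "ennreal (log_weight a q x) * ennreal (\<bar>f x\<bar> powr q)
            = ennreal (log_weight a q x * \<bar>f x\<bar> powr q)"
            by (simp add: log_weight_nonneg ennreal_mult')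
          also have "\<dots> \<le> ennreal (K * \<bar>f x\<bar> + e' * (f x ^ (2 * 1) / (norm x)\<^sup>2 + f x ^ (2
            * m) / (norm x)\<^sup>2))"
            using True elim by (intro ennreal_leI K) auto
          also have "\<dots> = ennreal (K * \<bar>f x\<bar>) + ennreal (e' * (f x ^ (2 * 1) / (norm x)\<^sup>2 + f x ^ (2
            * m) / (norm x)\<^sup>2))"
            using K(1) e' n by (intro ennreal_plus) auto
          also have "ennreal (K * \<bar>f x\<bar>) = ennreal K * ennreal \<bar>f x\<bar>" using K(1)
            by (intro ennreal_mult') auto
          also have "ennreal (e' * (f x ^ (2 * 1) / (norm x)\<^sup>2 + f x ^ (2 * m) / (norm x)\<^sup>2))
            = ennreal e' * ennreal (f x ^ (2 * 1) / (norm x)\<^sup>2 + f x ^ (2 * m) / (norm x)\<^sup>2)"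
            using e' by (intro ennreal_mult') auto
          also have "ennreal (f x ^ (2 * 1) / (norm x)\<^sup>2 + f x ^ (2 * m) / (norm x)\<^sup>2)
            = ennreal (f x ^ (2 * 1) / (norm x)\<^sup>2) + ennreal (f x ^ (2 * m) / (norm x)\<^sup>2)"
            by (rule ennreal_plus[OF n])
          finally show ?thesis using True by simp
        qed simp
      qed
    qed
    also have "\<dots> = ennreal K * (\<integral>\<^sup>+x. ennreal \<bar>f x\<bar> \<partial>lborel) + ennreal e' * (moment 1 f
        + moment m f)"
      by (simp add: nn_integral_cmult nn_integral_add)
    also have "\<dots> \<le> ennreal K * ennreal (\<integral>x. \<bar>f x\<bar> \<partial>lborel) + ennreal e' * (ennreal (C1) + ennreal (Cm))"
    proof (intro add_mono mult_left_mono)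
      show "(\<integral>\<^sup>+x. ennreal \<bar>f x\<bar> \<partial>lborel) \<le> ennreal (\<integral>x. \<bar>f x\<bar> \<partial>lborel)"
        using C1c_integrable(5)[OF f(1)] by (simp add: nn_integral_eq_integral)
    qed (use C1(2)[OF f] Cm(2)[OF f] in auto)
    also have "\<dots> = ennreal (K * (\<integral>x. \<bar>f x\<bar> \<partial>lborel) + e' * (C1 + Cm))"
    proof -
      have n: "0 \<le> C1" "0 \<le> Cm" using C1(1) Cm(1) by auto
      show ?thesis
        unfolding ennreal_plus[OF n, symmetric]
        using K(1) e' n by (simp add: ennreal_mult'[symmetric] ennreal_plus[symmetric] del: ennreal_plus)
    qed
    also have "\<dots> \<le> ennreal (K * (\<integral>x. \<bar>f x\<bar> \<partial>lborel) + e)"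
    proof (intro ennreal_leI add_left_mono)
      have "e' * (C1 + Cm) \<le> e' * S"
        using e' by (intro mult_left_mono) (auto simp: S_def)
      then show "e' * (C1 + Cm) \<le> e" using S by (simp add: e'_def)
    qed
    finally show ?thesis .
  qed
  then show ?thesis using that K(1) by blast
qed

lemma nn_integral_powr_add_le:
  fixes f h :: "'a \<Rightarrow> real"
  assumes [measurable]: "f \<in> borel_measurable M" "h \<in> borel_measurable M" and "q \<ge> 0"
  shows "powr_mass M q (\<lambda>x. f x + h x)
    \<le> ennreal (2 powr q) * (powr_mass M q f + powr_mass M q h)"
proof -
  have "powr_mass M q (\<lambda>x. f x + h x)
      \<le> (\<integral>\<^sup>+x. ennreal (2 powr q) * (ennreal (\<bar>f x\<bar> powr q) + ennreal (\<bar>h x\<bar> powr q)) \<partial>M)"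
  proof (rule nn_integral_mono)
    fix x
    have "ennreal (\<bar>f x + h x\<bar> powr q) \<le> ennreal (2 powr q * (\<bar>f x\<bar> powr q + \<bar>h x\<bar> powr q))"
      by (intro ennreal_leI abs_add_powr_le assms)
    then show "ennreal (\<bar>f x + h x\<bar> powr q)
        \<le> ennreal (2 powr q) * (ennreal (\<bar>f x\<bar> powr q) + ennreal (\<bar>h x\<bar> powr q))"
      by (simp add: ennreal_mult')
  qed
  then show ?thesis by (simp add: nn_integral_cmult nn_integral_add)
qed

lemma borel_measurable_log_measure [simp]: "borel_measurable (log_measure a q)
    = borel_measurable disc_measure"
  by (rule measurable_cong_sets) (auto simp: log_measure_def)

text \<open>The circular mean of f is handled by the radial bound, the remainder h by the
  Ehrling-type inequality with error 1. That inequality still contains the L^1 norm of h, which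
  Wirtinger's inequality controls because f vanishes outside the disc.\<close>

lemma weighted_inequality_unit:
  assumes a: "a > 1" and q: "q \<ge> 2"
  obtains C where "C \<ge> 0" "\<And>f g. C1c f g \<Longrightarrow> (\<And>x. norm x \<ge> 1 \<Longrightarrow> f x = 0) \<Longrightarrow>
     energy lborel g \<le> 1 \<Longrightarrow>
     powr_mass (log_measure a q) q f \<le> ennreal C"
proof -
  obtain K where K: "K \<ge> 0" "\<And>f g. C1c f g \<Longrightarrow> (\<And>x. avg f x = 0) \<Longrightarrow>
     energy lborel g \<le> 1 \<Longrightarrow>
     powr_mass (log_measure a q) q f \<le> ennreal (K * (\<integral>x. \<bar>f x\<bar> \<partial>lborel) + 1)"
    by (rule mean_zero_weighted_le[OF a q zero_less_one, where c = 1]) (rule that; fast)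
  define B where "B = K * (measure lborel disc + 2 * (4 * pi\<^sup>2)) + 1"
  have B: "B \<ge> 0" using K(1) by (simp add: B_def)
  have "powr_mass (log_measure a q) q f \<le> ennreal (2 powr q * (8 * pi + B))"
    if f: "C1c f g" "\<And>x. norm x \<ge> 1 \<Longrightarrow> f x = 0" "energy lborel g \<le> 1" for f g
  proof -
    define h where "h = (\<lambda>x. f x - avg f x)"
    have h: "C1c h (\<lambda>x. g x - avg_grad g x)" unfolding h_def by (intro C1c_diff C1c_avg f)
    note cf = C1c_cont[OF f(1)] and A = C1c_avg[OF f(1)]
    have fm[measurable]: "avg f \<in> borel_measurable disc_measure" "h \<in> borel_measurable disc_measure"
      using C1c_measurable(1)[OF A] C1c_measurable(1)[OF h] by (auto intro: borel_measurable_disc_measure)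
    have ah: "avg h x = 0" for x
      unfolding h_def using avg_diff[OF cf C1c_cont[OF A]] avg_avg[OF cf] by simp
    have E: "energy lborel (avg_grad g) \<le> 1" "energy lborel (\<lambda>x. g x - avg_grad g x) \<le> 1"
      using avg_energy[OF f(1)] f(3) by simp_all
    have a0: "avg f x = 0" if "norm x \<ge> 1" for x
    proof -
      have "avg f x = integral {0..1} (\<lambda>t::real. 0)"
        unfolding avg_def by (intro integral_cong) (use f(2) that in auto)
      then show ?thesis by simp
    qed
    have "powr_mass (log_measure a q) q (avg f)
        = (\<integral>\<^sup>+x. ennreal (log_weight a q x * \<bar>avg f x\<bar> powr q) * indicator disc x \<partial>lborel)"
      by (subst nn_integral_log_measure) (auto simp: ennreal_mult' log_weight_nonneg)
    also have "\<dots> \<le> ennreal (8 * pi)"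
    proof (rule radial_weighted_bound[OF A avg_radial[OF cf] _ a0 E(1) a q])
      show "norm (avg_grad g x) = norm (avg_grad g (norm x *\<^sub>R axis 1 1))" for x
      proof -
        obtain s where "s \<in> {0..1}" "x = rot s (norm x *\<^sub>R axis 1 1)" by (rule rot_polar)
        then show ?thesis using avg_grad_rot[OF f(1)] by (metis norm_rot)
      qed
    qed
    finally have ra: "powr_mass (log_measure a q) q (avg f) \<le> ennreal (8 * pi)" .
    \<comment> \<open>Wirtinger's quotient with shift 1: on the disc |x|^2 + 1 \<le> 2, so h^2 \<le>
      2 X and |h| \<le> 1 + 2 X. This plays the part of a Poincare inequality and explains the
      constant \<open>B\<close>.\<close>
    define X where "X = (\<lambda>x. (h x)\<^sup>2 / ((norm x)\<^sup>2 + 1))"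
    have iX: "integrable lborel X"
      unfolding X_def by (rule quotient_integrable[OF h]) auto
    have "(\<integral>x. \<bar>h x\<bar> \<partial>lborel) \<le> (\<integral>x. indicator disc x + 2 * X x \<partial>lborel)"
    proof (rule integral_mono)
      show "integrable lborel (\<lambda>x. indicator disc x + 2 * X x)"
        using iX integrable_indicator_disc by auto
      show "\<bar>h x\<bar> \<le> indicator disc x + 2 * X x" for x
      proof (cases "x \<in> disc")
        case True
        then have "(norm x)\<^sup>2 + 1 \<le> 2" by (simp add: power_le_one)
        then have "(h x)\<^sup>2 / 2 \<le> X x"
          unfolding X_def by (intro divide_left_mono) (auto simp: add_nonneg_pos)
        moreover have "2 * \<bar>h x\<bar> \<le> (h x)\<^sup>2 + 1" using sum_squares_bound[of "\<bar>h x\<bar>" 1] by simp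
        ultimately have "\<bar>h x\<bar> \<le> 1 + 2 * X x" using zero_le_power2[of "h x"] by linarith
        then show ?thesis using True by simp
      next
        case False
        then show ?thesis using f(2)[of x] a0[of x] by (simp add: h_def X_def)
      qed
    qed (use C1c_integrable[OF h] in auto)
    also have "\<dots> = measure lborel disc + 2 * (\<integral>x. X x \<partial>lborel)"
      using iX integrable_indicator_disc by simp
    also have "(\<integral>x. X x \<partial>lborel) \<le> 4 * pi\<^sup>2 * 1"
      unfolding X_def by (rule order_trans[OF wirtinger[OF h ah zero_less_one] mult_left_mono[OF E(2)]]) simp
    finally have "K * (\<integral>x. \<bar>h x\<bar> \<partial>lborel) + 1 \<le> B"
      unfolding B_def using K(1) by (simp add: mult_left_mono)
    then have rh: "powr_mass (log_measure a q) q h \<le> ennreal B"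
      by (intro order_trans[OF K(2)[OF h ah E(2)]] ennreal_leI)
    have "powr_mass (log_measure a q) q f
        = powr_mass (log_measure a q) q (\<lambda>x. avg f x + h x)" by (simp add: h_def)
    also have "\<dots> \<le> ennreal (2 powr q) * (powr_mass (log_measure a q) q (avg f)
        + powr_mass (log_measure a q) q h)"
      using fm q by (intro nn_integral_powr_add_le) auto
    also have "\<dots> \<le> ennreal (2 powr q) * (ennreal (8 * pi) + ennreal B)"
      by (intro mult_left_mono add_mono ra rh) auto
    also have "\<dots> = ennreal (2 powr q * (8 * pi + B))"
      unfolding ennreal_mult'[OF powr_ge_zero] using B by (subst ennreal_plus) auto
    finally show ?thesis .
  qed
  then show ?thesis using that[of "2 powr q * (8 * pi + B)"] B by simp
qed

text \<open>Scaling by 1/c. A free c > 0 bounding the gradient norm is used instead of the norm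
  itself, so that a vanishing gradient causes no division by zero.\<close>

lemma weighted_inequality:
  assumes a: "a > 1" and q: "q \<ge> 2"
  obtains C where "C \<ge> 0" "\<And>f g c. C1c f g \<Longrightarrow> (\<And>x. norm x \<ge> 1 \<Longrightarrow> f x = 0) \<Longrightarrow> c > 0 \<Longrightarrow>
     energy lborel g \<le> c\<^sup>2 \<Longrightarrow>
     powr_mass (log_measure a q) q f \<le> ennreal (C * c powr q)"
proof -
  obtain C where C: "C \<ge> 0" "\<And>f g. C1c f g \<Longrightarrow> (\<And>x. norm x \<ge> 1 \<Longrightarrow> f x = 0) \<Longrightarrow>
     energy lborel g \<le> 1 \<Longrightarrow>
     powr_mass (log_measure a q) q f \<le> ennreal C"
    using weighted_inequality_unit[OF a q] by blast
  have "powr_mass (log_measure a q) q f \<le> ennreal (C * c powr q)"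
    if f: "C1c f g" "\<And>x. norm x \<ge> 1 \<Longrightarrow> f x = 0" "c > 0" "energy lborel g \<le> c\<^sup>2" for f g c
  proof -
    have fm[measurable]: "f \<in> borel_measurable disc_measure"
      by (intro measurable_restrict_space1 measurable_completion)
        (auto simp: measurable_lborel1 intro!: borel_measurable_continuous_onI C1c_cont[OF f(1)])
    have [measurable]: "f \<in> borel_measurable (log_measure a q)"
      using fm by (simp add: log_measure_def)
    have "energy lborel (\<lambda>x. (1 / c) *\<^sub>R g x) = (1 / c)\<^sup>2 * energy lborel g"
      by (simp add: power_mult_distrib power_divide)
    also have "\<dots> \<le> (1 / c)\<^sup>2 * c\<^sup>2" by (intro mult_left_mono f) auto
    finally have E: "energy lborel (\<lambda>x. (1 / c) *\<^sub>R g x) \<le> 1"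
      using f(3) by (simp add: power_divide)
    have "ennreal (\<bar>f x\<bar> powr q) = ennreal (c powr q) * ennreal (\<bar>1 / c * f x\<bar> powr q)" for x
    proof -
      have "\<bar>f x\<bar> = c * \<bar>1 / c * f x\<bar>" using f(3) by (simp add: abs_mult)
      then have "\<bar>f x\<bar> powr q = c powr q * \<bar>1 / c * f x\<bar> powr q"
        using f(3) by (metis abs_ge_zero less_imp_le powr_mult)
      then show ?thesis by (simp flip: ennreal_mult')
    qed
    then have "powr_mass (log_measure a q) q f
        = ennreal (c powr q) * powr_mass (log_measure a q) q (\<lambda>x. 1 / c * f x)"
      by (simp add: nn_integral_cmult)
    also have "\<dots> \<le> ennreal (c powr q) * ennreal C"
      by (intro mult_left_mono C(2)[OF C1c_cmult[OF f(1)]] E) (use f(2) in auto)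
    also have "\<dots> = ennreal (C * c powr q)" using C(1) by (simp add: mult.commute flip: ennreal_mult')
    finally show ?thesis .
  qed
  then show ?thesis using that C(1) by blast
qed

subsection \<open>Test functions\<close>

lemma Ck_imp_continuous: "Ck k f \<Longrightarrow> continuous_on UNIV f"
  by (cases k) (auto intro!: continuous_at_imp_continuous_on differentiable_imp_continuous_within)

lemma Ck_SucI:
  assumes "\<And>x. (f has_derivative f' x) (at x)" and "\<And>v. Ck k (\<lambda>x. f' x v)"
  shows "Ck (Suc k) f"
proof -
  have "frechet_derivative f (at x) = f' x" for x
    using frechet_derivative_at[OF assms(1)] by simp
  then show ?thesis using assms by (auto simp: differentiable_def)
qed

lemma Ck_SucD:
  assumes "Ck (Suc k) f"
  shows "(f has_derivative frechet_derivative f (at x)) (at x)"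
    and "Ck k (\<lambda>x. frechet_derivative f (at x) v)"
  using assms by (auto simp: frechet_derivative_works[symmetric])

lemma Ck_add: "Ck k f \<Longrightarrow> Ck k g \<Longrightarrow> Ck k (\<lambda>x. f x + g x)"
proof (induction k arbitrary: f g)
  case (Suc k)
  show ?case
    by (rule Ck_SucI[OF has_derivative_add[OF Ck_SucD(1)[OF Suc.prems(1)] Ck_SucD(1)[OF Suc.prems(2)]]])
       (intro Suc.IH Ck_SucD Suc.prems)
qed (auto intro: continuous_intros)

lemma Ck_cmult: "Ck k f \<Longrightarrow> Ck k (\<lambda>x. c * f x)"
proof (induction k arbitrary: f)
  case (Suc k)
  show ?case
    by (rule Ck_SucI[OF has_derivative_mult_right[OF Ck_SucD(1)[OF Suc.prems]]])
       (intro Suc.IH Ck_SucD Suc.prems)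
qed (auto intro: continuous_intros)

lemma Ck_diff: "Ck k f \<Longrightarrow> Ck k g \<Longrightarrow> Ck k (\<lambda>x. f x - g x)"
  using Ck_add[of k f "\<lambda>x. (-1) * g x"] Ck_cmult[of k g "-1"] by simp

lemma has_derivative_gradient:
  assumes "f differentiable (at x)"
  shows "(f has_derivative (\<lambda>v. gradient f x \<bullet> v)) (at x)"
proof -
  have d: "(f has_derivative frechet_derivative f (at x)) (at x)"
    using assms by (simp add: frechet_derivative_works)
  then have l: "linear (frechet_derivative f (at x))" by (rule has_derivative_linear)
  have "frechet_derivative f (at x) v = gradient f x \<bullet> v" for v
  proof -
    have "frechet_derivative f (at x) v = frechet_derivative f (at x) (\<Sum>b\<in>Basis. (v \<bullet> b) *\<^sub>R b)"
      by (simp add: euclidean_representation)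
    also have "\<dots> = (\<Sum>b\<in>Basis. (v \<bullet> b) * frechet_derivative f (at x) b)"
      using l by (simp add: linear_sum linear_scale)
    also have "\<dots> = gradient f x \<bullet> v"
      by (simp add: gradient_def inner_sum_left inner_commute[of v] mult.commute)
    finally show ?thesis .
  qed
  with d show ?thesis by (metis (no_types, lifting) ext)
qed

lemma Ck_Suc_gradient:
  assumes "Ck (Suc k) f"
  shows "(f has_derivative (\<lambda>v. gradient f x \<bullet> v)) (at x)" and "continuous_on UNIV (gradient f)"
    and "frechet_derivative f (at x) v = gradient f x \<bullet> v"
proof -
  show d: "(f has_derivative (\<lambda>v. gradient f x \<bullet> v)) (at x)"
    using assms by (intro has_derivative_gradient) simp
  show "frechet_derivative f (at x) v = gradient f x \<bullet> v"
    using frechet_derivative_at[OF d] by metis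
  show "continuous_on UNIV (gradient f)"
    unfolding gradient_def[abs_def]
    by (intro continuous_intros Ck_imp_continuous[OF Ck_SucD(2)[OF assms]])
qed

lemma C1c_gradient_eq:
  assumes "C1c f g"
  shows "gradient f = g"
proof
  fix x
  have "(f has_derivative (\<lambda>v. gradient f x \<bullet> v)) (at x)"
    using C1c_deriv[OF assms, of x UNIV] by (intro has_derivative_gradient) (auto simp: differentiable_def)
  from has_derivative_unique[OF this C1c_deriv[OF assms]]
  have "gradient f x \<bullet> v = g x \<bullet> v" for v by metis
  then show "gradient f x = g x" by (meson vector_eq_rdot)
qed

text \<open>Since \<open>rot t v\<close> is a combination of v and \<open>perp v\<close>, the
  derivative of an average along v is a sum of two averages of directional derivatives of f, with c
  multiplied by a cosine or a sine. The induction therefore runs over all continuous weights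
  c.\<close>

lemma Ck_rot_average:
  assumes "Ck k f" and "continuous_on UNIV c"
  shows "Ck k (\<lambda>x. integral {0..1} (\<lambda>t. c t * f (rot t x)))"
  using assms
proof (induction k arbitrary: f c)
  case 0
  have "continuous_on UNIV (\<lambda>(t,y). c t * y)"
    unfolding case_prod_unfold by (intro continuous_intros continuous_on_compose2[OF 0(2)]) auto
  from continuous_on_rot_average[OF _ this, of f] 0(1) show ?case by simp
next
  case (Suc k)
  note g = Ck_Suc_gradient[OF Suc.prems(1)]
  define F where "F = (\<lambda>x v. integral {0..1} (\<lambda>t. c t *\<^sub>R rot (- t) (gradient f (rot t x))) \<bullet> v)"
  show ?case
  proof (rule Ck_SucI[where f' = F])
    show "((\<lambda>x. integral {0..1} (\<lambda>t. c t * f (rot t x))) has_derivative F x) (at x)" for x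
      unfolding F_def by (rule weighted_average_derivative[OF g(1,2) Suc.prems(2)])
    fix v
    define A where "A = (\<lambda>x. integral {0..1} (\<lambda>t. (c t * cos (2 * pi * t))
        * frechet_derivative f (at (rot t x)) v))"
    define B where "B = (\<lambda>x. integral {0..1} (\<lambda>t. (c t * sin (2 * pi * t))
        * frechet_derivative f (at (rot t x)) (perp v)))"
    have "F x v = A x + B x" for x
    proof -
      have c: "continuous_on {0..1} c" using Suc.prems(2) continuous_on_subset by blast
      have cr: "continuous_on {0..1} (\<lambda>t. gradient f (rot t x))"
        by (intro continuous_on_compose2[OF g(2)] continuous_intros) auto
      have "((\<lambda>t. c t *\<^sub>R rot (- t) (gradient f (rot t x))) has_integral
          integral {0..1} (\<lambda>t. c t *\<^sub>R rot (- t) (gradient f (rot t x)))) {0..1}"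
        by (intro integrable_integral integrable_continuous_real continuous_intros c cr)
      from has_integral_linear[OF this bounded_linear_inner_left[of v]]
      have "((\<lambda>t. c t * (rot (- t) (gradient f (rot t x)) \<bullet> v)) has_integral F x v) {0..1}"
        unfolding F_def comp_def inner_scaleR_left .
      then have "F x v = integral {0..1} (\<lambda>t. c t * (rot (- t) (gradient f (rot t x)) \<bullet> v))"
        by (rule integral_unique[symmetric])
      also have "\<dots> = integral {0..1} (\<lambda>t. (c t * cos (2 * pi * t)) * (gradient f (rot t x) \<bullet> v)
          + (c t * sin (2 * pi * t)) * (gradient f (rot t x) \<bullet> perp v))"
      proof (intro integral_cong)
        fix t
        have "gradient f y \<bullet> rot t v
            = cos (2 * pi * t) * (gradient f y \<bullet> v) + sin (2 * pi * t) * (gradient f y \<bullet> perp v)" for y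
          by (simp add: rot_def inner_add_right)
        then show "c t * (rot (- t) (gradient f (rot t x)) \<bullet> v)
          = (c t * cos (2 * pi * t)) * (gradient f (rot t x) \<bullet> v)
          + (c t * sin (2 * pi * t)) * (gradient f (rot t x) \<bullet> perp v)"
          by (simp add: rot_inner distrib_left mult.assoc)
      qed
      also have "\<dots> = integral {0..1} (\<lambda>t. (c t * cos (2 * pi * t)) * (gradient f (rot t x) \<bullet> v))
          + integral {0..1} (\<lambda>t. (c t * sin (2 * pi * t)) * (gradient f (rot t x) \<bullet> perp v))"
        by (intro integral_add integrable_continuous_real continuous_intros c cr)
      finally show ?thesis by (simp add: A_def B_def g(3))
    qed
    moreover have "Ck k A"
      unfolding A_def
      by (rule Suc.IH[OF Ck_SucD(2)[OF Suc.prems(1)], of "\<lambda>t. c t * cos (2 * pi * t)"])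
        (intro continuous_intros Suc.prems(2))
    moreover have "Ck k B"
      unfolding B_def
      by (rule Suc.IH[OF Ck_SucD(2)[OF Suc.prems(1)], of "\<lambda>t. c t * sin (2 * pi * t)"])
        (intro continuous_intros Suc.prems(2))
    ultimately show "Ck k (\<lambda>x. F x v)" by (simp add: Ck_add)
  qed
qed

lemma test_function_Ck: "\<phi> \<in> test_functions S \<Longrightarrow> Ck k \<phi>"
  by (simp add: test_functions_def)

lemma test_function_C1c:
  assumes "\<phi> \<in> test_functions S"
  shows "C1c \<phi> (gradient \<phi>)"
proof -
  note k = test_function_Ck[OF assms, of "Suc 0"]
  have "compact (closure {x. \<phi> x \<noteq> 0})" using assms by (simp add: test_functions_def)
  then have "bounded {x. \<phi> x \<noteq> 0}"
    using bounded_subset[OF compact_imp_bounded closure_subset] by blast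
  then show ?thesis
    unfolding C1c_def by (intro conjI allI Ck_Suc_gradient(1)[OF k] Ck_Suc_gradient(2)[OF k])
qed

lemma test_function_disc_support:
  assumes "\<phi> \<in> test_functions disc"
  obtains R where "0 < R" "R < 1" "\<And>x. norm x > R \<Longrightarrow> \<phi> x = 0" "\<And>x. norm x > R \<Longrightarrow> gradient \<phi> x = 0"
proof -
  define K where "K = closure {x. \<phi> x \<noteq> 0}"
  have K: "compact K" "K \<subseteq> disc" using assms by (auto simp: test_functions_def K_def)
  obtain R where R: "0 < R" "R < 1" "K \<subseteq> cball 0 R"
  proof (cases "K = {}")
    case False
    obtain z where z: "z \<in> K" "\<And>y. y \<in> K \<Longrightarrow> norm y \<le> norm z"
      using continuous_attains_sup[OF K(1) False, of norm] by (auto intro: continuous_intros)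
    show ?thesis
    proof (rule that)
      \<comment> \<open>The value 1/2 keeps the radius positive when the support is just the
        origin.\<close>
      show "max (norm z) (1/2) < 1" using z K by auto
      show "K \<subseteq> cball 0 (max (norm z) (1/2))" using z by force
    qed simp
  next
    case True
    then show ?thesis using that[of "1/2"] by simp
  qed
  have 0: "\<phi> x = 0" if "norm x > R" for x
    using R(3) that closure_subset[of "{x. \<phi> x \<noteq> 0}"] unfolding K_def by force
  have "gradient \<phi> x = 0" if "norm x > R" for x
  proof -
    have "(\<phi> has_derivative (\<lambda>v. 0)) (at x)"
    proof (rule has_derivative_transform_within_open[where s = "- cball 0 R"])
      show "((\<lambda>x. 0) has_derivative (\<lambda>v. 0)) (at x)" by auto
    qed (use 0 that in force)+
    from has_derivative_unique[OF this C1c_deriv[OF test_function_C1c[OF assms]]]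
    have "gradient \<phi> x \<bullet> gradient \<phi> x = 0" by metis
    then show ?thesis by simp
  qed
  then show ?thesis using that R 0 by blast
qed

lemma test_function_discI:
  assumes "\<And>k. Ck k \<phi>" "R < 1" "\<And>x. norm x > R \<Longrightarrow> \<phi> x = 0"
  shows "\<phi> \<in> test_functions disc"
proof -
  have "closure {x. \<phi> x \<noteq> 0} \<subseteq> cball 0 R"
    by (rule closure_minimal) (use assms(3) in force)+
  moreover have "cball 0 R \<subseteq> disc" using assms(2) by auto
  moreover have "bounded {x. \<phi> x \<noteq> 0}"
    by (rule bounded_subset[OF bounded_cball[of 0 R]]) (use assms(3) in force)
  ultimately show ?thesis
    using assms(1) unfolding test_functions_def by auto
qed

lemma test_function_diff:
  assumes "\<phi> \<in> test_functions disc" "\<psi> \<in> test_functions disc"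
  shows "(\<lambda>x. \<phi> x - \<psi> x) \<in> test_functions disc"
proof -
  obtain R where R: "R < 1" "\<And>x. norm x > R \<Longrightarrow> \<phi> x = 0"
    using test_function_disc_support[OF assms(1)] by metis
  obtain R' where R': "R' < 1" "\<And>x. norm x > R' \<Longrightarrow> \<psi> x = 0"
    using test_function_disc_support[OF assms(2)] by metis
  show ?thesis
    by (rule test_function_discI[of _ "max R R'"])
       (use R R' assms in \<open>auto intro!: Ck_diff simp: test_functions_def\<close>)
qed

lemma test_function_derivative:
  assumes "\<phi> \<in> test_functions disc"
  shows "(\<lambda>x. gradient \<phi> x \<bullet> v) \<in> test_functions disc"
proof -
  obtain R where R: "R < 1" "\<And>x. norm x > R \<Longrightarrow> gradient \<phi> x = 0"
    using test_function_disc_support[OF assms(1)] by metis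
  have "Ck k (\<lambda>x. gradient \<phi> x \<bullet> v)" for k
  proof -
    note k = test_function_Ck[OF assms, of "Suc k"]
    show ?thesis using Ck_SucD(2)[OF k, of v] unfolding Ck_Suc_gradient(3)[OF k] .
  qed
  then show ?thesis
    by (rule test_function_discI[of _ R]) (use R in auto)
qed

lemma test_function_avg:
  assumes "\<phi> \<in> test_functions disc"
  shows "avg \<phi> \<in> test_functions disc"
proof -
  obtain R where R: "R < 1" "\<And>x. norm x > R \<Longrightarrow> \<phi> x = 0"
    using test_function_disc_support[OF assms(1)] by metis
  show ?thesis
  proof (rule test_function_discI)
    from Ck_rot_average[OF test_function_Ck[OF assms], of "\<lambda>_. 1"] show "Ck k (avg \<phi>)" for k
      by (simp add: avg_def[abs_def])
    show "avg \<phi> x = 0" if "norm x > R" for x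
    proof -
      have "avg \<phi> x = integral {0..1} (\<lambda>t::real. 0)"
        unfolding avg_def by (intro integral_cong) (use R that in auto)
      then show ?thesis by simp
    qed
  qed fact
qed

lemma gradient_avg:
  "\<phi> \<in> test_functions S \<Longrightarrow> gradient (avg \<phi>) = avg_grad (gradient \<phi>)"
  by (intro C1c_gradient_eq C1c_avg test_function_C1c)

lemma gradient_diff:
  assumes "\<phi> \<in> test_functions disc" "\<psi> \<in> test_functions disc"
  shows "gradient (\<lambda>x. \<phi> x - \<psi> x) = (\<lambda>x. gradient \<phi> x - gradient \<psi> x)"
  by (intro C1c_gradient_eq C1c_diff test_function_C1c[OF assms(1)] test_function_C1c[OF assms(2)])

section \<open>Integration by parts and Green's identity\<close>

lemma integral_by_parts:
  assumes "C1c f g" "C1c h k"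
  shows "(\<integral>x. (g x \<bullet> v) * h x \<partial>lborel) = - (\<integral>x. f x * (k x \<bullet> v) \<partial>lborel)"
proof -
  have i: "integrable lborel (\<lambda>x. (g x \<bullet> v) * h x)" "integrable lborel (\<lambda>x. f x * (k x \<bullet> v))"
  proof -
    obtain B where "\<And>x. norm x > B \<Longrightarrow> f x = 0" "\<And>x. norm x > B \<Longrightarrow> g x = 0"
      using C1c_support[OF assms(1)] by metis
    then show "integrable lborel (\<lambda>x. (g x \<bullet> v) * h x)" "integrable lborel (\<lambda>x. f x * (k x \<bullet> v))"
      by (auto intro!: integrable_lborel_cont_bounded_support[of _ B] continuous_intros
        C1cD[OF assms(1)] C1cD[OF assms(2)])
  qed
  have "C1c (\<lambda>x. f x * h x) (\<lambda>x. f x *\<^sub>R k x + h x *\<^sub>R g x)"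
    by (intro C1c_mult assms C1c_deriv[OF assms(2)] C1c_cont_grad[OF assms(2)])
  from integral_gradient_eq_0[OF this, of v]
  have "(\<integral>x. f x * (k x \<bullet> v) + (g x \<bullet> v) * h x \<partial>lborel) = 0"
    by (simp add: inner_add_left mult.commute)
  then show ?thesis using i by simp
qed

definition laplacian :: "(real^2 \<Rightarrow> real) \<Rightarrow> real^2 \<Rightarrow> real" where
  "laplacian f x = (\<Sum>b\<in>Basis. gradient (\<lambda>x. gradient f x \<bullet> b) x \<bullet> b)"

text \<open>Both derivatives end up on \<psi>, so that the right side depends continuously on \<phi>
  in L^2.\<close>

lemma green_test_functions:
  assumes "\<phi> \<in> test_functions disc" "\<psi> \<in> test_functions disc"
  shows "(\<integral>x. gradient \<phi> x \<bullet> gradient \<psi> x \<partial>lborel) = - (\<integral>x. \<phi> x * laplacian \<psi> x \<partial>lborel)"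
proof -
  note C = test_function_C1c[OF assms(1)]
  note D = test_function_C1c[OF test_function_derivative[OF assms(2)]]
  obtain B where B: "\<And>x. norm x > B \<Longrightarrow> \<phi> x = 0" "\<And>x. norm x > B \<Longrightarrow> gradient \<phi> x = 0"
    using C1c_support[OF C] by metis
  have i: "integrable lborel (\<lambda>x. (gradient \<phi> x \<bullet> b) * (gradient \<psi> x \<bullet> b))"
    "integrable lborel (\<lambda>x. \<phi> x * (gradient (\<lambda>x. gradient \<psi> x \<bullet> b) x \<bullet> b))" for b
    using B by (auto intro!: integrable_lborel_cont_bounded_support[of _ B] continuous_intros
        C1cD[OF C] C1cD[OF D] C1cD[OF test_function_C1c[OF assms(2)]])
  have "(\<integral>x. gradient \<phi> x \<bullet> gradient \<psi> x \<partial>lborel)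
      = (\<integral>x. (\<Sum>b\<in>Basis. (gradient \<phi> x \<bullet> b) * (gradient \<psi> x \<bullet> b)) \<partial>lborel)"
    by (subst euclidean_inner) simp
  also have "\<dots> = (\<Sum>b\<in>Basis. \<integral>x. (gradient \<phi> x \<bullet> b) * (gradient \<psi> x \<bullet> b) \<partial>lborel)"
    by (rule Bochner_Integration.integral_sum) (rule i)
  also have "\<dots> = (\<Sum>b\<in>Basis. - (\<integral>x. \<phi> x * (gradient (\<lambda>x. gradient \<psi> x \<bullet> b) x \<bullet> b) \<partial>lborel))"
    by (intro sum.cong refl integral_by_parts C D)
  also have "\<dots> = - (\<integral>x. (\<Sum>b\<in>Basis. \<phi> x * (gradient (\<lambda>x. gradient \<psi> x \<bullet> b) x \<bullet> b)) \<partial>lborel)"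
    by (subst Bochner_Integration.integral_sum) (auto simp: i sum_negf)
  finally show ?thesis by (simp add: laplacian_def sum_distrib_left)
qed

subsection \<open>The Hilbert space structure\<close>

text \<open>The case p = 2 of the Lebesgue spaces, written with squares in place of
  \<open>powr\<close> and roots so that inner product algebra applies;
  \<open>Lp_tendsto_2_iff\<close> makes the link.\<close>

definition L2 :: "'a measure \<Rightarrow> ('a \<Rightarrow> 'b::euclidean_space) \<Rightarrow> bool" where
  "L2 M f \<longleftrightarrow> f \<in> borel_measurable M \<and> integrable M (\<lambda>x. (norm (f x))\<^sup>2)"

definition L2_to :: "'a measure \<Rightarrow> (nat \<Rightarrow> 'a \<Rightarrow> 'b::euclidean_space) \<Rightarrow> ('a \<Rightarrow> 'b) \<Rightarrow> bool" where
  "L2_to M f u \<longleftrightarrow> (\<forall>n. L2 M (f n)) \<and> L2 M u \<and> (\<lambda>n. \<integral>x. (norm (f n x - u x))\<^sup>2 \<partial>M) \<longlonglongrightarrow> 0"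

lemma Lp_norm_tendsto_0_iff:
  assumes "q > 0"
  shows "(\<lambda>n. Lp_norm M q (h n)) \<longlonglongrightarrow> 0 \<longleftrightarrow> (\<lambda>n. \<integral>x. norm (h n x) powr q \<partial>M) \<longlonglongrightarrow> 0"
proof
  define I where "I n = (\<integral>x. norm (h n x) powr q \<partial>M)" for n
  have I: "I n \<ge> 0" for n by (simp add: I_def)
  {
    assume "(\<lambda>n. Lp_norm M q (h n)) \<longlonglongrightarrow> 0"
    then have "(\<lambda>n. (I n powr (1 / q)) powr q) \<longlonglongrightarrow> 0"
      unfolding Lp_norm_def I_def[symmetric]
      by (rule tendsto_zero_powrI[OF _ tendsto_const]) (use assms in auto)
    then show "I \<longlonglongrightarrow> 0" using assms I by (simp add: powr_powr)
  next
    assume "I \<longlonglongrightarrow> 0"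
    then show "(\<lambda>n. Lp_norm M q (h n)) \<longlonglongrightarrow> 0"
      unfolding Lp_norm_def I_def[symmetric]
      by (rule tendsto_zero_powrI[OF _ tendsto_const]) (use assms I in auto)
  }
qed

lemma Lp_tendsto_2_iff: "Lp_tendsto M 2 f u \<longleftrightarrow> L2_to M f u"
  by (simp add: Lp_tendsto_def L2_to_def Lp_norm_tendsto_0_iff Lp_space_def L2_def)

lemma L2_inner_integrable:
  assumes "L2 M f" "L2 M g"
  shows "integrable M (\<lambda>x. f x \<bullet> g x)"
proof (rule Bochner_Integration.integrable_bound)
  show "integrable M (\<lambda>x. (norm (f x))\<^sup>2 + (norm (g x))\<^sup>2)" using assms by (simp add: L2_def)
  show "(\<lambda>x. f x \<bullet> g x) \<in> borel_measurable M" using assms by (auto simp: L2_def)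
  show "AE x in M. norm (f x \<bullet> g x) \<le> norm ((norm (f x))\<^sup>2 + (norm (g x))\<^sup>2)"
  proof (rule AE_I2)
    fix x
    have "\<bar>f x \<bullet> g x\<bar> \<le> norm (f x) * norm (g x)" by (rule Cauchy_Schwarz_ineq2)
    also have "\<dots> \<le> (norm (f x))\<^sup>2 + (norm (g x))\<^sup>2"
    proof -
      have "0 \<le> norm (f x) * norm (g x)" by simp
      then show ?thesis using sum_squares_bound[of "norm (f x)" "norm (g x)"] by linarith
    qed
    finally show "norm (f x \<bullet> g x) \<le> norm ((norm (f x))\<^sup>2 + (norm (g x))\<^sup>2)" by simp
  qed
qed

lemma norm_sq_diff: "(norm (x - y))\<^sup>2 = (norm x)\<^sup>2 - 2 * (x \<bullet> y) + (norm (y::'a::real_inner))\<^sup>2"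
  by (simp add: power2_norm_eq_inner inner_diff_left inner_diff_right inner_commute)

lemma norm_sq_add: "(norm (x + y))\<^sup>2 = (norm x)\<^sup>2 + 2 * (x \<bullet> y) + (norm (y::'a::real_inner))\<^sup>2"
  by (simp add: power2_norm_eq_inner inner_add_left inner_add_right inner_commute)

lemma norm_sq_diff_le: "(norm (x - y))\<^sup>2 \<le> 2 * (norm x)\<^sup>2 + 2 * (norm (y::'a::real_inner))\<^sup>2"
  using norm_sq_diff[of x y] norm_sq_add[of x y] zero_le_power2[of "norm (x + y)"] by linarith

lemma L2_diff:
  assumes "L2 M f" "L2 M g"
  shows "L2 M (\<lambda>x. f x - g x)"
  using assms L2_inner_integrable[OF assms] unfolding L2_def norm_sq_diff by auto

lemma L2_Cauchy_Schwarz: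
  assumes "L2 M f" "L2 M g"
  shows "(\<integral>x. f x \<bullet> g x \<partial>M)\<^sup>2 \<le> energy M f * energy M g"
proof -
  define A where "A = energy M f"
  define B where "B = (\<integral>x. f x \<bullet> g x \<partial>M)"
  define C where "C = energy M g"
  have i: "integrable M (\<lambda>x. (norm (f x))\<^sup>2)" "integrable M (\<lambda>x. (norm (g x))\<^sup>2)"
    "integrable M (\<lambda>x. f x \<bullet> g x)"
    using assms L2_inner_integrable[OF assms] by (auto simp: L2_def)
  have A0: "A \<ge> 0" "C \<ge> 0" by (simp_all add: A_def C_def)
  have q: "0 \<le> A - 2 * t * B + t\<^sup>2 * C" for t
  proof -
    have "0 \<le> energy M (\<lambda>x. f x - t *\<^sub>R g x)" by simp
    also have "\<dots> = (\<integral>x. (norm (f x))\<^sup>2 - 2 * t * (f x \<bullet> g x) + t\<^sup>2 * (norm (g x))\<^sup>2 \<partial>M)"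
      by (simp add: norm_sq_diff power_mult_distrib mult.assoc)
    also have "\<dots> = A - 2 * t * B + t\<^sup>2 * C" using i by (simp add: A_def B_def C_def)
    finally show ?thesis .
  qed
  have "B\<^sup>2 \<le> A * C"
  proof (cases "C = 0")
    case True
    have "B = 0"
    proof (rule ccontr)
      assume "B \<noteq> 0"
      \<comment> \<open>With C = 0 the quadratic is affine in t, and at this t it takes the value
        -1.\<close>
      then show False using q[of "(A + 1) / (2 * B)"] True by simp
    qed
    then show ?thesis using True by simp
  next
    case False
    then have "C > 0" using A0 by simp
    have "0 \<le> (A - 2 * (B / C) * B + (B / C)\<^sup>2 * C) * C" using q[of "B / C"] A0 by simp
    also have "\<dots> = A * C - B\<^sup>2" using \<open>C > 0\<close> by (simp add: field_simps power2_eq_square)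
    finally show ?thesis by simp
  qed
  then show ?thesis by (simp add: A_def B_def C_def)
qed

lemma L2_to_inner:
  assumes "L2_to M f u" "L2 M g"
  shows "(\<lambda>n. \<integral>x. f n x \<bullet> g x \<partial>M) \<longlonglongrightarrow> (\<integral>x. u x \<bullet> g x \<partial>M)"
proof -
  have L: "L2 M (f n)" "L2 M u" for n using assms by (auto simp: L2_to_def)
  have "(\<lambda>n. energy M (\<lambda>x. f n x - u x) * energy M g) \<longlonglongrightarrow> 0 * energy M g"
    using assms(1) unfolding L2_to_def by (intro tendsto_mult tendsto_const) auto
  then have "(\<lambda>n. (\<integral>x. (f n x - u x) \<bullet> g x \<partial>M)\<^sup>2) \<longlonglongrightarrow> 0"
    by (intro Lim_null_comparison[of "\<lambda>n. (\<integral>x. (f n x - u x) \<bullet> g x \<partial>M)\<^sup>2"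
          "\<lambda>n. energy M (\<lambda>x. f n x - u x) * energy M g"])
       (auto intro!: always_eventually L2_Cauchy_Schwarz L2_diff L assms(2))
  from tendsto_real_sqrt[OF this]
  have "(\<lambda>n. \<bar>\<integral>x. (f n x - u x) \<bullet> g x \<partial>M\<bar>) \<longlonglongrightarrow> 0" by simp
  then have "(\<lambda>n. \<integral>x. (f n x - u x) \<bullet> g x \<partial>M) \<longlonglongrightarrow> 0"
    by (rule tendsto_rabs_zero_cancel)
  moreover have "(\<integral>x. (f n x - u x) \<bullet> g x \<partial>M) = (\<integral>x. f n x \<bullet> g x \<partial>M) - (\<integral>x. u x \<bullet> g x \<partial>M)" for n
    unfolding inner_diff_left using L assms(2)
    by (intro Bochner_Integration.integral_diff L2_inner_integrable) auto
  ultimately show ?thesis by (simp add: LIM_zero_iff)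
qed

lemma L2_to_norm:
  assumes "L2_to M f u"
  shows "(\<lambda>n. \<integral>x. (norm (f n x))\<^sup>2 \<partial>M) \<longlonglongrightarrow> (energy M u)"
proof -
  have L: "L2 M (f n)" "L2 M u" for n using assms by (auto simp: L2_to_def)
  have "energy M (f n)
      = energy M (\<lambda>x. f n x - u x) + 2 * (\<integral>x. f n x \<bullet> u x \<partial>M) - energy M u" for n
  proof -
    have "energy M (\<lambda>x. f n x - u x)
      = energy M (f n) - 2 * (\<integral>x. f n x \<bullet> u x \<partial>M) + energy M u"
      unfolding norm_sq_diff using L(1)[of n] L(2) L2_inner_integrable[OF L(1)[of n] L(2)]
      by (simp add: L2_def)
    then show ?thesis by simp
  qed
  moreover have "(\<lambda>n. energy M (\<lambda>x. f n x - u x) + 2 * (\<integral>x. f n x \<bullet> u x \<partial>M) - energy M u)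
      \<longlonglongrightarrow> 0 + 2 * (\<integral>x. u x \<bullet> u x \<partial>M) - energy M u"
    by (intro tendsto_intros L2_to_inner assms L) (use assms in \<open>simp add: L2_to_def\<close>)
  ultimately show ?thesis by (simp add: power2_norm_eq_inner)
qed

lemma L2_to_diff:
  assumes "L2_to M f u" "L2_to M f' u'"
  shows "L2_to M (\<lambda>n x. f n x - f' n x) (\<lambda>x. u x - u' x)"
proof -
  have L: "L2 M (f n)" "L2 M u" "L2 M (f' n)" "L2 M u'" for n using assms by (auto simp: L2_to_def)
  have b: "energy M (\<lambda>x. (f n x - f' n x) - (u x - u' x))
      \<le> 2 * energy M (\<lambda>x. f n x - u x) + 2 * energy M (\<lambda>x. f' n x - u' x)" for n
  proof -
    have i: "integrable M (\<lambda>x. (norm (f n x - u x))\<^sup>2)" "integrable M (\<lambda>x. (norm (f' n x - u' x))\<^sup>2)"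
      "integrable M (\<lambda>x. (norm ((f n x - f' n x) - (u x - u' x)))\<^sup>2)"
      using L2_diff[OF L(1,2)] L2_diff[OF L(3,4)] L2_diff[OF L2_diff[OF L(1,3)] L2_diff[OF L(2,4)]]
      by (auto simp: L2_def)
    have "energy M (\<lambda>x. (f n x - f' n x) - (u x - u' x))
      \<le> (\<integral>x. 2 * (norm (f n x - u x))\<^sup>2 + 2 * (norm (f' n x - u' x))\<^sup>2 \<partial>M)"
    proof (rule integral_mono)
      fix x
      have "(f n x - f' n x) - (u x - u' x) = (f n x - u x) - (f' n x - u' x)" by simp
      then show "(norm ((f n x - f' n x) - (u x - u' x)))\<^sup>2
        \<le> 2 * (norm (f n x - u x))\<^sup>2 + 2 * (norm (f' n x - u' x))\<^sup>2"
        by (simp only: norm_sq_diff_le)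
    qed (use i in auto)
    then show ?thesis using i by simp
  qed
  have "(\<lambda>n. 2 * energy M (\<lambda>x. f n x - u x) + 2 * energy M (\<lambda>x. f' n x - u' x)) \<longlonglongrightarrow> 2 * 0 + 2 * 0"
    using assms unfolding L2_to_def by (intro tendsto_intros) auto
  then have "(\<lambda>n. \<integral>x. (norm ((f n x - f' n x) - (u x - u' x)))\<^sup>2 \<partial>M) \<longlonglongrightarrow> 0"
    by (intro Lim_null_comparison[of "\<lambda>n. \<integral>x. (norm ((f n x - f' n x) - (u x - u' x)))\<^sup>2 \<partial>M"
          "\<lambda>n. 2 * energy M (\<lambda>x. f n x - u x) + 2 * energy M (\<lambda>x. f' n x - u' x)"])
       (use b in auto)
  then show ?thesis by (simp add: L2_to_def L2_diff L)
qed

lemma L2_to_const: "L2 M u \<Longrightarrow> L2_to M (\<lambda>n. u) u"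
  by (simp add: L2_to_def)

lemma L2_to_AE_subseq:
  assumes "L2_to M f u"
  obtains r where "strict_mono (r :: nat \<Rightarrow> nat)" "AE x in M. (\<lambda>n. f (r n) x) \<longlonglongrightarrow> u x"
proof -
  have L: "L2 M (\<lambda>x. f n x - u x)" for n using assms by (auto simp: L2_to_def intro: L2_diff)
  then have "\<And>n. integrable M (\<lambda>x. (norm (f n x - u x))\<^sup>2)" by (simp add: L2_def)
  moreover have "(\<lambda>n. \<integral>x. norm ((norm (f n x - u x))\<^sup>2) \<partial>M) \<longlonglongrightarrow> 0"
    using assms by (simp add: L2_to_def)
  ultimately obtain r where r: "strict_mono r" "AE x in M. (\<lambda>n. (norm (f (r n) x - u x))\<^sup>2) \<longlonglongrightarrow> 0"
    using tendsto_L1_AE_subseq[of M "\<lambda>n x. (norm (f n x - u x))\<^sup>2"] by blast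
  have "AE x in M. (\<lambda>n. f (r n) x) \<longlonglongrightarrow> u x"
    using r(2)
  proof eventually_elim
    case (elim x)
    from tendsto_real_sqrt[OF elim] have "(\<lambda>n. norm (f (r n) x - u x)) \<longlonglongrightarrow> 0" by simp
    then show ?case by (simp add: tendsto_norm_zero_iff LIM_zero_iff)
  qed
  then show ?thesis using r(1) that by blast
qed

section \<open>Weak gradients as limits of gradients of test functions\<close>

lemma integral_disc_measure:
  fixes F :: "real^2 \<Rightarrow> 'b::{banach, second_countable_topology}"
  assumes "F \<in> borel_measurable borel" "\<And>x. x \<notin> disc \<Longrightarrow> F x = 0"
  shows "integral\<^sup>L disc_measure F = integral\<^sup>L lborel F"
    and "integrable disc_measure F \<longleftrightarrow> integrable lborel F"
proof -
  have eq: "(\<lambda>x. indicator disc x *\<^sub>R F x) = F" using assms(2) by (force simp: indicator_def)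
  show "integral\<^sup>L disc_measure F = integral\<^sup>L lborel F"
    using assms(1) by (subst integral_restrict_space) (auto simp: eq integral_completion)
  show "integrable disc_measure F \<longleftrightarrow> integrable lborel F"
    using assms(1) by (subst integrable_restrict_space) (auto simp: eq integrable_completion)
qed

lemma test_function_zero:
  assumes "\<phi> \<in> test_functions disc" "x \<notin> disc"
  shows "\<phi> x = 0" "gradient \<phi> x = 0"
  using test_function_disc_support[OF assms(1)] assms(2)
      by (metis linorder_not_less mem_ball_0 order_less_le_trans)+

lemma test_function_measurable:
  assumes "\<phi> \<in> test_functions disc"
  shows "\<phi> \<in> borel_measurable borel" "gradient \<phi> \<in> borel_measurable borel"
  using C1cD[OF test_function_C1c[OF assms]] by (auto intro!: borel_measurable_continuous_onI)

lemma test_function_L2: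
  assumes "\<phi> \<in> test_functions disc"
  shows "L2 disc_measure \<phi>" "L2 disc_measure (gradient \<phi>)"
proof -
  note m[measurable] = test_function_measurable[OF assms] and z = test_function_zero[OF assms]
  note i = C1c_integrable[OF test_function_C1c[OF assms]]
  have "integrable disc_measure (\<lambda>x. (norm (\<phi> x))\<^sup>2)"
    by (subst integral_disc_measure(2)) (use z i in auto)
  then show "L2 disc_measure \<phi>" by (simp add: L2_def borel_measurable_disc_measure[OF m(1)])
  have "integrable disc_measure (\<lambda>x. (norm (gradient \<phi> x))\<^sup>2)"
    by (subst integral_disc_measure(2)) (use z i in auto)
  then show "L2 disc_measure (gradient \<phi>)" by (simp add: L2_def borel_measurable_disc_measure[OF m(2)])
qed

lemma energy_disc_measure:
  assumes "\<phi> \<in> test_functions disc"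
  shows "energy disc_measure (gradient \<phi>) = energy lborel (gradient \<phi>)"
proof -
  note [measurable] = test_function_measurable[OF assms]
  show ?thesis by (rule integral_disc_measure) (use test_function_zero[OF assms] in auto)
qed

lemma inner_disc_measure:
  assumes "\<phi> \<in> test_functions disc" "\<psi> \<in> test_functions disc"
  shows "(\<integral>x. gradient \<phi> x \<bullet> gradient \<psi> x \<partial>disc_measure) = (\<integral>x. gradient \<phi> x \<bullet> gradient \<psi> x \<partial>lborel)"
proof -
  note [measurable] = test_function_measurable[OF assms(1)] test_function_measurable[OF assms(2)]
  show ?thesis by (rule integral_disc_measure) (use test_function_zero[OF assms(1)] in auto)
qed

lemma has_H01_gradient_iff:
  "has_H01_gradient u g \<longleftrightarrow> (\<exists>\<phi>. (\<forall>n. \<phi> n \<in> test_functions disc) \<and>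
     L2_to disc_measure \<phi> u \<and> L2_to disc_measure (\<lambda>n. gradient (\<phi> n)) g)"
  by (simp add: has_H01_gradient_def Lp_tendsto_2_iff)

lemma has_H01_gradient_L2:
  "has_H01_gradient u g \<Longrightarrow> L2 disc_measure u \<and> L2 disc_measure g"
  by (auto simp: has_H01_gradient_iff L2_to_def)

lemma has_H01_gradient_test:
  "\<phi> \<in> test_functions disc \<Longrightarrow> has_H01_gradient \<phi> (gradient \<phi>)"
  unfolding has_H01_gradient_iff
  by (intro exI[of _ "\<lambda>n. \<phi>"]) (auto intro: L2_to_const test_function_L2)

lemma has_H01_gradient_diff:
  assumes "has_H01_gradient u g" "has_H01_gradient u' g'"
  shows "has_H01_gradient (\<lambda>x. u x - u' x) (\<lambda>x. g x - g' x)"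
proof -
  obtain \<phi> where p: "\<And>n. \<phi> n \<in> test_functions disc" "L2_to disc_measure \<phi> u"
    "L2_to disc_measure (\<lambda>n. gradient (\<phi> n)) g"
    using assms(1) by (auto simp: has_H01_gradient_iff)
  obtain \<phi>' where p': "\<And>n. \<phi>' n \<in> test_functions disc" "L2_to disc_measure \<phi>' u'"
    "L2_to disc_measure (\<lambda>n. gradient (\<phi>' n)) g'"
    using assms(2) by (auto simp: has_H01_gradient_iff)
  show ?thesis
    unfolding has_H01_gradient_iff
    using L2_to_diff[OF p(2) p'(2)] L2_to_diff[OF p(3) p'(3)]
    by (intro exI[of _ "\<lambda>n x. \<phi> n x - \<phi>' n x"])
       (auto simp: test_function_diff p p' gradient_diff)
qed

text \<open>The energy of the difference of two weak gradients is a double limit of Dirichlet products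
  \<open>\<integral> \<nabla>\<phi>\<^sub>m \<bullet> \<nabla>\<phi>\<^sub>n = - \<integral> \<phi>\<^sub>n \<Delta>\<phi>\<^sub>m\<close>, whose inner limit vanishes
  because \<open>\<phi>\<^sub>n \<longlonglongrightarrow> 0\<close> in $L^2$.\<close>

lemma has_H01_gradient_zero:
  assumes "has_H01_gradient u g" and u: "AE x in disc_measure. u x = 0"
  shows "energy disc_measure g = 0"
proof -
  obtain \<phi> where p: "\<And>n. \<phi> n \<in> test_functions disc" "L2_to disc_measure \<phi> u"
    "L2_to disc_measure (\<lambda>n. gradient (\<phi> n)) g"
    using assms(1) by (auto simp: has_H01_gradient_iff)
  have g: "L2 disc_measure g" using p(3) by (simp add: L2_to_def)
  have z: "(\<integral>x. g x \<bullet> gradient \<psi> x \<partial>disc_measure) = 0" if psi: "\<psi> \<in> test_functions disc" for \<psi>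
  proof -
    define l where "l = laplacian \<psi>"
    note D = test_function_derivative[OF psi]
    have [measurable]: "l \<in> borel_measurable borel" "\<phi> n \<in> borel_measurable borel" for n
      unfolding l_def laplacian_def[abs_def]
      using test_function_measurable[OF D] test_function_measurable[OF p(1)] by auto
    have cl: "continuous_on UNIV l"
      unfolding l_def laplacian_def[abs_def]
      by (intro continuous_intros C1c_cont_grad[OF test_function_C1c[OF D]])
    have l0: "l x = 0" if "norm x > 1" for x
      using test_function_zero(2)[OF D, of x] that by (simp add: l_def laplacian_def)
    have L: "L2 disc_measure l"
    proof -
      have "integrable lborel (\<lambda>x. (norm (l x))\<^sup>2)"
        by (rule integrable_lborel_cont_bounded_support[of _ 1])
           (auto intro!: continuous_intros cl simp: l0)
      moreover have "l x = 0" if "x \<notin> disc" for x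
        using test_function_zero(2)[OF D that] by (simp add: l_def laplacian_def)
      ultimately have "integrable disc_measure (\<lambda>x. (norm (l x))\<^sup>2)"
        by (subst integral_disc_measure(2)) auto
      then show ?thesis by (simp add: L2_def borel_measurable_disc_measure)
    qed
    have "(\<integral>x. gradient (\<phi> n) x \<bullet> gradient \<psi> x \<partial>disc_measure) = - (\<integral>x. \<phi> n x \<bullet> l x \<partial>disc_measure)" for n
    proof -
      have "(\<integral>x. \<phi> n x \<bullet> l x \<partial>disc_measure) = (\<integral>x. \<phi> n x * l x \<partial>lborel)"
        by (subst integral_disc_measure(1)) (use test_function_zero[OF p(1)] in auto)
      then show ?thesis
        using green_test_functions[OF p(1) psi] inner_disc_measure[OF p(1) psi] by (simp add: l_def)
    qed
    moreover have "(\<lambda>n. - (\<integral>x. \<phi> n x \<bullet> l x \<partial>disc_measure)) \<longlonglongrightarrow> - (\<integral>x. u x \<bullet> l x \<partial>disc_measure)"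
      by (intro tendsto_minus L2_to_inner p L)
    moreover have "(\<integral>x. u x \<bullet> l x \<partial>disc_measure) = 0"
      using u by (intro integral_eq_zero_AE) auto
    ultimately have "(\<lambda>n. \<integral>x. gradient (\<phi> n) x \<bullet> gradient \<psi> x \<partial>disc_measure) \<longlonglongrightarrow> 0" by simp
    with L2_to_inner[OF p(3) test_function_L2(2)[OF psi]] show ?thesis
      by (rule LIMSEQ_unique)
  qed
  have "(\<lambda>n. \<integral>x. gradient (\<phi> n) x \<bullet> g x \<partial>disc_measure) \<longlonglongrightarrow> (\<integral>x. g x \<bullet> g x \<partial>disc_measure)"
    by (rule L2_to_inner[OF p(3) g])
  moreover have "(\<integral>x. gradient (\<phi> n) x \<bullet> g x \<partial>disc_measure) = 0" for n
    using z[OF p(1)] by (simp add: inner_commute)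
  ultimately show ?thesis by (simp add: power2_norm_eq_inner LIMSEQ_const_iff)
qed

lemma has_H01_gradient_unique:
  assumes "has_H01_gradient u g" "has_H01_gradient u g'"
  shows "AE x in disc_measure. g x = g' x"
proof -
  have d: "has_H01_gradient (\<lambda>x. u x - u x) (\<lambda>x. g x - g' x)"
    by (rule has_H01_gradient_diff[OF assms])
  then have "energy disc_measure (\<lambda>x. g x - g' x) = 0"
    by (rule has_H01_gradient_zero) simp
  moreover have "integrable disc_measure (\<lambda>x. (norm (g x - g' x))\<^sup>2)"
    using has_H01_gradient_L2[OF d] by (simp add: L2_def)
  ultimately have "AE x in disc_measure. (norm (g x - g' x))\<^sup>2 = 0"
    using integral_nonneg_eq_0_iff_AE[of disc_measure "\<lambda>x. (norm (g x - g' x))\<^sup>2"] by simp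
  then show ?thesis by eventually_elim simp
qed

lemma weak_gradient:
  "u \<in> H01 \<Longrightarrow> has_H01_gradient u (weak_gradient u)"
  unfolding H01_def weak_gradient_def by (simp add: someI_ex)

text \<open>Uniqueness almost everywhere lets any admissible gradients stand in for the ones
  selected by choice; in particular, products of test functions can be computed from their classical
  gradients.\<close>

lemma H01_inner_eq:
  assumes "has_H01_gradient u g" "has_H01_gradient v h"
  shows "H01_inner u v = (\<integral>x. g x \<bullet> h x \<partial>disc_measure)"
proof -
  have w: "has_H01_gradient u (weak_gradient u)" "has_H01_gradient v (weak_gradient v)"
    using assms by (auto intro!: weak_gradient simp: H01_def)
  have L: "L2 disc_measure (weak_gradient u)" "L2 disc_measure (weak_gradient v)"
    "L2 disc_measure g" "L2 disc_measure h"
    using w assms by (auto dest: has_H01_gradient_L2)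
  show ?thesis unfolding H01_inner_def
  proof (rule integral_cong_AE)
    show "AE x in disc_measure. weak_gradient u x \<bullet> weak_gradient v x = g x \<bullet> h x"
      using has_H01_gradient_unique[OF w(1) assms(1)] has_H01_gradient_unique[OF w(2) assms(2)]
      by eventually_elim simp
  qed (use L in \<open>auto simp: L2_def\<close>)
qed

lemma H01_norm_eq:
  assumes "has_H01_gradient u g"
  shows "H01_norm u = sqrt (energy disc_measure g)"
  by (simp add: H01_norm_def H01_inner_eq[OF assms assms] power2_norm_eq_inner)

section \<open>Transfer of the weighted inequality from test functions to \<open>H01\<close>\<close>

lemma Lp_space_of_nn_integral_le:
  assumes u: "u \<in> borel_measurable M" and "q > 0" "K \<ge> 0"
    and le: "(\<integral>\<^sup>+x. ennreal (norm (u x) powr q) \<partial>M) \<le> ennreal K"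
  shows "u \<in> Lp_space M q" "(\<integral>x. norm (u x) powr q \<partial>M) \<le> K" "Lp_norm M q u \<le> K powr (1 / q)"
proof -
  have [measurable]: "u \<in> borel_measurable M" by fact
  have i: "integrable M (\<lambda>x. norm (u x) powr q)"
    by (rule integrableI_bounded) (use le in \<open>auto simp: le_less_trans[OF le]\<close>)
  then show "u \<in> Lp_space M q" using u by (simp add: Lp_space_def)
  have "ennreal (\<integral>x. norm (u x) powr q \<partial>M) \<le> ennreal K"
    using le i by (simp add: nn_integral_eq_integral)
  then show *: "(\<integral>x. norm (u x) powr q \<partial>M) \<le> K" using \<open>K \<ge> 0\<close> by simp
  show "Lp_norm M q u \<le> K powr (1 / q)"
    unfolding Lp_norm_def using * \<open>q > 0\<close> by (intro powr_mono2) auto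
qed

text \<open>Lower semicontinuity of the q-mass under almost everywhere convergence. It extends
  inequalities to limits, and later compares a sequence with its pointwise limit.\<close>

lemma nn_integral_powr_Fatou:
  fixes f :: "nat \<Rightarrow> 'a \<Rightarrow> real"
  assumes m: "\<And>n. f n \<in> borel_measurable M" and lim: "AE x in M. (\<lambda>n. f n x) \<longlonglongrightarrow> u x" and "q > 0"
    and le: "\<forall>\<^sub>F n in sequentially. powr_mass M q (f n) \<le> K"
  shows "powr_mass M q u \<le> K"
proof -
  note [measurable] = m
  have "powr_mass M q u = (\<integral>\<^sup>+x. liminf (\<lambda>n. ennreal (\<bar>f n x\<bar> powr q)) \<partial>M)"
  proof (rule nn_integral_cong_AE)
    show "AE x in M. ennreal (\<bar>u x\<bar> powr q) = liminf (\<lambda>n. ennreal (\<bar>f n x\<bar> powr q))"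
      using lim
    proof eventually_elim
      case (elim x)
      have "(\<lambda>n. ennreal (\<bar>f n x\<bar> powr q)) \<longlonglongrightarrow> ennreal (\<bar>u x\<bar> powr q)"
        by (intro tendsto_ennrealI tendsto_powr' tendsto_intros elim) (use \<open>q > 0\<close> in auto)
      then show ?case by (intro lim_imp_Liminf[symmetric]) auto
    qed
  qed
  also have "\<dots> \<le> liminf (\<lambda>n. \<integral>\<^sup>+x. ennreal (\<bar>f n x\<bar> powr q) \<partial>M)"
    by (rule nn_integral_liminf) measurable
  also have "\<dots> \<le> liminf (\<lambda>n::nat. K)" by (rule Liminf_mono[OF le])
  finally show ?thesis by (simp add: Liminf_const)
qed

lemma AE_log_measureI:
  assumes "AE x in disc_measure. P x"
  shows "AE x in log_measure a q. P x"
proof -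
  have [measurable]: "log_weight a q \<in> borel_measurable disc_measure"
    by (rule borel_measurable_disc_measure) measurable
  show ?thesis unfolding log_measure_def using assms by (subst AE_density) auto
qed

text \<open>Approximating test functions satisfy the inequality, their energies converge because
  their gradients do in L^2, and an almost everywhere convergent subsequence hands the bound to u by
  Fatou's lemma.\<close>

lemma H01_weighted_inequality:
  assumes a: "a > 1" and q: "q \<ge> 2"
  obtains C where "C \<ge> 0" "\<And>u g. has_H01_gradient u g \<Longrightarrow>
     powr_mass (log_measure a q) q u
       \<le> ennreal (C * sqrt (energy disc_measure g) powr q)"
proof -
  obtain C where C: "C \<ge> 0" "\<And>f g c. C1c f g \<Longrightarrow> (\<And>x. norm x \<ge> 1 \<Longrightarrow> f x = 0) \<Longrightarrow> c > 0 \<Longrightarrow>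
     energy lborel g \<le> c\<^sup>2 \<Longrightarrow>
     powr_mass (log_measure a q) q f \<le> ennreal (C * c powr q)"
    using weighted_inequality[OF a q] by blast
  have "powr_mass (log_measure a q) q u
       \<le> ennreal (C * sqrt (energy disc_measure g) powr q)"
    if h: "has_H01_gradient u g" for u g
  proof -
    obtain \<phi> where p: "\<And>n. \<phi> n \<in> test_functions disc" "L2_to disc_measure \<phi> u"
      "L2_to disc_measure (\<lambda>n. gradient (\<phi> n)) g"
      using h by (auto simp: has_H01_gradient_iff)
    define G where "G = sqrt (energy disc_measure g)"
    have G0: "G \<ge> 0" by (simp add: G_def)
    have G2: "energy disc_measure g = G\<^sup>2" by (simp add: G_def)
    obtain r where r: "strict_mono (r :: nat \<Rightarrow> nat)" "AE x in disc_measure. (\<lambda>n. \<phi> (r n) x) \<longlonglongrightarrow> u x"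
      using L2_to_AE_subseq[OF p(2)] by blast
    have lim: "(\<lambda>n. \<integral>x. (norm (gradient (\<phi> (r n)) x))\<^sup>2 \<partial>lborel) \<longlonglongrightarrow> G\<^sup>2"
      using LIMSEQ_subseq_LIMSEQ[OF L2_to_norm[OF p(3)] r(1)]
      by (simp add: comp_def energy_disc_measure[OF p(1)] G2)
    \<comment> \<open>The energies of the approximants are eventually below c^2 only when c exceeds
      the limit G; the value c = G is recovered afterwards by letting c decrease to it.\<close>
    have c: "powr_mass (log_measure a q) q u \<le> ennreal (C * c powr q)" if c: "c > G" for c
    proof (rule nn_integral_powr_Fatou)
      show "\<phi> (r n) \<in> borel_measurable (log_measure a q)" for n
        using test_function_measurable[OF p(1)] by (simp add: borel_measurable_disc_measure)
      show "AE x in log_measure a q. (\<lambda>n. \<phi> (r n) x) \<longlonglongrightarrow> u x" by (intro AE_log_measureI r)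
      show "q > 0" using q by simp
      have "G\<^sup>2 < c\<^sup>2" using c G0 by (intro power_strict_mono) auto
      from order_tendstoD(2)[OF lim this]
      show "\<forall>\<^sub>F n in sequentially. powr_mass (log_measure a q) q (\<lambda>x. \<phi> (r n) x) \<le> ennreal (C * c powr q)"
      proof eventually_elim
        case (elim n)
        show ?case
          by (rule C(2)[OF test_function_C1c[OF p(1)]])
            (use elim c G0 test_function_zero[OF p(1)] in auto)
      qed
    qed
    have "(\<lambda>n. ennreal (C * (G + 1 / real (Suc n)) powr q)) \<longlonglongrightarrow> ennreal (C * (G + 0) powr q)"
      using q G0 by (intro tendsto_ennrealI tendsto_mult tendsto_powr' tendsto_add tendsto_const
          lim_inverse_n'[THEN LIMSEQ_Suc]) (auto intro!: always_eventually add_nonneg_nonneg)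
    then have "powr_mass (log_measure a q) q u \<le> ennreal (C * (G + 0) powr q)"
      by (rule LIMSEQ_le_const) (auto intro!: c exI[of _ 0])
    then show ?thesis by (simp add: G_def)
  qed
  then show ?thesis using that C(1) by blast
qed

lemma H01_measurable: "u \<in> H01 \<Longrightarrow> u \<in> borel_measurable disc_measure"
  using has_H01_gradient_L2 unfolding H01_def L2_def by blast

lemma H01_continuous_embedding:
  assumes a: "a > 1" and q: "q \<ge> 2"
  shows "continuous_embedding H01 H01_norm (Lp_space (log_measure a q) q) (Lp_norm (log_measure a q) q)"
proof -
  obtain C where C: "C \<ge> 0" "\<And>u g. has_H01_gradient u g \<Longrightarrow>
     powr_mass (log_measure a q) q u
       \<le> ennreal (C * sqrt (energy disc_measure g) powr q)"
    using H01_weighted_inequality[OF a q] by blast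
  have *: "u \<in> Lp_space (log_measure a q) q" "Lp_norm (log_measure a q) q u \<le> C powr (1 / q) * H01_norm u"
    if "u \<in> H01" for u
  proof -
    note w = weak_gradient[OF that]
    have n: "H01_norm u \<ge> 0" by (simp add: H01_norm_eq[OF w])
    have le: "(\<integral>\<^sup>+x. ennreal (norm (u x) powr q) \<partial>log_measure a q) \<le> ennreal (C * H01_norm u powr q)"
      using C(2)[OF w] by (simp add: H01_norm_eq[OF w])
    have u: "u \<in> borel_measurable (log_measure a q)" using H01_measurable[OF that] by simp
    have q0: "q > 0" using q by simp
    have K: "C * H01_norm u powr q \<ge> 0" using C(1) by simp
    note L = Lp_space_of_nn_integral_le[OF u q0 K le]
    show "u \<in> Lp_space (log_measure a q) q" by (rule L)
    have "(C * H01_norm u powr q) powr (1 / q) = C powr (1 / q) * H01_norm u"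
      using C(1) n q0 by (simp add: powr_mult powr_powr)
    then show "Lp_norm (log_measure a q) q u \<le> C powr (1 / q) * H01_norm u" using L(3) by simp
  qed
  then show ?thesis unfolding continuous_embedding_def by blast
qed

lemma continuous_embedding_subset:
  "continuous_embedding X nX Y nY \<Longrightarrow> X' \<subseteq> X \<Longrightarrow> continuous_embedding X' nX Y nY"
  unfolding continuous_embedding_def by blast

text \<open>If \<open>\<phi>\<^sub>n\<close> approximates \<open>u\<close>, its radial average \<open>a\<^sub>n\<close> satisfies
  \<open>\<parallel>\<nabla>a\<^sub>n\<parallel>\<^sup>2 = \<langle>\<nabla>\<phi>\<^sub>n - \<nabla>u, \<nabla>a\<^sub>n\<rangle>\<close>, since \<open>u\<close> is orthogonal to \<open>a\<^sub>n\<close>; hence \<open>a\<^sub>n\<close> tends to zero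
  and \<open>\<phi>\<^sub>n - a\<^sub>n\<close> approximates \<open>u\<close> as well.\<close>

lemma rad_perp_approximation:
  assumes u: "u \<in> H01_rad_perp"
  obtains \<psi> where "\<And>n. \<psi> n \<in> test_functions disc" "\<And>n x. avg (\<psi> n) x = 0"
    "L2_to disc_measure (\<lambda>n. gradient (\<psi> n)) (weak_gradient u)"
proof -
  define g where "g = weak_gradient u"
  have uH: "u \<in> H01" using u by (simp add: H01_rad_perp_def)
  note w = weak_gradient[OF uH, folded g_def]
  obtain \<phi> where p: "\<And>n. \<phi> n \<in> test_functions disc" "L2_to disc_measure \<phi> u"
    "L2_to disc_measure (\<lambda>n. gradient (\<phi> n)) g"
    using w by (auto simp: has_H01_gradient_iff)
  have L: "L2 disc_measure g" "\<And>n. L2 disc_measure (gradient (\<phi> n))" using p(3) by (auto simp: L2_to_def)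
  define \<alpha> where "\<alpha> n = avg (\<phi> n)" for n
  note c = C1c_cont[OF test_function_C1c[OF p(1)]]
  have aT: "\<alpha> n \<in> test_functions disc" for n unfolding \<alpha>_def by (rule test_function_avg[OF p(1)])
  have ga: "gradient (\<alpha> n) = avg_grad (gradient (\<phi> n))" for n
    unfolding \<alpha>_def by (rule gradient_avg[OF p(1)])
  have La: "L2 disc_measure (gradient (\<alpha> n))" for n by (rule test_function_L2(2)[OF aT])
  have le: "energy disc_measure (gradient (\<alpha> n))
      \<le> energy disc_measure (\<lambda>x. gradient (\<phi> n) x - g x)" for n
  proof -
    define A where "A = energy disc_measure (gradient (\<alpha> n))"
    define B where "B = energy disc_measure (\<lambda>x. gradient (\<phi> n) x - g x)"
    have "\<alpha> n x = \<alpha> n (norm x *\<^sub>R axis 1 1)" for x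
      unfolding \<alpha>_def by (rule avg_radial[OF c])
    then have "AE x in disc_measure. \<alpha> n x = (\<lambda>r. \<alpha> n (r *\<^sub>R axis 1 1)) (norm x)" by simp
    then have "\<exists>f. AE x in disc_measure. \<alpha> n x = f (norm x)"
      by (intro exI[of _ "\<lambda>r. \<alpha> n (r *\<^sub>R axis 1 1)"]) simp
    moreover have "\<alpha> n \<in> H01" using has_H01_gradient_test[OF aT] by (auto simp: H01_def)
    ultimately have "\<alpha> n \<in> H01_rad" by (simp add: H01_rad_def)
    then have "H01_inner u (\<alpha> n) = 0" using u by (simp add: H01_rad_perp_def)
    then have z: "(\<integral>x. g x \<bullet> gradient (\<alpha> n) x \<partial>disc_measure) = 0"
      by (simp add: H01_inner_eq[OF w has_H01_gradient_test[OF aT]])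
    have "A = (\<integral>x. gradient (\<phi> n) x \<bullet> gradient (\<alpha> n) x \<partial>disc_measure)"
      unfolding A_def energy_disc_measure[OF aT] inner_disc_measure[OF p(1) aT]
      using avg_orthogonal[OF test_function_C1c[OF p(1)]] by (simp add: ga)
    also have "\<dots> = (\<integral>x. (gradient (\<phi> n) x - g x) \<bullet> gradient (\<alpha> n) x \<partial>disc_measure)"
      using L2_inner_integrable[OF L(2) La] L2_inner_integrable[OF L(1) La] z
      by (simp add: inner_diff_left)
    finally have "A\<^sup>2 \<le> B * A"
      using L2_Cauchy_Schwarz[OF L2_diff[OF L(2)[of n] L(1)] La[of n]] by (simp add: A_def B_def)
    moreover have "A \<ge> 0" "B \<ge> 0" by (simp_all add: A_def B_def)
    ultimately have "A \<le> B" by (cases "A = 0") (auto simp: power2_eq_square)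
    then show ?thesis by (simp add: A_def B_def)
  qed
  have "(\<lambda>n. \<integral>x. (norm (gradient (\<alpha> n) x - 0))\<^sup>2 \<partial>disc_measure) \<longlonglongrightarrow> 0"
  proof (rule Lim_null_comparison)
    show "(\<lambda>n. \<integral>x. (norm (gradient (\<phi> n) x - g x))\<^sup>2 \<partial>disc_measure) \<longlonglongrightarrow> 0"
      using p(3) by (simp add: L2_to_def)
    show "\<forall>\<^sub>F n in sequentially. norm (energy disc_measure (\<lambda>x. gradient (\<alpha> n) x - 0))
      \<le> energy disc_measure (\<lambda>x. gradient (\<phi> n) x - g x)"
      using le by (intro always_eventually) simp
  qed
  then have "L2_to disc_measure (\<lambda>n. gradient (\<alpha> n)) (\<lambda>x. 0)"
    using La by (simp add: L2_to_def, simp add: L2_def)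
  from L2_to_diff[OF p(3) this]
  have lim: "L2_to disc_measure (\<lambda>n. gradient (\<lambda>x. \<phi> n x - \<alpha> n x)) g"
    by (simp add: gradient_diff[OF p(1) aT])
  have "avg (\<lambda>x. \<phi> n x - \<alpha> n x) x = 0" for n x
  proof -
    have "avg (\<lambda>x. \<phi> n x - \<alpha> n x) x = avg (\<phi> n) x - avg (\<alpha> n) x"
      by (rule avg_diff[OF c C1c_cont[OF test_function_C1c[OF aT]]])
    then show ?thesis unfolding \<alpha>_def using avg_avg[OF c] by simp
  qed
  then show ?thesis
    using that[of "\<lambda>n x. \<phi> n x - \<alpha> n x"] lim test_function_diff[OF p(1) aT] by (simp add: g_def)
qed

subsection \<open>Rellich compactness in $L^1$\<close>

lemma lborel_shift:
  fixes f :: "'a::euclidean_space \<Rightarrow> 'b::{banach, second_countable_topology}"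
  assumes [measurable]: "f \<in> borel_measurable borel"
  shows "(\<integral>x. f (c + x) \<partial>lborel) = (\<integral>x. f x \<partial>lborel)"
    "integrable lborel (\<lambda>x. f (c + x)) \<longleftrightarrow> integrable lborel f"
  using integral_distr[of "(+) c" lborel borel f] integrable_distr_eq[of "(+) c" lborel borel f]
  by (simp_all add: lborel_distr_plus)

text \<open>An unnormalised mean over a ball about x; the volume reappears as a factor in
  \<open>ball_integral_approx\<close>. The discontinuous kernel suffices, since regularity comes
  from the translation estimate for f.\<close>

definition ball_integral :: "real \<Rightarrow> ('a::euclidean_space \<Rightarrow> real) \<Rightarrow> 'a \<Rightarrow> real" where
  "ball_integral d f x = (\<integral>y. indicator (ball 0 d) y * f (x + y) \<partial>lborel)"

lemma ball_integral_integrable: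
  assumes "C1c f g"
  shows "integrable lborel (\<lambda>y. indicator (ball 0 d) y * f (x + y))"
proof -
  have [measurable]: "f \<in> borel_measurable borel"
    by (intro borel_measurable_continuous_onI C1c_cont[OF assms])
  have "integrable lborel (\<lambda>y. f (x + y))"
    using lborel_shift(2)[of f x] C1c_integrable(1)[OF assms] by simp
  from integrable_mult_indicator[OF _ this, of "ball 0 d"] show ?thesis by simp
qed

text \<open>Moving the centre amounts to translating f, so the L^1 translation estimate applies.
  Dropping the indicator makes the constant independent of d.\<close>

lemma ball_integral_lipschitz:
  assumes fg: "C1c f g" and L: "(\<integral>x. norm (g x) \<partial>lborel) \<le> L"
  shows "\<bar>ball_integral d f x - ball_integral d f x'\<bar> \<le> norm (x - x') * L"
proof -
  have [measurable]: "f \<in> borel_measurable borel"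
    by (intro borel_measurable_continuous_onI C1c_cont[OF fg])
  note i = ball_integral_integrable[OF fg]
  have ii: "integrable lborel (\<lambda>y. \<bar>f (y + (x - x')) - f y\<bar>)"
    using lborel_shift(2)[of f "x - x'"] C1c_integrable(1)[OF fg] by (simp add: add.commute)
  have ii': "integrable lborel (\<lambda>y. \<bar>f (x + y) - f (x' + y)\<bar>)"
    using lborel_shift(2)[of f x] lborel_shift(2)[of f x'] C1c_integrable(1)[OF fg] by simp
  have "\<bar>ball_integral d f x - ball_integral d f x'\<bar>
      = \<bar>\<integral>y. indicator (ball 0 d) y * f (x + y) - indicator (ball 0 d) y * f (x' + y) \<partial>lborel\<bar>"
    unfolding ball_integral_def using i by simp
  also have "\<dots> \<le> (\<integral>y. \<bar>indicator (ball 0 d) y * f (x + y) - indicator (ball 0 d) y * f (x' + y)\<bar> \<partial>lborel)"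
    by (rule integral_abs_bound)
  also have "\<dots> \<le> (\<integral>y. \<bar>f (x + y) - f (x' + y)\<bar> \<partial>lborel)"
    using i ii' by (intro integral_mono) (auto simp: indicator_def)
  also have "\<dots> = (\<integral>y. \<bar>f (y + (x - x')) - f y\<bar> \<partial>lborel)"
    using lborel_shift(1)[of "\<lambda>y. \<bar>f (y + (x - x')) - f y\<bar>" x'] by (simp add: algebra_simps)
  also have "\<dots> \<le> norm (x - x') * (\<integral>x. norm (g x) \<partial>lborel)"
    by (rule integral_translate_diff_le[OF fg])
  also have "\<dots> \<le> norm (x - x') * L" by (intro mult_left_mono L) auto
  finally show ?thesis .
qed

text \<open>After exchanging the integrals, each y in the ball contributes a translation error of at
  most d L, and the volume of the ball counts the y.\<close>

lemma ball_integral_approx: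
  fixes f :: "'a::euclidean_space \<Rightarrow> real"
  assumes fg: "C1c f g" and L: "(\<integral>x. norm (g x) \<partial>lborel) \<le> L" and d: "d > 0"
  shows "(\<integral>\<^sup>+x. ennreal \<bar>ball_integral d f x - measure lborel (ball (0::'a) d) * f x\<bar> \<partial>lborel)
    \<le> ennreal (measure lborel (ball (0::'a) d) * (d * L))"
proof -
  define V where "V = measure lborel (ball (0::'a) d)"
  have eV: "emeasure lborel (ball (0::'a) d) = ennreal V"
    unfolding V_def by (intro emeasure_eq_ennreal_measure) (use emeasure_lborel_ball_finite[of
        "0::'a" d] in auto)
  have [measurable]: "f \<in> borel_measurable borel"
    by (intro borel_measurable_continuous_onI C1c_cont[OF fg])
  have L0: "L \<ge> 0" using L order_trans[OF _ L, of 0] by simp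
  have pt: "ennreal \<bar>ball_integral d f x - V * f x\<bar>
      \<le> (\<integral>\<^sup>+y. indicator (ball 0 d) y * ennreal \<bar>f (x + y) - f x\<bar> \<partial>lborel)" for x
  proof -
    have iB: "integrable lborel (\<lambda>y::'a. indicator (ball 0 d) y * f x)"
      using eV by (intro integrable_mult_left integrable_real_indicator) auto
    have "(\<integral>y. indicator (ball (0::'a) d) y * f x \<partial>lborel) = V * f x" by (simp add: V_def)
    from Bochner_Integration.integral_diff[OF ball_integral_integrable[OF fg] iB, unfolded this]
    have eq: "ball_integral d f x - V * f x
        = (\<integral>y. indicator (ball 0 d) y * f (x + y) - indicator (ball 0 d) y * f x \<partial>lborel)"
      unfolding ball_integral_def by (rule sym)
    have "ennreal (norm (ball_integral d f x - V * f x))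
        \<le> (\<integral>\<^sup>+y. norm (indicator (ball 0 d) y * f (x + y) - indicator (ball 0 d) y * f x) \<partial>lborel)"
      unfolding eq using ball_integral_integrable[OF fg] iB by (intro integral_norm_bound_ennreal) auto
    also have "\<dots> = (\<integral>\<^sup>+y. indicator (ball 0 d) y * ennreal \<bar>f (x + y) - f x\<bar> \<partial>lborel)"
      by (intro nn_integral_cong) (auto simp: indicator_def)
    finally show ?thesis by simp
  qed
  have "(\<integral>\<^sup>+x. ennreal \<bar>ball_integral d f x - V * f x\<bar> \<partial>lborel)
      \<le> (\<integral>\<^sup>+x. (\<integral>\<^sup>+y. indicator (ball 0 d) y * ennreal \<bar>f (x + y) - f x\<bar> \<partial>lborel) \<partial>lborel)"
    by (intro nn_integral_mono pt)
  also have "\<dots> = (\<integral>\<^sup>+y. (\<integral>\<^sup>+x. indicator (ball 0 d) y * ennreal \<bar>f (x + y) - f x\<bar> \<partial>lborel) \<partial>lborel)"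
  proof (rule lborel_pair.Fubini'[symmetric])
    have [measurable]: "ball (0::'a) d \<in> sets borel" by simp
    have [measurable]: "(\<lambda>p. ennreal \<bar>f (fst p + snd p) - f (fst p)\<bar>) \<in> borel_measurable borel"
      by (intro measurable_compose[OF _ measurable_ennreal] borel_measurable_continuous_onI
          continuous_intros continuous_on_compose2[OF C1c_cont[OF fg, of UNIV]]) auto
    have "(\<lambda>p. indicator (ball 0 d) (snd p) * ennreal \<bar>f (fst p + snd p)
        - f (fst p)\<bar>) \<in> borel_measurable borel"
      unfolding borel_prod[symmetric] by (measurable; simp add: borel_prod)
    then show "(\<lambda>(x, y). indicator (ball 0 d) y * ennreal \<bar>f (x + y) - f x\<bar>)
        \<in> borel_measurable (lborel \<Otimes>\<^sub>M lborel)"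
      by (simp add: case_prod_unfold lborel_prod)
  qed
  also have "\<dots> \<le> (\<integral>\<^sup>+y. indicator (ball (0::'a) d) y * ennreal (d * L) \<partial>lborel)"
  proof (rule nn_integral_mono)
    fix y :: 'a
    show "(\<integral>\<^sup>+x. indicator (ball 0 d) y * ennreal \<bar>f (x + y) - f x\<bar> \<partial>lborel)
        \<le> indicator (ball 0 d) y * ennreal (d * L)"
    proof (cases "y \<in> ball 0 d")
      case True
      have "integrable lborel (\<lambda>x. f (x + y))"
        using lborel_shift(2)[of f y] C1c_integrable(1)[OF fg] by (simp add: add.commute)
      then have "(\<integral>\<^sup>+x. ennreal \<bar>f (x + y) - f x\<bar> \<partial>lborel) = ennreal (\<integral>x. \<bar>f (x + y) - f x\<bar> \<partial>lborel)"
        using C1c_integrable(1)[OF fg] by (intro nn_integral_eq_integral) auto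
      also have "(\<integral>x. \<bar>f (x + y) - f x\<bar> \<partial>lborel) \<le> norm y * (\<integral>x. norm (g x) \<partial>lborel)"
        by (rule integral_translate_diff_le[OF fg])
      also have "\<dots> \<le> d * L" using True L L0 d by (intro mult_mono) auto
      finally show ?thesis using True by (simp add: ennreal_leI)
    qed simp
  qed
  also have "\<dots> = ennreal V * ennreal (d * L)"
    by (subst nn_integral_multc) (auto simp: eV intro!: borel_measurable_indicator)
  also have "\<dots> = ennreal (V * (d * L))" by (simp add: V_def ennreal_mult')
  finally show ?thesis by (simp add: V_def)
qed

lemma lipschitz_dense_convergent:
  fixes F :: "nat \<Rightarrow> 'a::euclidean_space \<Rightarrow> real"
  assumes lip: "\<And>n x y. \<bar>F n x - F n y\<bar> \<le> norm (x - y) * L"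
    and D: "\<And>X. open X \<Longrightarrow> X \<noteq> {} \<Longrightarrow> \<exists>d\<in>D. d \<in> (X :: 'a set)"
    and conv: "\<And>d. d \<in> D \<Longrightarrow> convergent (\<lambda>n. F n d)"
  shows "convergent (\<lambda>n. F n x)"
proof -
  have "Cauchy (\<lambda>n. F n x)"
  proof (rule metric_CauchyI)
    fix e :: real assume e: "e > 0"
    \<comment> \<open>The Lipschitz error on a ball of this radius is at most e / 3; adding 1 to |L|
      avoids a zero denominator.\<close>
    define \<delta> where "\<delta> = e / (3 * (\<bar>L\<bar> + 1))"
    have \<delta>: "\<delta> > 0" using e by (simp add: \<delta>_def add_nonneg_pos)
    obtain d where d: "d \<in> D" "d \<in> ball x \<delta>" using D[of "ball x \<delta>"] \<delta> by auto
    have c: "\<bar>F n x - F n d\<bar> \<le> e / 3" for n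
    proof -
      have "norm (x - d) * L \<le> \<delta> * (\<bar>L\<bar> + 1)"
        using d(2) \<delta> by (intro order_trans[OF mult_left_mono[of L "\<bar>L\<bar> + 1"] mult_right_mono])
          (auto simp: dist_norm)
      also have "\<dots> = e / 3" by (simp add: \<delta>_def field_simps)
      finally show ?thesis using lip[of n x d] by linarith
    qed
    obtain M where M: "\<And>m n. m \<ge> M \<Longrightarrow> n \<ge> M \<Longrightarrow> dist (F m d) (F n d) < e / 3"
      using metric_CauchyD[OF convergent_Cauchy[OF conv[OF d(1)]], of "e / 3"] e by auto
    have "dist (F m x) (F n x) < e" if "m \<ge> M" "n \<ge> M" for m n
      using M[OF that] c[of m] c[of n] unfolding dist_real_def by linarith
    then show "\<exists>M. \<forall>m\<ge>M. \<forall>n\<ge>M. dist (F m x) (F n x) < e" by blast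
  qed
  then show ?thesis by (simp add: Cauchy_convergent)
qed

text \<open>Averages over small balls are within \<open>O(\<delta>)\<close> of the functions in $L^1$, uniformly in the
  sequence, and for fixed \<open>\<delta>\<close> they are equi-Lipschitz; so it suffices to make all of them converge
  at the points of a countable dense set.\<close>

lemma rellich_L1:
  fixes \<phi> :: "nat \<Rightarrow> real^2 \<Rightarrow> real"
  assumes C: "\<And>n. C1c (\<phi> n) (g n)" and z: "\<And>n x. norm x \<ge> 1 \<Longrightarrow> \<phi> n x = 0"
    and L: "\<And>n. (\<integral>x. norm (g n x) \<partial>lborel) \<le> L"
  obtains k where "strict_mono (k :: nat \<Rightarrow> nat)"
    "\<And>e. e > 0 \<Longrightarrow> \<exists>N. \<forall>i\<ge>N. \<forall>j\<ge>N. (\<integral>x. \<bar>\<phi> (k i) x - \<phi> (k j) x\<bar> \<partial>lborel) < e"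
proof -
  have L0: "L \<ge> 0"
    using order_trans[OF _ L[of 0], of 0] by simp
  define \<delta> where "\<delta> j = 1 / real (Suc j)" for j
  have \<delta>: "\<delta> j > 0" "\<delta> j \<le> 1" for j by (simp_all add: \<delta>_def)
  define A where "A j n = ball_integral (\<delta> j) (\<phi> n)" for j n
  have lip: "\<bar>A j n x - A j n y\<bar> \<le> norm (x - y) * L" for j n x y
    unfolding A_def by (rule ball_integral_lipschitz[OF C L])
  have A0: "A j n x = 0" if "norm x \<ge> 2" for j n x
  proof -
    have "indicator (ball 0 (\<delta> j)) y * \<phi> n (x + y) = 0" for y
    proof (cases "y \<in> ball 0 (\<delta> j)")
      case True
      then have "norm (x + y) \<ge> 1" using norm_diff_ineq[of x y] that \<delta>(2)[of j] by auto
      then show ?thesis using z by simp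
    qed simp
    then have "ball_integral (\<delta> j) (\<phi> n) x = (\<integral>y. 0 \<partial>(lborel :: (real^2) measure))"
      unfolding ball_integral_def by (intro Bochner_Integration.integral_cong) auto
    then show ?thesis by (simp add: A_def)
  qed
  \<comment> \<open>A bound on the L^1 norm of the gradient gives no sup bound for the functions
    themselves. For the averages it does: measure the Lipschitz bound from a point of norm 2, where
    they vanish.\<close>
  have bd: "\<bar>A j n x\<bar> \<le> 4 * L" for j n x
  proof (cases "norm x \<ge> 2")
    case False
    define x0 :: "real^2" where "x0 = 2 *\<^sub>R axis 1 1"
    have n: "norm x0 = 2" by (simp add: x0_def)
    have "norm (x - x0) \<le> 4" using norm_triangle_ineq4[of x x0] False n by simp
    then have "norm (x - x0) * L \<le> 4 * L" using L0 by (intro mult_right_mono)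
    then show ?thesis using lip[of j n x x0] A0[of x0 j n] n by simp
  qed (use A0 L0 in auto)
  obtain D :: "(real^2) set" where D: "countable D" "\<And>X. open X \<Longrightarrow> X \<noteq> {} \<Longrightarrow> \<exists>d\<in>D. d \<in> X"
    by (rule countable_dense_setE) blast
  \<comment> \<open>Indexing by pairs of a radius and a dense point yields one subsequence good for
    all radii at once, in place of a further diagonal argument.\<close>
  have cD: "countable ((UNIV :: nat set) \<times> D)" using D(1) by auto
  obtain k :: "nat \<Rightarrow> nat" where k: "strict_mono k"
    "\<And>p. p \<in> UNIV \<times> D \<Longrightarrow> \<exists>l. (\<lambda>n. A (fst p) (k n) (snd p)) \<longlonglongrightarrow> l"
    by (rule function_convergent_subsequence[OF cD, of "\<lambda>n p. A (fst p) n (snd p)" "4 * L"])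
      (use bd in auto)
  have conv: "convergent (\<lambda>n. A j (k n) x)" for j x
  proof (rule lipschitz_dense_convergent[OF _ D(2)])
    show "convergent (\<lambda>n. A j (k n) d)" if "d \<in> D" for d
      using k(2)[of "(j, d)"] that by (auto simp: convergent_def)
  qed (use lip in auto)
  define p where "p j x = lim (\<lambda>n. A j (k n) x)" for j x
  have p: "(\<lambda>n. A j (k n) x) \<longlonglongrightarrow> p j x" for j x
    unfolding p_def using conv by (simp add: convergent_LIMSEQ_iff)
  have Acont: "continuous_on UNIV (A j n)" for j n
  proof (rule continuous_onI)
    fix x :: "real^2" and e :: real assume e: "e > 0"
    show "\<exists>d>0. \<forall>x'\<in>UNIV. dist x' x < d \<longrightarrow> dist (A j n x') (A j n x) \<le> e"
    proof (intro exI conjI ballI impI)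
      show "e / (L + 1) > 0" using e L0 by simp
      fix x' assume "dist x' x < e / (L + 1)"
      then have "norm (x' - x) * L \<le> e / (L + 1) * (L + 1)"
        using L0 e by (intro mult_mono) (auto simp: dist_norm)
      then show "dist (A j n x') (A j n x) \<le> e"
        using lip[of j n x' x] L0 by (simp add: dist_real_def)
    qed
  qed
  have [measurable]: "A j n \<in> borel_measurable borel" for j n
    by (intro borel_measurable_continuous_onI Acont)
  have pm[measurable]: "p j \<in> borel_measurable borel" for j
    by (rule borel_measurable_LIMSEQ_real[OF p]) measurable
  have p0: "p j x = 0" if "norm x \<ge> 2" for j x
    using p[of j x] that by (simp add: A0 LIMSEQ_const_iff)
  have pb: "\<bar>p j x\<bar> \<le> 4 * L" for j x
    by (rule LIMSEQ_le_const2[OF tendsto_rabs[OF p]]) (use bd in auto)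
  \<comment> \<open>The dominating function: averages and their limits are at most 4 L in absolute
    value and vanish at points of norm at least 2.\<close>
  have iW: "integrable lborel (\<lambda>x::real^2. 8 * L * indicator (cball 0 2) x)"
    using emeasure_lborel_cball_finite[of "0::real^2" 2]
    by (intro integrable_mult_right integrable_real_indicator) auto
  have dom: "\<bar>A j n x - p j x\<bar> \<le> 8 * L * indicator (cball 0 2) x" for j n x
    using bd[of j n x] pb[of j x] A0[of x j n] p0[of x j] by (auto simp: indicator_def)
  have iAp: "integrable lborel (\<lambda>x. \<bar>A j n x - p j x\<bar>)" for j n
  proof (rule Bochner_Integration.integrable_bound[OF iW])
    show "AE x in lborel. norm \<bar>A j n x - p j x\<bar> \<le> norm (8 * L * indicator (cball 0 2) x)"
      using order_trans[OF dom abs_ge_self] by (intro AE_I2) simp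
  qed measurable
  have DCT: "(\<lambda>n. \<integral>x. \<bar>A j (k n) x - p j x\<bar> \<partial>lborel) \<longlonglongrightarrow> (\<integral>x. 0 \<partial>(lborel :: (real^2) measure))" for j
  proof (rule integral_dominated_convergence[OF _ _ iW])
    show "AE x in lborel. (\<lambda>n. \<bar>A j (k n) x - p j x\<bar>) \<longlonglongrightarrow> 0"
      using p by (intro AE_I2 tendsto_rabs_zero) (simp add: LIM_zero_iff)
    show "AE x in lborel. norm \<bar>A j (k n) x - p j x\<bar> \<le> 8 * L * indicator (cball 0 2) x" for n
      using dom by (intro AE_I2) simp
  qed auto
  have cau: "\<exists>N. \<forall>i\<ge>N. \<forall>j\<ge>N. (\<integral>x. \<bar>\<phi> (k i) x - \<phi> (k j) x\<bar> \<partial>lborel) < e" if e: "e > 0" for e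
  proof -
    \<comment> \<open>The error budget is four quarters of e, each scaled by the volume V since
      \<open>ball_integral\<close> is not normalised: two averaging errors and two distances to the
      pointwise limit.\<close>
    obtain j where j: "\<delta> j * L < e / 4"
    proof -
      have "(\<lambda>j. \<delta> j * L) \<longlonglongrightarrow> 0 * L"
        unfolding \<delta>_def by (intro tendsto_mult tendsto_const lim_inverse_n'[THEN LIMSEQ_Suc])
      then have "(\<lambda>j. \<delta> j * L) \<longlonglongrightarrow> 0" by simp
      from order_tendstoD(2)[OF this, of "e / 4"] e have "\<forall>\<^sub>F j in sequentially. \<delta> j * L < e / 4" by simp
      then show ?thesis using that by (auto simp: eventually_sequentially)
    qed
    define V where "V = measure lborel (ball (0::real^2) (\<delta> j))"
    have V: "V > 0" unfolding V_def using \<delta>(1)[of j] by simp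
    note i\<phi> = C1c_integrable(1)[OF C]
    have iA: "integrable lborel (A j n)" for n
      by (rule integrable_lborel_cont_bounded_support[OF Acont, of 2]) (use A0 in auto)
    have apx: "(\<integral>x. \<bar>A j n x - V * \<phi> n x\<bar> \<partial>lborel) \<le> V * (\<delta> j * L)" for n
    proof -
      have "integrable lborel (\<lambda>x. \<bar>A j n x - V * \<phi> n x\<bar>)" using iA i\<phi> by auto
      then have "ennreal (\<integral>x. \<bar>A j n x - V * \<phi> n x\<bar> \<partial>lborel)
          = (\<integral>\<^sup>+x. ennreal \<bar>A j n x - V * \<phi> n x\<bar> \<partial>lborel)"
        by (intro nn_integral_eq_integral[symmetric]) auto
      also have "\<dots> \<le> ennreal (V * (\<delta> j * L))"
        unfolding A_def V_def by (rule ball_integral_approx[OF C L \<delta>(1)])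
      finally show ?thesis using V \<delta>(1)[of j] L0 by (subst (asm) ennreal_le_iff) auto
    qed
    have "V * e / 4 > 0" using V e by simp
    from order_tendstoD(2)[OF DCT[of j], of "V * e / 4"] this
    obtain N where N: "\<And>n. n \<ge> N \<Longrightarrow> (\<integral>x. \<bar>A j (k n) x - p j x\<bar> \<partial>lborel) < V * e / 4"
      by (auto simp: eventually_sequentially)
    have "(\<integral>x. \<bar>\<phi> (k m) x - \<phi> (k n) x\<bar> \<partial>lborel) < e" if mn: "m \<ge> N" "n \<ge> N" for m n
    proof -
      have "V * (\<integral>x. \<bar>\<phi> (k m) x - \<phi> (k n) x\<bar> \<partial>lborel) = (\<integral>x. V * \<bar>\<phi> (k m) x - \<phi> (k n) x\<bar> \<partial>lborel)"
        by simp
      also have "\<dots> \<le> (\<integral>x. \<bar>A j (k m) x - V * \<phi> (k m) x\<bar> + \<bar>A j (k n) x - V * \<phi> (k n) x\<bar>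
          + \<bar>A j (k m) x - p j x\<bar> + \<bar>A j (k n) x - p j x\<bar> \<partial>lborel)"
      proof (rule integral_mono)
        fix x
        have "V * \<bar>\<phi> (k m) x - \<phi> (k n) x\<bar> = \<bar>V * \<phi> (k m) x - V * \<phi> (k n) x\<bar>"
          using V by (simp add: abs_mult flip: right_diff_distrib)
        then show "V * \<bar>\<phi> (k m) x - \<phi> (k n) x\<bar> \<le> \<bar>A j (k m) x - V * \<phi> (k m) x\<bar>
          + \<bar>A j (k n) x - V * \<phi> (k n) x\<bar> + \<bar>A j (k m) x - p j x\<bar> + \<bar>A j (k n) x - p j x\<bar>" by linarith
      qed (use iA i\<phi> iAp in auto)
      also have "\<dots> = (\<integral>x. \<bar>A j (k m) x - V * \<phi> (k m) x\<bar> \<partial>lborel) + (\<integral>x. \<bar>A j (k n) x - V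
          * \<phi> (k n) x\<bar> \<partial>lborel)
          + (\<integral>x. \<bar>A j (k m) x - p j x\<bar> \<partial>lborel) + (\<integral>x. \<bar>A j (k n) x - p j x\<bar> \<partial>lborel)"
        using iA i\<phi> iAp by simp
      also have "\<dots> < V * (\<delta> j * L) + V * (\<delta> j * L) + V * e / 4 + V * e / 4"
        using apx[of "k m"] apx[of "k n"] N[OF mn(1)] N[OF mn(2)] by linarith
      also have "\<dots> \<le> V * (e / 4) + V * (e / 4) + V * e / 4 + V * e / 4"
        using V j by (intro add_mono mult_left_mono) auto
      finally show ?thesis using V by simp
    qed
    then show ?thesis by blast
  qed
  show ?thesis by (rule that[OF k(1) cau])
qed

section \<open>Compactness on the orthogonal complement of the radial functions\<close>

lemma Lp_norm_tendsto_0I: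
  fixes h :: "nat \<Rightarrow> 'a \<Rightarrow> real"
  assumes m: "\<And>n. h n \<in> borel_measurable M" and q: "q > 0"
    and le: "\<And>e. e > 0 \<Longrightarrow> \<forall>\<^sub>F n in sequentially. powr_mass M q (h n) \<le> ennreal e"
  shows "(\<lambda>n. Lp_norm M q (h n)) \<longlonglongrightarrow> 0"
  unfolding Lp_norm_tendsto_0_iff[OF q]
proof (rule order_tendstoI)
  fix e :: real assume "e > 0"
  then have "\<forall>\<^sub>F n in sequentially. powr_mass M q (h n) \<le> ennreal (e / 2)"
    by (intro le) simp
  then show "\<forall>\<^sub>F n in sequentially. (\<integral>x. norm (h n x) powr q \<partial>M) < e"
  proof eventually_elim
    case (elim n)
    have "(\<integral>x. norm (h n x) powr q \<partial>M) \<le> e / 2"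
      by (rule Lp_space_of_nn_integral_le(2)[OF m q]) (use elim \<open>e > 0\<close> in auto)
    then show ?case using \<open>e > 0\<close> by simp
  qed
next
  fix e :: real assume "e < 0"
  then show "\<forall>\<^sub>F n in sequentially. e < (\<integral>x. norm (h n x) powr q \<partial>M)"
    by (intro always_eventually allI less_le_trans[OF \<open>e < 0\<close>] Bochner_Integration.integral_nonneg) simp
qed

text \<open>On the disc a norm is at most 1 plus its square, and outside it the gradient vanishes.
  This turns an energy bound into the L^1 bound that Rellich's theorem asks for.\<close>

lemma gradient_L1_le:
  assumes "\<phi> \<in> test_functions disc"
  shows "(\<integral>x. norm (gradient \<phi> x) \<partial>lborel) \<le> measure lborel disc + energy lborel (gradient \<phi>)"
proof -
  note i = C1c_integrable[OF test_function_C1c[OF assms]]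
  note iD = integrable_indicator_disc
  have "(\<integral>x. norm (gradient \<phi> x) \<partial>lborel) \<le> (\<integral>x. indicator disc x + (norm (gradient \<phi> x))\<^sup>2 \<partial>lborel)"
  proof (rule integral_mono)
    fix x
    show "norm (gradient \<phi> x) \<le> indicator disc x + (norm (gradient \<phi> x))\<^sup>2"
    proof (cases "x \<in> disc")
      case True
      have "2 * norm (gradient \<phi> x) * 1 \<le> (norm (gradient \<phi> x))\<^sup>2 + 1\<^sup>2" by (rule sum_squares_bound)
      then have "norm (gradient \<phi> x) \<le> 1 + (norm (gradient \<phi> x))\<^sup>2"
        using norm_ge_zero[of "gradient \<phi> x"] by (simp only: power_one mult_1_right)
      then show ?thesis using True by simp
    qed (use test_function_zero[OF assms] in simp)
  qed (use i iD in auto)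
  then show ?thesis using i iD by simp
qed

lemma AE_log_measure_lborelI:
  assumes "AE x in lborel. P x"
  shows "AE x in log_measure a q. P x"
  by (intro AE_log_measureI, subst AE_restrict_space_iff) (use AE_completion[OF assms] in auto)

text \<open>The mean-zero estimates concern genuine C1 functions, so u is replaced by one at
  arbitrarily small weighted cost. The strict inequality \<open>H01_norm u < K\<close> leaves room
  for the energy of the approximant.\<close>

lemma rad_perp_close_test_function:
  assumes a: "a > 1" and q: "q \<ge> 2" and u: "u \<in> H01_rad_perp" and K: "H01_norm u < K" and e: "e > 0"
  obtains \<psi> where "\<psi> \<in> test_functions disc" "\<And>x. avg \<psi> x = 0"
    "energy lborel (gradient \<psi>) \<le> K\<^sup>2"
    "powr_mass (log_measure a q) q (\<lambda>x. u x - \<psi> x) \<le> ennreal e"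
proof -
  obtain C where C: "C \<ge> 0" "\<And>u g. has_H01_gradient u g \<Longrightarrow>
     powr_mass (log_measure a q) q u
       \<le> ennreal (C * sqrt (energy disc_measure g) powr q)"
    using H01_weighted_inequality[OF a q] by blast
  define g where "g = weak_gradient u"
  have w: "has_H01_gradient u g"
    unfolding g_def using u by (intro weak_gradient) (simp add: H01_rad_perp_def)
  obtain \<psi> where p: "\<And>n. \<psi> n \<in> test_functions disc" "\<And>n x. avg (\<psi> n) x = 0"
    "L2_to disc_measure (\<lambda>n. gradient (\<psi> n)) g"
    by (rule rad_perp_approximation[OF u, folded g_def]) (rule that)
  have G: "energy disc_measure g = (H01_norm u)\<^sup>2" "H01_norm u \<ge> 0"
    by (simp_all add: H01_norm_eq[OF w])
  have "(H01_norm u)\<^sup>2 < K\<^sup>2" using K G(2) by (intro power_strict_mono) auto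
  then have "\<forall>\<^sub>F n in sequentially. energy disc_measure (gradient (\<psi> n)) < K\<^sup>2"
    using order_tendstoD(2)[OF L2_to_norm[OF p(3)]] G by simp
  moreover have "\<forall>\<^sub>F n in sequentially. C * sqrt (energy disc_measure (\<lambda>x. gradient (\<psi> n) x
      - g x)) powr q < e"
  proof -
    have "(\<lambda>n. \<integral>x. (norm (gradient (\<psi> n) x - g x))\<^sup>2 \<partial>disc_measure) \<longlonglongrightarrow> 0"
      using p(3) by (simp add: L2_to_def)
    from tendsto_real_sqrt[OF this]
    have "(\<lambda>n. sqrt (energy disc_measure (\<lambda>x. gradient (\<psi> n) x - g x))) \<longlonglongrightarrow> 0" by simp
    then have "(\<lambda>n. sqrt (energy disc_measure (\<lambda>x. gradient (\<psi> n) x - g x)) powr q) \<longlonglongrightarrow> 0"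
      by (rule tendsto_zero_powrI[OF _ tendsto_const]) (use q in auto)
    from order_tendstoD(2)[OF tendsto_mult_right_zero[OF this, of C] e] show ?thesis .
  qed
  ultimately have "\<forall>\<^sub>F n in sequentially. energy disc_measure (gradient (\<psi> n)) < K\<^sup>2 \<and>
     C * sqrt (energy disc_measure (\<lambda>x. gradient (\<psi> n) x - g x)) powr q < e"
    by (rule eventually_conj)
  then obtain n where n: "energy disc_measure (gradient (\<psi> n)) < K\<^sup>2"
     "C * sqrt (energy disc_measure (\<lambda>x. gradient (\<psi> n) x - g x)) powr q < e"
    using eventually_happens'[OF sequentially_bot] by blast
  have "powr_mass (log_measure a q) q (\<lambda>x. u x - \<psi> n x)
      \<le> ennreal (C * sqrt (energy disc_measure (\<lambda>x. g x - gradient (\<psi> n) x)) powr q)"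
    by (rule C(2)[OF has_H01_gradient_diff[OF w has_H01_gradient_test[OF p(1)]]])
  also have "\<dots> \<le> ennreal e"
    using n(2) by (intro ennreal_leI) (simp add: norm_minus_commute)
  finally show ?thesis
    by (rule that[OF p(1,2) less_imp_le[OF n(1)[unfolded energy_disc_measure[OF p(1)]]]])
qed

text \<open>Each \<open>u n\<close> is replaced by a mean-zero test function within 1 / (n + 1) in
  weighted mass. Rellich's theorem makes a subsequence Cauchy in L^1, and the Ehrling-type
  inequality, applied to differences of bounded energy, upgrades this to the weighted space.\<close>

lemma rad_perp_compact_embedding:
  assumes a: "a > 1" and q: "q \<ge> 2"
  shows "compact_embedding H01_rad_perp H01_norm (Lp_space (log_measure a q) q) (Lp_norm (log_measure a q) q)"
  unfolding compact_embedding_def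
proof (intro conjI allI impI)
  define M where "M = log_measure a q"
  have q0: "q > 0" using q by simp
  show "continuous_embedding H01_rad_perp H01_norm (Lp_space (log_measure a q) q) (Lp_norm (log_measure a q) q)"
    by (rule continuous_embedding_subset[OF H01_continuous_embedding[OF a q]])
       (auto simp: H01_rad_perp_def)
  fix u :: "nat \<Rightarrow> real^2 \<Rightarrow> real"
  assume "(\<forall>n. u n \<in> H01_rad_perp) \<and> bounded (range (\<lambda>n. H01_norm (u n)))"
  then have u: "\<And>n. u n \<in> H01_rad_perp" and bu: "bounded (range (\<lambda>n. H01_norm (u n)))" by auto
  obtain K0 where K0: "\<And>n. \<bar>H01_norm (u n)\<bar> \<le> K0"
    using bu unfolding bounded_iff by auto
  define K where "K = K0 + 1"
  have K: "H01_norm (u n) < K" for n using K0[of n] by (simp add: K_def)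
  have uH: "u n \<in> H01" for n using u by (simp add: H01_rad_perp_def)
  have um[measurable]: "u n \<in> borel_measurable M" for n
    unfolding M_def using H01_measurable[OF uH] by simp
  define P where "P n \<psi> \<longleftrightarrow> \<psi> \<in> test_functions disc \<and> (\<forall>x. avg \<psi> x = 0) \<and>
    energy lborel (gradient \<psi>) \<le> K\<^sup>2 \<and>
    powr_mass M q (\<lambda>x. u n x - \<psi> x) \<le> ennreal (1 / real (Suc n))" for n \<psi>
  have "\<exists>\<psi>. P n \<psi>" for n
  proof -
    have "1 / real (Suc n) > 0" by simp
    obtain \<psi> where "\<psi> \<in> test_functions disc" "\<And>x. avg \<psi> x = 0"
      "energy lborel (gradient \<psi>) \<le> K\<^sup>2"
      "powr_mass M q (\<lambda>x. u n x - \<psi> x) \<le> ennreal (1 / real (Suc n))"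
      by (rule rad_perp_close_test_function[OF a q u K \<open>1 / real (Suc n) > 0\<close>, folded M_def]) (rule that)
    then have "P n \<psi>" unfolding P_def by blast
    then show ?thesis by blast
  qed
  then obtain \<psi> where "\<And>n. P n (\<psi> n)" by metis
  then have psi: "\<And>n. \<psi> n \<in> test_functions disc" "\<And>n x. avg (\<psi> n) x = 0"
    "\<And>n. (energy lborel (gradient (\<psi> n))) \<le> K\<^sup>2"
    "\<And>n. (powr_mass M q (\<lambda>x. u n x - \<psi> n x)) \<le> ennreal (1 / real (Suc n))"
    unfolding P_def by blast+
  note C = test_function_C1c[OF psi(1)]
  have pm[measurable]: "\<psi> n \<in> borel_measurable borel" for n by (rule test_function_measurable[OF psi(1)])
  have pM[measurable]: "\<psi> n \<in> borel_measurable M" for n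
    unfolding M_def using borel_measurable_disc_measure[OF pm] by simp
  define L where "L = measure lborel disc + K\<^sup>2"
  have L: "(\<integral>x. norm (gradient (\<psi> n) x) \<partial>lborel) \<le> L" for n
    using gradient_L1_le[OF psi(1)[of n]] psi(3)[of n] by (simp add: L_def)
  have z: "\<psi> n x = 0" if "norm x \<ge> 1" for n x using test_function_zero[OF psi(1)] that by simp
  obtain k where k: "strict_mono (k :: nat \<Rightarrow> nat)"
    "\<And>e. e > 0 \<Longrightarrow> \<exists>N. \<forall>i\<ge>N. \<forall>j\<ge>N. (\<integral>x. \<bar>\<psi> (k i) x - \<psi> (k j) x\<bar> \<partial>lborel) < e"
  proof (rule rellich_L1[where \<phi> = \<psi> and g = "\<lambda>n. gradient (\<psi> n)" and L = L])
    show "C1c (\<psi> n) (gradient (\<psi> n))" for n by (rule C)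
    show "\<psi> n x = 0" if "norm x \<ge> 1" for n x by (rule z[OF that])
    show "(\<integral>x. norm (gradient (\<psi> n) x) \<partial>lborel) \<le> L" for n by (rule L)
  qed (rule that)
  obtain r where r: "strict_mono (r :: nat \<Rightarrow> nat)" "AE x in lborel. Cauchy (\<lambda>i. \<psi> (k (r i)) x)"
  proof (rule cauchy_L1_AE_cauchy_subseq)
    show "integrable lborel (\<psi> (k i))" for i by (rule C1c_integrable(1)[OF C])
    show "\<exists>N. \<forall>i\<ge>N. \<forall>j\<ge>N. (\<integral>x. norm (\<psi> (k i) x - \<psi> (k j) x) \<partial>lborel) < e" if "e > 0" for e
      using k(2)[OF that] by simp
  qed (rule that)
  define s where "s = (\<lambda>i. k (r i))"
  have s: "strict_mono s" using strict_mono_compose[OF k(1) r(1)] by (simp add: s_def)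
  \<comment> \<open>The limit is taken pointwise; Fatou's lemma then turns the Cauchy estimate into
    convergence to v, in place of completeness of the target space.\<close>
  define v where "v = (\<lambda>x. lim (\<lambda>i. \<psi> (s i) x))"
  have vb[measurable]: "v \<in> borel_measurable borel" unfolding v_def
      by (rule borel_measurable_lim_metric) measurable
  have vM[measurable]: "v \<in> borel_measurable M"
    unfolding M_def using borel_measurable_disc_measure[OF vb] by simp
  have lim: "AE x in M. (\<lambda>i. \<psi> (s i) x) \<longlonglongrightarrow> v x"
    unfolding M_def
  proof (rule AE_log_measure_lborelI)
    show "AE x in lborel. (\<lambda>i. \<psi> (s i) x) \<longlonglongrightarrow> v x"
      using r(2)
    proof eventually_elim
      case (elim x)
      then show ?case unfolding v_def s_def by (simp add: Cauchy_convergent_iff convergent_LIMSEQ_iff)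
    qed
  qed
  \<comment> \<open>Differences have energy at most 4 K^2, the common level at which the
    Ehrling-type inequality is invoked below.\<close>
  have energy: "energy lborel (gradient (\<lambda>x. \<psi> i x - \<psi> j x)) \<le> (2 * K)\<^sup>2" for i j
  proof -
    have "energy lborel (gradient (\<lambda>x. \<psi> i x - \<psi> j x))
      \<le> (\<integral>x. 2 * (norm (gradient (\<psi> i) x))\<^sup>2 + 2 * (norm (gradient (\<psi> j) x))\<^sup>2 \<partial>lborel)"
      using C1c_integrable(4)[OF C] C1c_integrable(4)[OF C1c_diff[OF C C]]
      by (intro integral_mono) (auto simp: gradient_diff[OF psi(1) psi(1)] norm_sq_diff_le)
    also have "\<dots> \<le> 2 * K\<^sup>2 + 2 * K\<^sup>2"
      using C1c_integrable(4)[OF C] psi(3)[of i] psi(3)[of j] by simp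
    finally show ?thesis by (simp add: power_mult_distrib)
  qed
  have close: "\<forall>\<^sub>F i in sequentially. powr_mass M q (\<lambda>x. \<psi> (s i) x - v x) \<le> ennreal e"
    if e: "e > 0" for e
  proof -
    have e2: "e / 2 > 0" using e by simp
    obtain B where B: "B \<ge> 0" "\<And>f g. C1c f g \<Longrightarrow> (\<And>x. avg f x = 0) \<Longrightarrow>
       energy lborel g \<le> (2 * K)\<^sup>2 \<Longrightarrow>
       powr_mass M q f \<le> ennreal (B * (\<integral>x. \<bar>f x\<bar> \<partial>lborel) + e / 2)"
      by (rule mean_zero_weighted_le[OF a q e2, folded M_def]) (rule that; fast)
    \<comment> \<open>B may be 0, hence B + 1; with this threshold the L^1 term contributes at most
      e / 2.\<close>
    have "e / (2 * (B + 1)) > 0" using e B(1) by simp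
    from k(2)[OF this] obtain N where N: "\<And>i j. i \<ge> N \<Longrightarrow> j \<ge> N \<Longrightarrow>
      (\<integral>x. \<bar>\<psi> (k i) x - \<psi> (k j) x\<bar> \<partial>lborel) < e / (2 * (B + 1))" by blast
    have ij: "powr_mass M q (\<lambda>x. \<psi> (s i) x - \<psi> (s j) x) \<le> ennreal e"
      if "i \<ge> N" "j \<ge> N" for i j
    proof -
      have "r i \<ge> N" "r j \<ge> N" using that seq_suble[OF r(1)] by (meson order_trans)+
      then have "(\<integral>x. \<bar>\<psi> (s i) x - \<psi> (s j) x\<bar> \<partial>lborel) \<le> e / (2 * (B + 1))"
        unfolding s_def using N by (simp add: less_imp_le)
      then have "B * (\<integral>x. \<bar>\<psi> (s i) x - \<psi> (s j) x\<bar> \<partial>lborel) \<le> (B + 1) * (e / (2 * (B + 1)))"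
        using B(1) by (intro mult_mono) auto
      also have "\<dots> = e / 2" using B(1) by (simp add: divide_simps)
      finally have le: "B * (\<integral>x. \<bar>\<psi> (s i) x - \<psi> (s j) x\<bar> \<partial>lborel) + e / 2 \<le> e" by simp
      have "powr_mass M q (\<lambda>x. \<psi> (s i) x - \<psi> (s j) x)
        \<le> ennreal (B * (\<integral>x. \<bar>\<psi> (s i) x - \<psi> (s j) x\<bar> \<partial>lborel) + e / 2)"
        by (rule B(2)[OF test_function_C1c[OF test_function_diff[OF psi(1) psi(1)]] _ energy])
           (simp add: avg_diff[OF C1c_cont[OF C] C1c_cont[OF C]] psi(2))
      also have "\<dots> \<le> ennreal e" by (rule ennreal_leI[OF le])
      finally show ?thesis .
    qed
    show ?thesis
    proof (rule eventually_sequentiallyI)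
      fix i assume i: "i \<ge> N"
      show "powr_mass M q (\<lambda>x. \<psi> (s i) x - v x) \<le> ennreal e"
      proof (rule nn_integral_powr_Fatou[OF _ _ q0])
        show "(\<lambda>x. \<psi> (s i) x - \<psi> (s j) x) \<in> borel_measurable M" for j by measurable
        show "AE x in M. (\<lambda>j. \<psi> (s i) x - \<psi> (s j) x) \<longlonglongrightarrow> \<psi> (s i) x - v x"
          using lim by eventually_elim (intro tendsto_diff tendsto_const)
        show "\<forall>\<^sub>F j in sequentially. powr_mass M q (\<lambda>x. \<psi> (s i) x - \<psi> (s j) x) \<le> ennreal e"
          using ij i by (intro eventually_sequentiallyI[of N])
      qed
    qed
  qed
  have ul: "(\<lambda>i. Lp_norm M q (\<lambda>x. u (s i) x - v x)) \<longlonglongrightarrow> 0"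
  proof (rule Lp_norm_tendsto_0I[OF _ q0])
    show "(\<lambda>x. u (s i) x - v x) \<in> borel_measurable M" for i by measurable
    fix e :: real assume e: "e > 0"
    \<comment> \<open>Two errors of size d, multiplied by 2^q from the quasi-triangle inequality,
      add up to exactly e.\<close>
    define d where "d = e / (2 * 2 powr q)"
    have d: "d > 0" using e by (simp add: d_def)
    obtain N :: nat where N: "N > 0" "1 / real N < d"
      using d by (metis nat_approx_posE of_nat_0_less_iff zero_less_Suc)
    have "\<forall>\<^sub>F i in sequentially. i \<ge> N" by (rule eventually_ge_at_top)
    with close[OF d] show "\<forall>\<^sub>F i in sequentially. powr_mass M q (\<lambda>x. u (s i) x - v x) \<le> ennreal e"
    proof eventually_elim
      case (elim i)
      have "1 / real (Suc (s i)) \<le> 1 / real N"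
        using elim(2) seq_suble[OF s, of i] N(1) by (intro divide_left_mono) auto
      then have dd: "ennreal (1 / real (Suc (s i))) \<le> ennreal d" using N(2) by (intro ennreal_leI) simp
      have "powr_mass M q (\<lambda>x. u (s i) x - v x)
          = powr_mass M q (\<lambda>x. (u (s i) x - \<psi> (s i) x) + (\<psi> (s i) x - v x))" by simp
      also have "\<dots> \<le> ennreal (2 powr q) * (powr_mass M q (\<lambda>x. u (s i) x - \<psi> (s i) x)
          + powr_mass M q (\<lambda>x. \<psi> (s i) x - v x))"
        using q by (intro nn_integral_powr_add_le) auto
      also have "\<dots> \<le> ennreal (2 powr q) * (ennreal d + ennreal d)"
        by (intro mult_left_mono add_mono elim(1) order_trans[OF psi(4) dd]) auto
      also have "\<dots> = ennreal (2 powr q * (d + d))"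
        unfolding ennreal_mult'[OF powr_ge_zero] using d by (subst ennreal_plus) auto
      also have "2 powr q * (d + d) = e" by (simp add: d_def)
      finally show ?case .
    qed
  qed
  \<comment> \<open>v is at finite weighted distance from a test function, whose own mass is finite
    by the weighted inequality.\<close>
  have vY: "v \<in> Lp_space M q"
  proof -
    obtain i where i: "powr_mass M q (\<lambda>x. \<psi> (s i) x - v x) \<le> ennreal 1"
      using eventually_happens[OF close[of 1]] by auto
    obtain B where B: "B \<ge> 0" "powr_mass M q (\<lambda>x. \<psi> (s i) x) \<le> ennreal B"
      using H01_weighted_inequality[OF a q] has_H01_gradient_test[OF psi(1)] unfolding M_def
      by (metis mult_nonneg_nonneg powr_ge_zero)
    have "(\<integral>\<^sup>+x. ennreal (norm (v x) powr q) \<partial>M)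
        = powr_mass M q (\<lambda>x. (v x - \<psi> (s i) x) + \<psi> (s i) x)" by simp
    also have "\<dots> \<le> ennreal (2 powr q) * (powr_mass M q (\<lambda>x. v x - \<psi> (s i) x)
          + powr_mass M q (\<lambda>x. \<psi> (s i) x))"
      using q by (intro nn_integral_powr_add_le) auto
    also have "\<dots> \<le> ennreal (2 powr q) * (ennreal 1 + ennreal B)"
      using i B by (intro mult_left_mono add_mono) (auto simp: abs_minus_commute)
    also have "\<dots> = ennreal (2 powr q * (1 + B))" 
      unfolding ennreal_mult'[OF powr_ge_zero] using B by (subst ennreal_plus) auto
    finally show ?thesis by (rule Lp_space_of_nn_integral_le(1)[OF vM q0, rotated]) (use B in auto)
  qed
  show "\<exists>r. strict_mono r \<and> (\<exists>v\<in>Lp_space (log_measure a q) q.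
      (\<lambda>n. Lp_norm (log_measure a q) q (\<lambda>x. u (r n) x - v x)) \<longlonglongrightarrow> 0)"
    using s vY ul unfolding M_def by blast
qed

section \<open>A criterion for non-compactness\<close>

lemma Lp_space_diff:
  fixes f h :: "'a \<Rightarrow> real"
  assumes "f \<in> Lp_space M q" "h \<in> Lp_space M q" "q > 0"
  shows "(\<lambda>x. f x - h x) \<in> Lp_space M q"
proof -
  have [measurable]: "f \<in> borel_measurable M" "h \<in> borel_measurable M" using assms
      by (auto simp: Lp_space_def)
  have i: "integrable M (\<lambda>x. \<bar>f x\<bar> powr q)" "integrable M (\<lambda>x. \<bar>h x\<bar> powr q)"
    using assms by (auto simp: Lp_space_def)
  have "integrable M (\<lambda>x. \<bar>f x - h x\<bar> powr q)"
  proof (rule Bochner_Integration.integrable_bound)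
    show "integrable M (\<lambda>x. 2 powr q * (\<bar>f x\<bar> powr q + \<bar>h x\<bar> powr q))" using i by auto
    show "AE x in M. norm (\<bar>f x - h x\<bar> powr q) \<le> norm (2 powr q * (\<bar>f x\<bar> powr q + \<bar>h x\<bar> powr q))"
      using abs_add_powr_le[of q "f _" "- h _"] assms(3) by (intro AE_I2) simp
  qed measurable
  then show ?thesis by (simp add: Lp_space_def)
qed

text \<open>Fatou's lemma forces any limit of a subsequence to vanish, which contradicts the lower bound
  on the norms.\<close>

lemma not_compact_embedding_of_vanishing:
  fixes u :: "nat \<Rightarrow> 'a \<Rightarrow> real"
  assumes u: "\<And>n. u n \<in> X" "\<And>n. \<bar>nX (u n)\<bar> \<le> B" and XY: "X \<subseteq> Lp_space M q" and q: "q > 0"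
    and z: "AE x in M. (\<lambda>n. u n x) \<longlonglongrightarrow> 0" and c: "c > 0"
    and lower: "\<And>n. ennreal c \<le> powr_mass M q (u n)"
  shows "\<not> compact_embedding X nX (Lp_space M q) (Lp_norm M q)"
proof
  assume comp: "compact_embedding X nX (Lp_space M q) (Lp_norm M q)"
  have "bounded (range (\<lambda>n. nX (u n)))"
    unfolding bounded_iff using u(2) by auto
  then obtain r v where r: "strict_mono (r :: nat \<Rightarrow> nat)" and v: "v \<in> Lp_space M q"
    and lim: "(\<lambda>n. Lp_norm M q (\<lambda>x. u (r n) x - v x)) \<longlonglongrightarrow> 0"
    using comp u(1) unfolding compact_embedding_def by blast
  have uY: "u n \<in> Lp_space M q" for n using u(1) XY by blast
  have [measurable]: "v \<in> borel_measurable M" "u n \<in> borel_measurable M" for n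
    using v uY by (auto simp: Lp_space_def)
  have small: "\<forall>\<^sub>F n in sequentially. powr_mass M q (\<lambda>x. u (r n) x - v x) \<le> ennreal e"
    if e: "e > 0" for e
  proof -
    have "(\<lambda>n. \<integral>x. norm (u (r n) x - v x) powr q \<partial>M) \<longlonglongrightarrow> 0"
      using lim by (simp add: Lp_norm_tendsto_0_iff[OF q])
    from order_tendstoD(2)[OF this e] show ?thesis
    proof eventually_elim
      case (elim n)
      have "integrable M (\<lambda>x. \<bar>u (r n) x - v x\<bar> powr q)"
        using Lp_space_diff[OF uY v q] by (simp add: Lp_space_def)
      then show ?case using elim by (subst nn_integral_eq_integral) (auto intro!: ennreal_leI)
    qed
  qed
  have v0: "powr_mass M q v \<le> ennreal e" if e: "e > 0" for e
  proof -
    have "powr_mass M q (\<lambda>x. - v x) \<le> ennreal e"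
    proof (rule nn_integral_powr_Fatou[OF _ _ q small[OF e]])
      show "AE x in M. (\<lambda>n. u (r n) x - v x) \<longlonglongrightarrow> - v x"
        using z
      proof eventually_elim
        case (elim x)
        from tendsto_diff[OF LIMSEQ_subseq_LIMSEQ[OF elim r] tendsto_const[of "v x"]]
        show ?case by (simp add: comp_def)
      qed
    qed measurable
    then show ?thesis by simp
  qed
  \<comment> \<open>Chosen so that 2^q (e + e) = c / 2, strictly below the assumed lower
    bound.\<close>
  define e where "e = c / (4 * 2 powr q)"
  have e: "e > 0" using c by (simp add: e_def)
  obtain n where n: "powr_mass M q (\<lambda>x. u (r n) x - v x) \<le> ennreal e"
    using eventually_happens[OF small[OF e]] by auto
  have "ennreal c \<le> powr_mass M q (\<lambda>x. (u (r n) x - v x) + v x)"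
    using lower[of "r n"] by simp
  also have "\<dots> \<le> ennreal (2 powr q) * (powr_mass M q (\<lambda>x. u (r n) x - v x)
      + powr_mass M q v)"
    using q by (intro nn_integral_powr_add_le) auto
  also have "\<dots> \<le> ennreal (2 powr q) * (ennreal e + ennreal e)"
    by (intro mult_left_mono add_mono n v0 e) auto
  also have "\<dots> = ennreal (2 powr q * (e + e))"
    unfolding ennreal_mult'[OF powr_ge_zero] using e by (subst ennreal_plus) auto
  also have "2 powr q * (e + e) = c / 2" by (simp add: e_def)
  finally show False using c by simp
qed

subsection \<open>A concentrating sequence of radial functions\<close>

lemma power_over_fact_le_exp:
  assumes "(y::real) \<ge> 0"
  shows "y ^ n / fact n \<le> exp y"
proof -
  have "(\<lambda>n. y ^ n /\<^sub>R fact n) sums exp y" by (rule exp_converges)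
  then have s: "summable (\<lambda>n. y ^ n /\<^sub>R fact n)" "exp y = (\<Sum>n. y ^ n /\<^sub>R fact n)"
    by (auto simp: sums_iff)
  have "(\<Sum>i\<in>{n}. y ^ i /\<^sub>R fact i) \<le> (\<Sum>n. y ^ n /\<^sub>R fact n)"
    by (rule sum_le_suminf[OF s(1)]) (use assms in auto)
  then show ?thesis by (simp add: s(2) divide_inverse mult.commute)
qed

text \<open>\<open>flat 0\<close> is the standard smooth function exp (-1/t), extended by 0; the
  factors 1/t make the linear span of the family closed under differentiation.\<close>

definition flat :: "nat \<Rightarrow> real \<Rightarrow> real" where
  "flat j t = (if t > 0 then (1 / t) ^ j * exp (- (1 / t)) else 0)"

lemma flat_nonneg: "flat j t \<ge> 0"
  by (simp add: flat_def)

lemma power_exp_minus_le: "(y::real) \<ge> 0 \<Longrightarrow> y ^ n * exp (- y) \<le> fact n"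
  using power_over_fact_le_exp[of y n] by (simp add: exp_minus field_simps)

lemma flat_le: "flat j t \<le> fact j"
  unfolding flat_def using power_exp_minus_le[of "1 / t" j] by auto

text \<open>Keeping two extra powers of 1/t under the exponential shows vanishing to second order at
  0, which gives derivative 0 there.\<close>

lemma flat_le_square: "flat j t \<le> fact (j + 2) * t\<^sup>2"
proof (cases "t > 0")
  case True
  have "(1 / t) ^ (j + 2) * exp (- (1 / t)) * t\<^sup>2 \<le> fact (j + 2) * t\<^sup>2"
    using True by (intro mult_right_mono power_exp_minus_le) auto
  moreover have "(1 / t) ^ (j + 2) * exp (- (1 / t)) * t\<^sup>2 = flat j t"
    using True by (simp add: flat_def power_add power_divide power2_eq_square)
  ultimately show ?thesis by simp
qed (simp add: flat_def)

lemma flat_DERIV: "(flat j has_real_derivative (flat (j + 2) t - real j * flat (j + 1) t)) (at t)"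
proof (cases "t = 0")
  case True
  have "((\<lambda>h. (flat j (0 + h) - flat j 0) / h) \<longlongrightarrow> 0) (at 0)"
  proof (rule Lim_null_comparison)
    have "((\<lambda>h::real. fact (j + 2) * \<bar>h\<bar>) \<longlongrightarrow> fact (j + 2) * \<bar>0\<bar>) (at 0)"
      by (intro tendsto_intros)
    then show "((\<lambda>h::real. fact (j + 2) * \<bar>h\<bar>) \<longlongrightarrow> 0) (at 0)" by simp
    have "norm ((flat j (0 + h) - flat j 0) / h) \<le> fact (j + 2) * \<bar>h\<bar>" if "h \<noteq> 0" for h
    proof -
      have "flat j h / \<bar>h\<bar> \<le> fact (j + 2) * h\<^sup>2 / \<bar>h\<bar>"
        by (intro divide_right_mono flat_le_square) simp
      also have "\<dots> = fact (j + 2) * \<bar>h\<bar>" using that by (simp add: power2_eq_square abs_if)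
      finally show ?thesis using flat_nonneg[of j h] by (simp add: flat_def[of j 0])
    qed
    then show "\<forall>\<^sub>F h in at 0. norm ((flat j (0 + h) - flat j 0) / h) \<le> fact (j + 2) * \<bar>h\<bar>"
      by (auto simp: eventually_at intro!: exI[of _ 1])
  qed
  then show ?thesis using True by (simp add: DERIV_def flat_def[of _ 0])
next
  case False
  show ?thesis
  proof (cases "t > 0")
    case True
    have "((\<lambda>t. (1 / t) ^ j * exp (- (1 / t))) has_real_derivative
        (real j * (1 / t) ^ (j - 1) * (- 1 / t\<^sup>2)) * exp (- (1 / t)) + exp (- (1 / t)) * (1 / t\<^sup>2)
          * (1 / t) ^ j) (at t)"
      using True by (auto intro!: derivative_eq_intros simp: power2_eq_square)
    moreover have "(real j * (1 / t) ^ (j - 1) * (- 1 / t\<^sup>2)) * exp (- (1 / t)) + exp (- (1 / t))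
        * (1 / t\<^sup>2) * (1 / t) ^ j
        = flat (j + 2) t - real j * flat (j + 1) t"
    proof -
      have "real j * (1 / t) ^ (j - 1) * (1 / t\<^sup>2) = real j * (1 / t) ^ (j + 1)"
        by (cases j) (simp_all add: power2_eq_square)
      then show ?thesis using True by (simp add: flat_def power_add power2_eq_square algebra_simps)
    qed
    ultimately have "((\<lambda>t. (1 / t) ^ j * exp (- (1 / t))) has_real_derivative
        flat (j + 2) t - real j * flat (j + 1) t) (at t)" by simp
    then show ?thesis
      by (rule has_field_derivative_transform_within_open[of _ _ _ "{0<..}"])
        (use True in \<open>auto simp: flat_def\<close>)
  next
    case nonpos: False
    have "((\<lambda>t. 0) has_real_derivative 0) (at t)" by simp
    then have "(flat j has_real_derivative 0) (at t)"
      by (rule has_field_derivative_transform_within_open[of _ _ _ "{..<0}"])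
        (use False nonpos in \<open>auto simp: flat_def\<close>)
    then show ?thesis using nonpos by (simp add: flat_def)
  qed
qed

text \<open>For \<eta> = 0 and t = - ln |x| this is 2t/k - 1, positive exactly for t > k/2;
  \<open>flat\<close> cuts it off below that threshold.\<close>

definition log_scale :: "real \<Rightarrow> real \<Rightarrow> real^2 \<Rightarrow> real" where
  "log_scale \<eta> k x = - 1 - ln (x \<bullet> x + \<eta>) / k"

text \<open>The members of this class are smooth because it is closed under directional derivatives.\<close>

inductive smooth_generated :: "real \<Rightarrow> real \<Rightarrow> (real^2 \<Rightarrow> real) \<Rightarrow> bool" for \<eta> k where
  const: "smooth_generated \<eta> k (\<lambda>x. c)"
| inner: "smooth_generated \<eta> k (\<lambda>x. x \<bullet> v)"
| inv: "smooth_generated \<eta> k (\<lambda>x. 1 / (x \<bullet> x + \<eta>))"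
| flat: "smooth_generated \<eta> k (\<lambda>x. flat j (log_scale \<eta> k x))"
| add: "smooth_generated \<eta> k f \<Longrightarrow> smooth_generated \<eta> k g \<Longrightarrow> smooth_generated \<eta> k (\<lambda>x. f x + g x)"
| mult: "smooth_generated \<eta> k f \<Longrightarrow> smooth_generated \<eta> k g \<Longrightarrow> smooth_generated \<eta> k (\<lambda>x. f x * g x)"

lemma flat_log_scale_has_derivative:
  assumes "\<eta> > 0"
  shows "((\<lambda>x. flat j (log_scale \<eta> k x)) has_derivative
    (\<lambda>v. (flat (j + 2) (log_scale \<eta> k x) + (- real j) * flat (j + 1) (log_scale \<eta> k x))
       * ((- 2 / k) * ((x \<bullet> v) * (1 / (x \<bullet> x + \<eta>)))))) (at x)"
proof -
  have p: "x \<bullet> x + \<eta> > 0" using assms by (simp add: add_nonneg_pos)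
  have 1: "(log_scale \<eta> k has_derivative (\<lambda>v. (- 2 / k) * ((x \<bullet> v) * (1 / (x \<bullet> x + \<eta>))))) (at x)"
    unfolding log_scale_def[abs_def] using p
    by (auto intro!: derivative_eq_intros simp: inner_commute divide_inverse algebra_simps)
  have 2: "(flat j has_derivative (*) (flat (j + 2) (log_scale \<eta> k x) - real j * flat (j
      + 1) (log_scale \<eta> k x)))
     (at (log_scale \<eta> k x))"
    using flat_DERIV[of j "log_scale \<eta> k x"] by (simp only: has_field_derivative_def)
  show ?thesis using has_derivative_compose[OF 1 2] by simp
qed

text \<open>\<open>log_scale\<close> occurs only inside \<open>flat\<close>; its derivative is
  rational, -2/k times the inner product with v over x \<bullet> x + \<eta>, and is built from
  \<open>inner\<close> and \<open>inv\<close>.\<close>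

lemma smooth_generated_derivative:
  assumes "smooth_generated \<eta> k f" and "\<eta> > 0"
  shows "\<exists>f'. (\<forall>x. (f has_derivative f' x) (at x)) \<and> (\<forall>v. smooth_generated \<eta> k (\<lambda>x. f' x v))"
  using assms(1)
proof induction
  case (const c)
  show ?case by (intro exI[of _ "\<lambda>x v. 0"]) (auto intro: smooth_generated.const)
next
  case (inner w)
  show ?case
    by (intro exI[of _ "\<lambda>x v. v \<bullet> w"])
       (auto intro!: smooth_generated.const bounded_linear_imp_has_derivative bounded_linear_inner_left)
next
  case inv
  have "((\<lambda>x. 1 / (x \<bullet> x + \<eta>)) has_derivative
     (\<lambda>v. (- 2) * ((x \<bullet> v) * (1 / (x \<bullet> x + \<eta>) * (1 / (x \<bullet> x + \<eta>)))))) (at x)" for x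
  proof -
    have "x \<bullet> x + \<eta> > 0" using assms(2) by (simp add: add_nonneg_pos)
    then show ?thesis
      by (auto intro!: derivative_eq_intros simp: inner_commute divide_inverse algebra_simps)
  qed
  moreover have "smooth_generated \<eta> k (\<lambda>x. (- 2) * ((x \<bullet> v) * (1 / (x \<bullet> x + \<eta>) * (1 / (x \<bullet> x + \<eta>)))))" for v
    by (intro smooth_generated.intros)
  ultimately show ?case
    by (intro exI[of _ "\<lambda>x v. (- 2) * ((x \<bullet> v) * (1 / (x \<bullet> x + \<eta>) * (1 / (x \<bullet> x + \<eta>))))"]) blast
next
  case (flat j)
  show ?case
    by (intro exI conjI allI, rule flat_log_scale_has_derivative[OF assms(2)])
       (intro smooth_generated.intros)
next
  case (add f g)
  then obtain f' g' where
    "\<And>x. (f has_derivative f' x) (at x)" "\<And>v. smooth_generated \<eta> k (\<lambda>x. f' x v)"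
    "\<And>x. (g has_derivative g' x) (at x)" "\<And>v. smooth_generated \<eta> k (\<lambda>x. g' x v)" by blast
  then show ?case
    by (intro exI[of _ "\<lambda>x v. f' x v + g' x v"])
       (auto intro!: has_derivative_add smooth_generated.add)
next
  case (mult f g)
  then obtain f' g' where
    "\<And>x. (f has_derivative f' x) (at x)" "\<And>v. smooth_generated \<eta> k (\<lambda>x. f' x v)"
    "\<And>x. (g has_derivative g' x) (at x)" "\<And>v. smooth_generated \<eta> k (\<lambda>x. g' x v)" by blast
  then show ?case using mult(1,2)
    by (intro exI[of _ "\<lambda>x v. f x * g' x v + f' x v * g x"])
       (auto intro!: has_derivative_mult smooth_generated.add smooth_generated.mult)
qed

lemma smooth_generated_Ck:
  assumes "\<eta> > 0"
  shows "smooth_generated \<eta> k f \<Longrightarrow> Ck n f"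
proof (induction n arbitrary: f)
  case 0
  obtain f' where "\<And>x. (f has_derivative f' x) (at x)"
    using smooth_generated_derivative[OF 0 assms] by blast
  then show ?case by (auto intro: has_derivative_continuous_on)
next
  case (Suc n)
  obtain f' where "\<And>x. (f has_derivative f' x) (at x)" "\<And>v. smooth_generated \<eta> k (\<lambda>x. f' x v)"
    using smooth_generated_derivative[OF Suc.prems assms] by blast
  then show ?case using Suc.IH by (intro Ck_SucI) auto
qed

text \<open>In the variable \<open>t = - ln |x|\<close> this is the Moser-type profile \<open>\<surd>k \<cdot> min(1, t/k)\<close> up to
  smoothing; \<open>\<eta> = e\<^sup>-\<^sup>4\<^sup>k\<close> only removes the singularity at the origin.\<close>

definition moser :: "nat \<Rightarrow> real^2 \<Rightarrow> real" where
  "moser k x = sqrt (real k) * flat 0 (log_scale (exp (- 4 * real k)) (real k) x)"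

lemma log_scale_pos_iff:
  assumes "\<eta> > 0" "k > 0"
  shows "log_scale \<eta> k x > 0 \<longleftrightarrow> x \<bullet> x + \<eta> < exp (- k)"
proof -
  have p: "x \<bullet> x + \<eta> > 0" using assms by (simp add: add_nonneg_pos)
  have "log_scale \<eta> k x > 0 \<longleftrightarrow> ln (x \<bullet> x + \<eta>) < - k"
    using assms by (simp add: log_scale_def field_simps)
  also have "\<dots> \<longleftrightarrow> x \<bullet> x + \<eta> < exp (- k)" using p by (metis exp_less_cancel_iff exp_ln)
  finally show ?thesis .
qed

lemma moser_eq_0:
  assumes "k > 0" "exp (- real k) \<le> x \<bullet> x"
  shows "moser k x = 0"
proof -
  have "\<not> log_scale (exp (- 4 * real k)) (real k) x > 0"
    using assms by (subst log_scale_pos_iff) (auto simp: not_less intro: order_trans)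
  then show ?thesis by (simp add: moser_def flat_def)
qed

lemma moser_test_function:
  assumes "k > 0"
  shows "moser k \<in> test_functions disc"
proof (rule test_function_discI)
  show "Ck n (moser k)" for n
    unfolding moser_def[abs_def]
    by (rule smooth_generated_Ck[of "exp (- 4 * real k)" "real k"]) (auto intro: smooth_generated.intros)
  show "exp (- real k / 2) < 1" using assms by simp
  fix x :: "real^2" assume "norm x > exp (- real k / 2)"
  then have "(exp (- real k / 2))\<^sup>2 \<le> (norm x)\<^sup>2" by (intro power_mono) auto
  then have "exp (- real k) \<le> x \<bullet> x" by (simp add: power2_norm_eq_inner flip: exp_double)
  then show "moser k x = 0" by (rule moser_eq_0[OF assms])
qed

lemma moser_has_derivative:
  "(moser k has_derivative (\<lambda>v. (sqrt (real k) * flat 2 (log_scale (exp (- 4 * real k)) (real k) x)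
      * (- 2 / real k) * (1 / (x \<bullet> x + exp (- 4 * real k)))) *\<^sub>R x \<bullet> v)) (at x)"
proof -
  have "((\<lambda>x. flat 0 (log_scale (exp (- 4 * real k)) (real k) x)) has_derivative
    (\<lambda>v. flat 2 (log_scale (exp (- 4 * real k)) (real k) x)
       * ((- 2 / real k) * ((x \<bullet> v) * (1 / (x \<bullet> x + exp (- 4 * real k))))))) (at x)"
    using flat_log_scale_has_derivative[of "exp (- 4 * real k)" 0 "real k" x]
    by (simp add: numeral_2_eq_2)
  from has_derivative_mult_right[OF this, of "sqrt (real k)"] show ?thesis
    unfolding moser_def[abs_def] by (simp add: mult_ac)
qed

text \<open>The constant 16 is 4 times 2^2: the 4 comes from the derivative -2/k of the logarithmic
  scale, and 2 = \<open>fact 2\<close> bounds \<open>flat 2\<close>.\<close>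

lemma moser_gradient_le:
  assumes "k > 0"
  shows "(norm (gradient (moser k) x))\<^sup>2 \<le> 16 / real k * (1 / (x \<bullet> x + exp (- 4 * real k)))"
proof -
  define \<eta> where "\<eta> = exp (- 4 * real k)"
  define f where "f = flat 2 (log_scale \<eta> (real k) x)"
  define s where "s = x \<bullet> x + \<eta>"
  have s: "s > 0" "x \<bullet> x \<le> s" unfolding s_def \<eta>_def by (simp_all add: add_nonneg_pos)
  have f: "0 \<le> f" "f \<le> 2" using flat_nonneg[of 2] flat_le[of 2] by (simp_all add: f_def)
  note T = moser_test_function[OF assms]
  define G where "G = (sqrt (real k) * f * (- 2 / real k) * (1 / s)) *\<^sub>R x"
  have "(moser k has_derivative (\<lambda>v. G \<bullet> v)) (at x)"
    using moser_has_derivative[of k x] by (simp only: G_def f_def s_def \<eta>_def)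
  from has_derivative_unique[OF this C1c_deriv[OF test_function_C1c[OF T]]]
  have "G \<bullet> v = gradient (moser k) x \<bullet> v" for v by metis
  then have "gradient (moser k) x = G" by (metis vector_eq_rdot)
  then have "(norm (gradient (moser k) x))\<^sup>2 = (sqrt (real k) * f * (- 2 / real k) * (1 / s))\<^sup>2 * (x \<bullet> x)"
    unfolding G_def power2_norm_eq_inner
        by (simp only: inner_scaleR_left inner_scaleR_right power2_eq_square mult.assoc)
  also have "\<dots> = (4 / real k * f\<^sup>2) * ((x \<bullet> x) * (1 / s)\<^sup>2)"
    using assms by (simp add: power_mult_distrib power_divide) (simp add: power2_eq_square)
  also have "\<dots> \<le> (4 / real k * 2\<^sup>2) * (s * (1 / s)\<^sup>2)"
    using f s by (intro mult_mono power_mono) auto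
  also have "\<dots> = 16 / real k * (1 / s)" using s by (simp add: power2_eq_square)
  finally show ?thesis by (simp only: s_def \<eta>_def)
qed

lemma moser_energy:
  assumes k: "k > 0"
  shows "energy lborel (gradient (moser k)) \<le> 80 * pi"
proof -
  define \<eta> where "\<eta> = exp (- 4 * real k)"
  have \<eta>: "\<eta> > 0" by (simp add: \<eta>_def)
  note T = moser_test_function[OF k] and i
      = C1c_integrable(4)[OF test_function_C1c[OF moser_test_function[OF k]]]
  define F where "F = (\<lambda>t. 16 / real k * (1 / (exp (- 2 * t) + \<eta>)))"
  have Fm[measurable]: "F \<in> borel_measurable borel" unfolding F_def by measurable
  have "ennreal (energy lborel (gradient (moser k)))
      = (\<integral>\<^sup>+x. ennreal ((norm (gradient (moser k) x))\<^sup>2) \<partial>lborel)"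
    using i by (intro nn_integral_eq_integral[symmetric]) auto
  also have "\<dots> \<le> (\<integral>\<^sup>+x. ennreal (F (- ln (norm (x::real^2)))) * indicator disc x \<partial>lborel)"
  proof (rule nn_integral_mono_AE)
    show "AE x in lborel. ennreal ((norm (gradient (moser k) x))\<^sup>2)
        \<le> ennreal (F (- ln (norm (x::real^2)))) * indicator disc x"
      using AE_lborel_neq[of 0]
    proof eventually_elim
      case (elim x)
      have "exp (- 2 * - ln (norm x)) = x \<bullet> x"
        using elim by (simp add: exp_double power2_norm_eq_inner)
      then have "(norm (gradient (moser k) x))\<^sup>2 \<le> F (- ln (norm x))"
        using moser_gradient_le[OF k, of x] by (simp add: F_def \<eta>_def)
      then show ?case
        using test_function_zero(2)[OF T, of x] by (cases "x \<in> disc") (auto intro: ennreal_leI)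
    qed
  qed
  also have "\<dots> = (\<integral>\<^sup>+t. ennreal (2 * pi * exp (- 2 * t)) * indicator {0..} t * ennreal (F t) \<partial>lborel)"
    by (rule nn_integral_polar_log) measurable
  also have "\<dots> = (\<integral>\<^sup>+t. ennreal (2 * pi * exp (- 2 * t) * F t) * indicator {0..} t \<partial>lborel)"
  proof (intro nn_integral_cong)
    fix t
    have "ennreal (2 * pi * exp (- 2 * t) * F t) = ennreal (2 * pi * exp (- 2 * t)) * ennreal (F t)"
      by (rule ennreal_mult') simp
    then show "ennreal (2 * pi * exp (- 2 * t)) * indicator {0..} t * ennreal (F t)
        = ennreal (2 * pi * exp (- 2 * t) * F t) * indicator {0..} t"
      by (simp only: mult_ac)
  qed
  \<comment> \<open>The primitive is a logarithm. Its increment ln (1 + \<eta>) - ln \<eta> is at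
    most k + 4k because \<eta> = exp (-4k), which cancels the prefactor 1/k and leaves 16 pi times
    5.\<close>
  also have "\<dots> = ennreal (- (16 * pi / real k) * ln \<eta> - (- (16 * pi / real k) * ln (exp (- 2 * 0) + \<eta>)))"
  proof (rule nn_integral_FTC_atLeast)
    have p: "exp (- 2 * t) + \<eta> > 0" for t using \<eta> by (simp add: add_pos_pos)
    show "((\<lambda>t. - (16 * pi / real k) * ln (exp (- 2 * t) + \<eta>)) has_real_derivative
        2 * pi * exp (- 2 * t) * F t) (at t)" for t
      using p[of t] k by (auto intro!: derivative_eq_intros simp: F_def mult_ac)
    show "0 \<le> 2 * pi * exp (- 2 * t) * F t" for t using p[of t] by (simp add: F_def)
    have "filterlim (\<lambda>s::real. - 2 * s) at_bot at_top"
      by (rule filterlim_tendsto_neg_mult_at_bot[OF tendsto_const _ filterlim_ident]) simp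
    from filterlim_compose[OF exp_at_bot this]
    have "((\<lambda>t. - (16 * pi / real k) * ln (exp (- 2 * t) + \<eta>)) \<longlongrightarrow> - (16 * pi / real k) * ln (0 + \<eta>)) at_top"
      using \<eta> by (intro tendsto_intros) auto
    then show "((\<lambda>t. - (16 * pi / real k) * ln (exp (- 2 * t) + \<eta>)) \<longlongrightarrow> - (16 * pi / real k) * ln \<eta>) at_top"
      by simp
  qed measurable
  also have "\<dots> \<le> ennreal (80 * pi)"
  proof (rule ennreal_leI)
    have "\<eta> \<le> 1" by (simp add: \<eta>_def)
    then have "ln (1 + \<eta>) \<le> 1" using ln_add_one_self_le_self[of \<eta>] \<eta> by simp
    then have "ln (1 + \<eta>) \<le> real k" using k by simp
    moreover have "ln \<eta> = - 4 * real k" by (simp add: \<eta>_def)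
    ultimately have "ln (1 + \<eta>) - ln \<eta> \<le> 5 * real k" by simp
    then have "16 * pi / real k * (ln (1 + \<eta>) - ln \<eta>) \<le> 16 * pi / real k * (5 * real k)"
      by (intro mult_left_mono) auto
    also have "\<dots> = 80 * pi" using k by simp
    finally show "- (16 * pi / real k) * ln \<eta> - (- (16 * pi / real k) * ln (exp (- 2 * 0) + \<eta>)) \<le> 80 * pi"
      by (simp add: right_diff_distrib)
  qed
  finally show ?thesis by simp
qed

text \<open>On the annulus 3k/2 \<le> - ln |x| \<le> 2k the function is at least sqrt k / exp 1 and
  the logarithm in the weight at most k (2 + ln a). The powers k^(q/2) and k^(-1 - q/2) and the
  logarithmic width k/2 multiply to a constant, so the bound is independent of k.\<close>

lemma moser_lower_bound:
  assumes a: "a > 1" and q: "q \<ge> 2" and k: "k > 0"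
  shows "ennreal (pi * exp (- q) * (2 + ln a) powr (- 1 - q / 2))
    \<le> powr_mass (log_measure a q) q (moser k)"
proof -
  define \<kappa> where "\<kappa> = (sqrt (real k) * exp (- 1)) powr q * (real k * (2 + ln a)) powr (- 1 - q / 2)"
  define F where "F = (\<lambda>t. \<kappa> * indicator {3 / 2 * real k..2 * real k} t)"
  have Fm[measurable]: "F \<in> borel_measurable borel" unfolding F_def by measurable
  have A: "ln a > 0" using a by simp
  have \<kappa>0: "\<kappa> \<ge> 0" by (simp add: \<kappa>_def)
  note T = moser_test_function[OF k]
  have [measurable]: "moser k \<in> borel_measurable disc_measure"
    by (rule borel_measurable_disc_measure[OF test_function_measurable(1)[OF T]])
  have \<kappa>: "\<kappa> * (pi * real k) = pi * exp (- q) * (2 + ln a) powr (- 1 - q / 2)"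
  proof -
    have e1: "(sqrt (real k) * exp (- 1)) powr q = real k powr (q / 2) * exp (- q)"
    proof -
      have "(sqrt (real k) * exp (- 1)) powr q = sqrt (real k) powr q * exp (- 1) powr q"
        by (rule powr_mult)
      also have "sqrt (real k) powr q = (real k powr (1 / 2)) powr q" by (simp add: powr_half_sqrt)
      also have "\<dots> = real k powr (q / 2)" by (simp add: powr_powr)
      also have "exp (- 1) powr q = exp (- q)" by (simp add: powr_def)
      finally show ?thesis .
    qed
    have e2: "(real k * (2 + ln a)) powr (- 1 - q / 2)
        = real k powr (- 1 - q / 2) * (2 + ln a) powr (- 1 - q / 2)"
      by (rule powr_mult)
    have "real k powr (q / 2) * real k powr (- 1 - q / 2) = real k powr (- 1)"
      by (simp flip: powr_add)
    also have "\<dots> = 1 / real k" by (simp add: powr_minus divide_inverse)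
    finally have e3: "real k powr (q / 2) * real k powr (- 1 - q / 2) * real k = 1" using k by simp
    have "\<kappa> * (pi * real k) = (real k powr (q / 2) * real k powr (- 1 - q / 2) * real k)
        * (pi * exp (- q) * (2 + ln a) powr (- 1 - q / 2))"
      unfolding \<kappa>_def e1 e2 by (simp only: mult_ac)
    then show ?thesis unfolding e3 by simp
  qed
  have pt: "F (- ln (norm x)) * (1 / (norm x)\<^sup>2) \<le> log_weight a q x * \<bar>moser k x\<bar> powr q"
    if x: "x \<noteq> 0" for x :: "real^2"
  proof (cases "- ln (norm x) \<in> {3 / 2 * real k..2 * real k}")
    case True
    define t where "t = - ln (norm x)"
    have t: "3 / 2 * real k \<le> t" "t \<le> 2 * real k" using True by (simp_all add: t_def)
    have nx: "norm x = exp (- t)" using x by (simp add: t_def)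
    have xx: "x \<bullet> x = exp (- 2 * t)" by (simp add: nx power2_norm_eq_inner[symmetric] flip: exp_double)
    \<comment> \<open>Both summands are at most exp (-3k) on the annulus, and the resulting factor 2
      is absorbed by exp (-k). This puts \<open>log_scale\<close> above 1, where
      \<open>flat 0\<close> is at least exp (-1).\<close>
    have "x \<bullet> x + exp (- 4 * real k) \<le> exp (- 3 * real k) + exp (- 3 * real k)"
      unfolding xx using t by (intro add_mono) auto
    also have "\<dots> = 2 * exp (- real k) * exp (- 2 * real k)" by (simp flip: exp_add)
    also have "\<dots> \<le> 1 * exp (- 2 * real k)"
    proof (rule mult_right_mono)
      have "2 \<le> exp (1::real)" using exp_ge_add_one_self[of 1] by simp
      also have "\<dots> \<le> exp (real k)" using k by simp
      finally show "2 * exp (- real k) \<le> 1" by (simp add: exp_minus field_simps)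
    qed simp
    finally have "x \<bullet> x + exp (- 4 * real k) \<le> exp (- 2 * real k)" by simp
    moreover have "x \<bullet> x + exp (- 4 * real k) > 0" by (simp add: add_nonneg_pos)
    ultimately have "ln (x \<bullet> x + exp (- 4 * real k)) \<le> - 2 * real k"
      by (metis exp_gt_zero ln_exp ln_le_cancel_iff)
    then have ls: "log_scale (exp (- 4 * real k)) (real k) x \<ge> 1"
      using k by (simp add: log_scale_def field_simps)
    then have "exp (- 1) \<le> flat 0 (log_scale (exp (- 4 * real k)) (real k) x)"
      by (simp add: flat_def)
    then have "sqrt (real k) * exp (- 1) \<le> \<bar>moser k x\<bar>"
      unfolding moser_def using mult_left_mono[of "exp (- 1)" _ "sqrt (real k)"]
          by (simp add: abs_mult flat_nonneg)
    then have 1: "(sqrt (real k) * exp (- 1)) powr q \<le> \<bar>moser k x\<bar> powr q"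
      using q by (intro powr_mono2) auto
    have "ln (a / norm x) = ln a + t" using a x by (simp add: ln_div t_def)
    moreover have "ln a + t \<le> real k * (2 + ln a)"
    proof -
      have "1 * ln a \<le> real k * ln a" using k A by (intro mult_right_mono) auto
      then show ?thesis using t by (simp add: distrib_left)
    qed
    moreover have "0 < ln a + t" using A t k by (simp add: add_pos_nonneg)
    ultimately have 2: "(real k * (2 + ln a)) powr (- 1 - q / 2) \<le> ln (a / norm x) powr (- 1 - q / 2)"
      using q by (intro powr_mono2') auto
    have "F t * (1 / (norm x)\<^sup>2)
        = (1 / (norm x)\<^sup>2) * (real k * (2 + ln a)) powr (- 1 - q / 2) * (sqrt (real k) * exp (- 1)) powr q"
      using t by (simp add: F_def \<kappa>_def)
    also have "\<dots> \<le> (1 / (norm x)\<^sup>2) * ln (a / norm x) powr (- 1 - q / 2) * \<bar>moser k x\<bar> powr q"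
      by (intro mult_mono 1 2) auto
    finally have "F t * (1 / (norm x)\<^sup>2)
      \<le> (1 / (norm x)\<^sup>2) * ln (a / norm x) powr (- 1 - q / 2) * \<bar>moser k x\<bar> powr q" .
    moreover have "norm x powr (- 2) = 1 / (norm x)\<^sup>2" using x by (simp add: powr_minus divide_inverse)
    ultimately show ?thesis by (simp only: t_def log_weight_def)
  qed (simp add: F_def log_weight_nonneg)
  have "ennreal (\<kappa> * (pi * real k)) = ennreal (2 * pi) * ennreal (\<kappa> * (2 * real k - 3 / 2 * real k))"
    by (subst ennreal_mult'[symmetric]) (auto simp: \<kappa>_def)
  also have "ennreal (\<kappa> * (2 * real k - 3 / 2 * real k))
      = (\<integral>\<^sup>+t. ennreal (F t) * indicator {0..} t \<partial>lborel)"
  proof -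
    have "(\<integral>\<^sup>+t. ennreal (F t) * indicator {0..} t \<partial>lborel)
        = (\<integral>\<^sup>+t. ennreal \<kappa> * indicator {3 / 2 * real k..2 * real k} t \<partial>lborel)"
      using k by (intro nn_integral_cong) (auto simp: F_def indicator_def)
    also have "\<dots> = ennreal \<kappa> * ennreal (2 * real k - 3 / 2 * real k)"
      by (simp add: nn_integral_cmult_indicator)
    finally show ?thesis unfolding ennreal_mult'[OF \<kappa>0] by (rule sym)
  qed
  also have "ennreal (2 * pi) * (\<integral>\<^sup>+t. ennreal (F t) * indicator {0..} t \<partial>lborel)
      = (\<integral>\<^sup>+x. ennreal (F (- ln (norm (x::real^2)))) * ennreal (1 / (norm x)\<^sup>2) * indicator disc x \<partial>lborel)"
    by (rule nn_integral_polar_log_weighted[symmetric]) measurable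
  also have "\<dots> \<le> (\<integral>\<^sup>+x. ennreal (log_weight a q x) * ennreal (\<bar>moser k x\<bar> powr q)
      * indicator disc x \<partial>lborel)"
  proof (rule nn_integral_mono_AE)
    show "AE x in lborel. ennreal (F (- ln (norm (x::real^2)))) * ennreal (1 / (norm x)\<^sup>2)
        * indicator disc x
      \<le> ennreal (log_weight a q x) * ennreal (\<bar>moser k x\<bar> powr q) * indicator disc x"
      using AE_lborel_neq[of 0]
    proof eventually_elim
      case (elim x)
      have F0: "F (- ln (norm x)) \<ge> 0" using \<kappa>0 by (simp add: F_def)
      from ennreal_leI[OF pt[OF elim]] show ?case
        unfolding ennreal_mult'[OF F0] ennreal_mult'[OF log_weight_nonneg]
        by (rule mult_right_mono) simp
    qed
  qed
  also have "\<dots> = powr_mass (log_measure a q) q (moser k)"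
    by (rule nn_integral_log_measure[symmetric]) measurable
  finally show ?thesis by (simp only: \<kappa>)
qed

lemma moser_tendsto_0:
  assumes "x \<noteq> 0"
  shows "(\<lambda>n. moser (Suc n) x) \<longlonglongrightarrow> 0"
proof -
  have p: "x \<bullet> x > 0" using assms by simp
  obtain N :: nat where N: "- ln (x \<bullet> x) \<le> real N" using real_arch_simple by blast
  have "moser (Suc n) x = 0" if "n \<ge> N" for n
  proof (rule moser_eq_0)
    have "- real (Suc n) \<le> ln (x \<bullet> x)" using N that by simp
    then have "exp (- real (Suc n)) \<le> exp (ln (x \<bullet> x))" by (simp only: exp_le_cancel_iff)
    then show "exp (- real (Suc n)) \<le> x \<bullet> x" by (simp only: exp_ln[OF p])
  qed simp
  then show ?thesis
    by (intro tendsto_eventually eventually_sequentiallyI[of N]) auto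
qed

text \<open>The concentrating sequence is radial, so it lies in every X between
  \<open>H01_rad\<close> and \<open>H01\<close>; both non-compactness claims are instances. The
  index starts at \<open>Suc n\<close> because the profiles are test functions for positive
  k.\<close>

lemma H01_noncompact_embedding:
  assumes a: "a > 1" and q: "q \<ge> 2" and X: "H01_rad \<subseteq> X" "X \<subseteq> H01"
  shows "noncompact_embedding X H01_norm (Lp_space (log_measure a q) q) (Lp_norm (log_measure a q) q)"
  unfolding noncompact_embedding_def
proof
  show ce: "continuous_embedding X H01_norm (Lp_space (log_measure a q) q) (Lp_norm (log_measure a q) q)"
    by (rule continuous_embedding_subset[OF H01_continuous_embedding[OF a q] X(2)])
  note T = moser_test_function[OF zero_less_Suc]
  show "\<not> compact_embedding X H01_norm (Lp_space (log_measure a q) q) (Lp_norm (log_measure a q) q)"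
  proof (rule not_compact_embedding_of_vanishing[where u = "\<lambda>n. moser (Suc n)" and B = "sqrt (80 * pi)"])
    show "moser (Suc n) \<in> X" for n
    proof -
      have "moser (Suc n) x = moser (Suc n) (norm x *\<^sub>R axis 1 1)" for x
        by (simp add: moser_def log_scale_def inner_axis_axis power2_norm_eq_inner[symmetric] power2_eq_square[symmetric])
      then have "\<exists>f. AE x in disc_measure. moser (Suc n) x = f (norm x)"
        by (intro exI[of _ "\<lambda>r. moser (Suc n) (r *\<^sub>R axis 1 1)"]) simp
      moreover have "moser (Suc n) \<in> H01" using has_H01_gradient_test[OF T] by (auto simp: H01_def)
      ultimately show ?thesis using X(1) by (auto simp: H01_rad_def)
    qed
    show "\<bar>H01_norm (moser (Suc n))\<bar> \<le> sqrt (80 * pi)" for n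
      using moser_energy[of "Suc n"]
      by (simp add: H01_norm_eq[OF has_H01_gradient_test[OF T]] energy_disc_measure[OF T])
    show "X \<subseteq> Lp_space (log_measure a q) q" using ce by (simp add: continuous_embedding_def)
    show "AE x in log_measure a q. (\<lambda>n. moser (Suc n) x) \<longlonglongrightarrow> 0"
      using AE_lborel_neq[of "0::real^2"]
      by (intro AE_log_measure_lborelI) (auto elim!: eventually_mono intro: moser_tendsto_0)
    show "pi * exp (- q) * (2 + ln a) powr (- 1 - q / 2) > 0"
      using ln_gt_zero[OF a] by (intro mult_pos_pos) auto
    show "ennreal (pi * exp (- q) * (2 + ln a) powr (- 1 - q / 2))
      \<le> powr_mass (log_measure a q) q (moser (Suc n))" for n
      by (rule moser_lower_bound[OF a q zero_less_Suc])
  qed (use q in simp)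
qed

theorem corollary1:
  fixes a q :: real
  assumes "a > 1" and "q \<ge> 2"
  shows "noncompact_embedding H01 H01_norm
           (Lp_space (log_measure a q) q) (Lp_norm (log_measure a q) q) \<and>
         noncompact_embedding H01_rad H01_norm
           (Lp_space (log_measure a q) q) (Lp_norm (log_measure a q) q) \<and>
         compact_embedding H01_rad_perp H01_norm
           (Lp_space (log_measure a q) q) (Lp_norm (log_measure a q) q)"
  using H01_noncompact_embedding[OF assms, of H01] H01_noncompact_embedding[OF assms, of H01_rad]
    rad_perp_compact_embedding[OF assms]
  by (auto simp: H01_rad_def)

end
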